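(* Let $R$ be a commutative ring and $\mathbb B=\mathbb B_R$ the biset category. There is an internal Hom construction on $\mathbb B$, given by $\mathcal H(\mathcal C,\mathcal E)=\mathcal E\times\tau(\mathcal C)$. For all finite categories $\mathcal C,\mathcal D,\mathcal E$ it satisfies $$\mathrm{Hom}_{\mathbb B}(\mathcal C\times\mathcal D,\mathcal E)\cong\mathrm{Hom}_{\mathbb B}(\mathcal D,\mathcal H(\mathcal C,\mathcal E)),$$ and also $$\mathcal H(\mathcal C\times\mathcal D,\mathcal E)\cong\mathcal H(\mathcal D,\mathcal H(\mathcal C,\mathcal E)).$$
   Context: All categories are finite and $\mathrm{Set}$ is the category of finite sets. A $(\mathcal C,\mathcal D)$-biset is a functor $\Omega:\mathcal C\times\mathcal D^{\mathrm{op}}\to\mathrm{Set}$. The composite of a $(\mathcal C,\mathcal D)$-biset $\Omega$ and a $(\mathcal D,\mathcal E)$-biset $\Psi$ is $(\Omega\circ\Psi)(x,z)=\left(\bigsqcup_{y}\Omega(x,y)\times\Psi(y,z)\right)/\sim$, with $\sim$ generated by $(u\beta,v)\sim(u,\beta v)$ for morphisms $\beta$ of $\mathcal D$. $\mathbb B_R$ has finite categories as objects; $\mathrm{Hom}_{\mathbb B_R}(\mathcal C,\mathcal D)$ is $R\otimes_{\mathbb Z}$ of the Grothendieck group of finite $(\mathcal D,\mathcal C)$-bisets with respect to disjoint union, and composition is the $R$-bilinear extension of $\circ$. The tensor product of objects of $\mathbb B_R$ is the product of categories. $\tau:\mathbb B^{\mathrm{op}}\to\mathbb B$ is the contravariant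 functor given on objects by $\tau(\mathcal C)=\mathcal C^{\mathrm{op}}$ and on morphisms by sending a $(\mathcal C,\mathcal D)$-biset $\Omega$ to the same functor regarded as a $(\mathcal D^{\mathrm{op}},\mathcal C^{\mathrm{op}})$-biset, via $\mathcal C\times\mathcal D^{\mathrm{op}}\cong\mathcal D^{\mathrm{op}}\times(\mathcal C^{\mathrm{op}})^{\mathrm{op}}$. *)

theory Defs
  imports "HOL-Algebra.Module" "HOL-Algebra.Free_Abelian_Groups"
begin

section \<open>Finite categories\<close>

text \<open>\<open>Comp C g f\<close> is the composite \<open>g \<circ> f\<close>, meaningful when \<open>Dom C g = Cod C f\<close>.\<close>

record ('o, 'a) cat =
  Obj :: "'o set"
  Arr :: "'a set"
  Dom :: "'a \<Rightarrow> 'o"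
  Cod :: "'a \<Rightarrow> 'o"
  Ident :: "'o \<Rightarrow> 'a"
  Comp :: "'a \<Rightarrow> 'a \<Rightarrow> 'a"

locale category =
  fixes C :: "('o, 'a) cat"
  assumes Dom_closed: "f \<in> Arr C \<Longrightarrow> Dom C f \<in> Obj C"
    and Cod_closed: "f \<in> Arr C \<Longrightarrow> Cod C f \<in> Obj C"
    and Ident_closed: "x \<in> Obj C \<Longrightarrow> Ident C x \<in> Arr C"
    and Dom_Ident: "x \<in> Obj C \<Longrightarrow> Dom C (Ident C x) = x"
    and Cod_Ident: "x \<in> Obj C \<Longrightarrow> Cod C (Ident C x) = x"
    and Comp_closed: "\<lbrakk>f \<in> Arr C; g \<in> Arr C; Dom C g = Cod C f\<rbrakk> \<Longrightarrow> Comp C g f \<in> Arr C"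
    and Dom_Comp: "\<lbrakk>f \<in> Arr C; g \<in> Arr C; Dom C g = Cod C f\<rbrakk> \<Longrightarrow> Dom C (Comp C g f) = Dom C f"
    and Cod_Comp: "\<lbrakk>f \<in> Arr C; g \<in> Arr C; Dom C g = Cod C f\<rbrakk> \<Longrightarrow> Cod C (Comp C g f) = Cod C g"
    and Comp_Ident: "f \<in> Arr C \<Longrightarrow> Comp C f (Ident C (Dom C f)) = f"
    and Ident_Comp: "f \<in> Arr C \<Longrightarrow> Comp C (Ident C (Cod C f)) f = f"
    and Comp_assoc: "\<lbrakk>f \<in> Arr C; g \<in> Arr C; h \<in> Arr C; Dom C g = Cod C f; Dom C h = Cod C g\<rbrakk>
           \<Longrightarrow> Comp C h (Comp C g f) = Comp C (Comp C h g) f"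

locale finite_category = category +
  assumes finite_Obj: "finite (Obj C)"
    and finite_Arr: "finite (Arr C)"

definition op_cat :: "('o, 'a) cat \<Rightarrow> ('o, 'a) cat" where
  "op_cat C = \<lparr>Obj = Obj C, Arr = Arr C, Dom = Cod C, Cod = Dom C, Ident = Ident C,
     Comp = (\<lambda>g f. Comp C f g)\<rparr>"

definition prod_cat :: "('o, 'a) cat \<Rightarrow> ('p, 'b) cat \<Rightarrow> ('o \<times> 'p, 'a \<times> 'b) cat" where
  "prod_cat C D = \<lparr>Obj = Obj C \<times> Obj D, Arr = Arr C \<times> Arr D,
     Dom = map_prod (Dom C) (Dom D), Cod = map_prod (Cod C) (Cod D),
     Ident = map_prod (Ident C) (Ident D),
     Comp = (\<lambda>(g, g') (f, f'). (Comp C g f, Comp D g' f'))\<rparr>"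


section \<open>Functors to finite sets\<close>

text \<open>The values of the functor are finite sets with elements in the type \<open>'x\<close>.  The map
  \<open>fmor F f\<close> matters only on \<open>fobj F (Dom C f)\<close>.\<close>

record ('o, 'a, 'x) set_fun =
  fobj :: "'o \<Rightarrow> 'x set"
  fmor :: "'a \<Rightarrow> 'x \<Rightarrow> 'x"

locale finset_functor = category C
  for C :: "('o, 'a) cat" and F :: "('o, 'a, 'x) set_fun" +
  assumes finite_fobj: "x \<in> Obj C \<Longrightarrow> finite (fobj F x)"
    and fmor_closed: "\<lbrakk>f \<in> Arr C; u \<in> fobj F (Dom C f)\<rbrakk> \<Longrightarrow> fmor F f u \<in> fobj F (Cod C f)"
    and fmor_Ident: "\<lbrakk>x \<in> Obj C; u \<in> fobj F x\<rbrakk> \<Longrightarrow> fmor F (Ident C x) u = u"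
    and fmor_Comp: "\<lbrakk>f \<in> Arr C; g \<in> Arr C; Dom C g = Cod C f; u \<in> fobj F (Dom C f)\<rbrakk>
           \<Longrightarrow> fmor F (Comp C g f) u = fmor F g (fmor F f u)"

definition naturally_iso ::
  "('o, 'a) cat \<Rightarrow> ('o, 'a, 'x) set_fun \<Rightarrow> ('o, 'a, 'y) set_fun \<Rightarrow> bool" where
  "naturally_iso C F G \<longleftrightarrow> (\<exists>\<eta>. (\<forall>x\<in>Obj C. bij_betw (\<eta> x) (fobj F x) (fobj G x)) \<and>
     (\<forall>f\<in>Arr C. \<forall>u\<in>fobj F (Dom C f). \<eta> (Cod C f) (fmor F f u) = fmor G f (\<eta> (Dom C f) u)))"


section \<open>Bisets\<close>

type_synonym ('o, 'a, 'p, 'b, 'x) biset = "('o \<times> 'p, 'a \<times> 'b, 'x) set_fun"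

definition is_biset ::
  "('o, 'a) cat \<Rightarrow> ('p, 'b) cat \<Rightarrow> ('o, 'a, 'p, 'b, 'x) biset \<Rightarrow> bool" where
  "is_biset C D \<Omega> \<longleftrightarrow> finset_functor (prod_cat C (op_cat D)) \<Omega>"

definition biset_union ::
  "('o, 'a, 'p, 'b, 'x) biset \<Rightarrow> ('o, 'a, 'p, 'b, 'y) biset \<Rightarrow> ('o, 'a, 'p, 'b, 'x + 'y) biset" where
  "biset_union \<Omega> \<Psi> = \<lparr>fobj = (\<lambda>z. fobj \<Omega> z <+> fobj \<Psi> z),
     fmor = (\<lambda>\<gamma>. map_sum (fmor \<Omega> \<gamma>) (fmor \<Psi> \<gamma>))\<rparr>"

text \<open>The identity \<open>(C, C)\<close>-biset: its value at \<open>(x, y)\<close> is the set of arrows from \<open>y\<close> to \<open>x\<close>.\<close>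

definition biset_id :: "('o, 'a) cat \<Rightarrow> ('o, 'a, 'o, 'a, 'a) biset" where
  "biset_id C = \<lparr>fobj = (\<lambda>(x, y). {f \<in> Arr C. Dom C f = y \<and> Cod C f = x}),
     fmor = (\<lambda>(\<alpha>, \<beta>) f. Comp C \<alpha> (Comp C f \<beta>))\<rparr>"

text \<open>For \<open>\<beta> : y \<rightarrow> y'\<close> in \<open>D\<close>, \<open>u \<in> \<Omega>(x, y')\<close> and \<open>v \<in> \<Psi>(y, z)\<close> one has
  \<open>u\<beta> = \<Omega>(1\<^sub>x, \<beta>)(u) \<in> \<Omega>(x, y)\<close> and \<open>\<beta>v = \<Psi>(\<beta>, 1\<^sub>z)(v) \<in> \<Psi>(y', z)\<close>; the element \<open>(u, v)\<close> of the
  summand at \<open>y\<close> is represented by the triple \<open>(y, u, v)\<close>.\<close>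

definition comp_carrier ::
  "('p, 'b) cat \<Rightarrow> ('o, 'a, 'p, 'b, 'x) biset \<Rightarrow> ('p, 'b, 'q, 'c, 'y) biset
    \<Rightarrow> 'o \<Rightarrow> 'q \<Rightarrow> ('p \<times> 'x \<times> 'y) set" where
  "comp_carrier D \<Omega> \<Psi> x z =
     {(y, u, v). y \<in> Obj D \<and> u \<in> fobj \<Omega> (x, y) \<and> v \<in> fobj \<Psi> (y, z)}"

inductive comp_step ::
  "('o, 'a) cat \<Rightarrow> ('p, 'b) cat \<Rightarrow> ('q, 'c) cat \<Rightarrow> ('o, 'a, 'p, 'b, 'x) biset
    \<Rightarrow> ('p, 'b, 'q, 'c, 'y) biset \<Rightarrow> 'o \<Rightarrow> 'q \<Rightarrow> 'p \<times> 'x \<times> 'y \<Rightarrow> 'p \<times> 'x \<times> 'y \<Rightarrow> bool"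
  for C D E \<Omega> \<Psi> x z where
  "\<lbrakk>\<beta> \<in> Arr D; u \<in> fobj \<Omega> (x, Cod D \<beta>); v \<in> fobj \<Psi> (Dom D \<beta>, z)\<rbrakk> \<Longrightarrow>
     comp_step C D E \<Omega> \<Psi> x z
       (Dom D \<beta>, fmor \<Omega> (Ident C x, \<beta>) u, v) (Cod D \<beta>, u, fmor \<Psi> (\<beta>, Ident E z) v)"

definition comp_rel ::
  "('o, 'a) cat \<Rightarrow> ('p, 'b) cat \<Rightarrow> ('q, 'c) cat \<Rightarrow> ('o, 'a, 'p, 'b, 'x) biset
    \<Rightarrow> ('p, 'b, 'q, 'c, 'y) biset \<Rightarrow> 'o \<Rightarrow> 'q \<Rightarrow> (('p \<times> 'x \<times> 'y) \<times> ('p \<times> 'x \<times> 'y)) set" where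
  "comp_rel C D E \<Omega> \<Psi> x z = {(s, t). equivclp (comp_step C D E \<Omega> \<Psi> x z) s t}"

text \<open>In the action on morphisms, \<open>K\<close> is an equivalence class; its image is contained in a single
  class, which is recovered by saturation.\<close>

definition biset_comp ::
  "('o, 'a) cat \<Rightarrow> ('p, 'b) cat \<Rightarrow> ('q, 'c) cat \<Rightarrow> ('o, 'a, 'p, 'b, 'x) biset
    \<Rightarrow> ('p, 'b, 'q, 'c, 'y) biset \<Rightarrow> ('o, 'a, 'q, 'c, ('p \<times> 'x \<times> 'y) set) biset" where
  "biset_comp C D E \<Omega> \<Psi> = \<lparr>
     fobj = (\<lambda>(x, z). comp_carrier D \<Omega> \<Psi> x z // comp_rel C D E \<Omega> \<Psi> x z),
     fmor = (\<lambda>(\<alpha>, \<gamma>) K. comp_rel C D E \<Omega> \<Psi> (Cod C \<alpha>) (Dom E \<gamma>) ``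
        ((\<lambda>(y, u, v). (y, fmor \<Omega> (\<alpha>, Ident D y) u, fmor \<Psi> (Ident D y, \<gamma>) v)) ` K))\<rparr>"

text \<open>The product of a \<open>(C, D)\<close>-biset and a \<open>(C', D')\<close>-biset, a \<open>(C \<times> C', D \<times> D')\<close>-biset.\<close>

definition biset_prod ::
  "('o, 'a, 'p, 'b, 'x) biset \<Rightarrow> ('s, 'd, 't, 'e, 'y) biset
    \<Rightarrow> ('o \<times> 's, 'a \<times> 'd, 'p \<times> 't, 'b \<times> 'e, 'x \<times> 'y) biset" where
  "biset_prod \<Omega> \<Psi> = \<lparr>
     fobj = (\<lambda>((x, x'), (y, y')). fobj \<Omega> (x, y) \<times> fobj \<Psi> (x', y')),
     fmor = (\<lambda>((\<alpha>, \<alpha>'), (\<beta>, \<beta>')). map_prod (fmor \<Omega> (\<alpha>, \<beta>)) (fmor \<Psi> (\<alpha>', \<beta>')))\<rparr>"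

text \<open>A \<open>(C, D)\<close>-biset regarded as a \<open>(D\<^sup>o\<^sup>p, C\<^sup>o\<^sup>p)\<close>-biset.\<close>

definition biset_op :: "('o, 'a, 'p, 'b, 'x) biset \<Rightarrow> ('p, 'b, 'o, 'a, 'x) biset" where
  "biset_op \<Omega> = \<lparr>fobj = (\<lambda>(y, x). fobj \<Omega> (x, y)), fmor = (\<lambda>(\<beta>, \<alpha>). fmor \<Omega> (\<alpha>, \<beta>))\<rparr>"


section \<open>The Grothendieck group of bisets\<close>

text \<open>Every finite set is in bijection with a set of natural numbers, so isomorphism classes are
  formed among bisets with values in \<open>nat\<close>.  The class of a biset \<open>\<Omega>\<close> with values in any type \<open>'x\<close> is
  the set of all \<open>nat\<close>-valued bisets isomorphic to \<open>\<Omega>\<close>.\<close>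

type_synonym ('o, 'a, 'p, 'b) iso_class = "('o, 'a, 'p, 'b, nat) biset set"

definition biset_class ::
  "('o, 'a) cat \<Rightarrow> ('p, 'b) cat \<Rightarrow> ('o, 'a, 'p, 'b, 'x) biset \<Rightarrow> ('o, 'a, 'p, 'b) iso_class" where
  "biset_class C D \<Omega> =
     {\<Omega>'. is_biset C D \<Omega>' \<and> naturally_iso (prod_cat C (op_cat D)) \<Omega> \<Omega>'}"

definition biset_classes ::
  "('o, 'a) cat \<Rightarrow> ('p, 'b) cat \<Rightarrow> ('o, 'a, 'p, 'b) iso_class set" where
  "biset_classes C D = biset_class C D ` {\<Omega> :: ('o, 'a, 'p, 'b, nat) biset. is_biset C D \<Omega>}"

definition union_relators ::
  "('o, 'a) cat \<Rightarrow> ('p, 'b) cat \<Rightarrow> (('o, 'a, 'p, 'b) iso_class \<Rightarrow>\<^sub>0 int) set" where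
  "union_relators C D =
     {frag_of (biset_class C D (biset_union \<Omega> \<Psi>))
        - frag_of (biset_class C D \<Omega>) - frag_of (biset_class C D \<Psi>)
      | (\<Omega> :: ('o, 'a, 'p, 'b, nat) biset) (\<Psi> :: ('o, 'a, 'p, 'b, nat) biset).
        is_biset C D \<Omega> \<and> is_biset C D \<Psi>}"

definition union_subgroup ::
  "('o, 'a) cat \<Rightarrow> ('p, 'b) cat \<Rightarrow> (('o, 'a, 'p, 'b) iso_class \<Rightarrow>\<^sub>0 int) set" where
  "union_subgroup C D = generate (free_Abelian_group (biset_classes C D)) (union_relators C D)"

type_synonym ('o, 'a, 'p, 'b) groth_elt = "(('o, 'a, 'p, 'b) iso_class \<Rightarrow>\<^sub>0 int) set"

definition groth_group ::
  "('o, 'a) cat \<Rightarrow> ('p, 'b) cat \<Rightarrow> ('o, 'a, 'p, 'b) groth_elt monoid" where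
  "groth_group C D = free_Abelian_group (biset_classes C D) Mod union_subgroup C D"

definition groth_class ::
  "('o, 'a) cat \<Rightarrow> ('p, 'b) cat \<Rightarrow> ('o, 'a, 'p, 'b, 'x) biset \<Rightarrow> ('o, 'a, 'p, 'b) groth_elt" where
  "groth_class C D \<Omega> =
     union_subgroup C D #>\<^bsub>free_Abelian_group (biset_classes C D)\<^esub> frag_of (biset_class C D \<Omega>)"


section \<open>Extension of scalars\<close>

text \<open>The tensor product over the integers of a commutative ring \<open>R\<close> with an abelian group \<open>A\<close>
  (written multiplicatively, as in HOL-Algebra), as an \<open>R\<close>-module.  Additivity in both arguments
  already implies that integers can be moved across the tensor sign.\<close>

definition tensor_relators ::
  "('r, 'm) ring_scheme \<Rightarrow> ('g, 'n) monoid_scheme \<Rightarrow> ('r \<times> 'g \<Rightarrow>\<^sub>0 int) set" where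
  "tensor_relators R A =
     {frag_of (r \<oplus>\<^bsub>R\<^esub> s, a) - frag_of (r, a) - frag_of (s, a) | r s a.
        r \<in> carrier R \<and> s \<in> carrier R \<and> a \<in> carrier A} \<union>
     {frag_of (r, a \<otimes>\<^bsub>A\<^esub> b) - frag_of (r, a) - frag_of (r, b) | r a b.
        r \<in> carrier R \<and> a \<in> carrier A \<and> b \<in> carrier A}"

definition tensor_free ::
  "('r, 'm) ring_scheme \<Rightarrow> ('g, 'n) monoid_scheme \<Rightarrow> ('r \<times> 'g \<Rightarrow>\<^sub>0 int) monoid" where
  "tensor_free R A = free_Abelian_group (carrier R \<times> carrier A)"

definition tensor_subgroup ::
  "('r, 'm) ring_scheme \<Rightarrow> ('g, 'n) monoid_scheme \<Rightarrow> ('r \<times> 'g \<Rightarrow>\<^sub>0 int) set" where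
  "tensor_subgroup R A = generate (tensor_free R A) (tensor_relators R A)"

definition simple_tensor ::
  "('r, 'm) ring_scheme \<Rightarrow> ('g, 'n) monoid_scheme \<Rightarrow> 'r \<Rightarrow> 'g \<Rightarrow> ('r \<times> 'g \<Rightarrow>\<^sub>0 int) set" where
  "simple_tensor R A r a = tensor_subgroup R A #>\<^bsub>tensor_free R A\<^esub> frag_of (r, a)"

text \<open>The scalar action is \<open>r (s \<otimes> a) = (r s) \<otimes> a\<close>.  The fields \<open>mult\<close> and \<open>one\<close> are inherited from the
  record type of rings and play no role for modules.\<close>

definition scalar_extension ::
  "('r, 'm) ring_scheme \<Rightarrow> ('g, 'n) monoid_scheme \<Rightarrow> ('r, ('r \<times> 'g \<Rightarrow>\<^sub>0 int) set) module" where
  "scalar_extension R A = \<lparr>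
     carrier = carrier (tensor_free R A Mod tensor_subgroup R A),
     monoid.mult = undefined,
     monoid.one = undefined,
     ring.zero = \<one>\<^bsub>tensor_free R A Mod tensor_subgroup R A\<^esub>,
     ring.add = (\<lambda>X Y. X \<otimes>\<^bsub>tensor_free R A Mod tensor_subgroup R A\<^esub> Y),
     module.smult = (\<lambda>r X. \<Union>p\<in>X. tensor_subgroup R A #>\<^bsub>tensor_free R A\<^esub>
                frag_extend (\<lambda>(s, a). frag_of (r \<otimes>\<^bsub>R\<^esub> s, a)) p)\<rparr>"

definition linear_map ::
  "('r, 'm) ring_scheme \<Rightarrow> ('r, 'u, 'j) module_scheme \<Rightarrow> ('r, 'v, 'k) module_scheme
    \<Rightarrow> ('u \<Rightarrow> 'v) \<Rightarrow> bool" where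
  "linear_map R M N f \<longleftrightarrow> f \<in> carrier M \<rightarrow> carrier N \<and>
     (\<forall>x\<in>carrier M. \<forall>y\<in>carrier M. f (x \<oplus>\<^bsub>M\<^esub> y) = f x \<oplus>\<^bsub>N\<^esub> f y) \<and>
     (\<forall>r\<in>carrier R. \<forall>x\<in>carrier M. f (r \<odot>\<^bsub>M\<^esub> x) = r \<odot>\<^bsub>N\<^esub> f x)"

definition linear_iso ::
  "('r, 'm) ring_scheme \<Rightarrow> ('r, 'u, 'j) module_scheme \<Rightarrow> ('r, 'v, 'k) module_scheme
    \<Rightarrow> ('u \<Rightarrow> 'v) \<Rightarrow> bool" where
  "linear_iso R M N f \<longleftrightarrow> linear_map R M N f \<and> bij_betw f (carrier M) (carrier N)"

definition bilinear_map ::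
  "('r, 'm) ring_scheme \<Rightarrow> ('r, 'u, 'j) module_scheme \<Rightarrow> ('r, 'v, 'k) module_scheme
    \<Rightarrow> ('r, 'w, 'l) module_scheme \<Rightarrow> ('u \<Rightarrow> 'v \<Rightarrow> 'w) \<Rightarrow> bool" where
  "bilinear_map R M N P b \<longleftrightarrow>
     (\<forall>x\<in>carrier M. linear_map R N P (b x)) \<and>
     (\<forall>y\<in>carrier N. linear_map R M P (\<lambda>x. b x y))"


section \<open>The biset category\<close>

type_synonym ('r, 'o, 'a, 'p, 'b) B_elt = "('r \<times> ('p, 'b, 'o, 'a) groth_elt \<Rightarrow>\<^sub>0 int) set"

text \<open>Morphisms from \<open>C\<close> to \<open>D\<close> are built from \<open>(D, C)\<close>-bisets.\<close>

definition B_Hom ::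
  "('r, 'm) ring_scheme \<Rightarrow> ('o, 'a) cat \<Rightarrow> ('p, 'b) cat
    \<Rightarrow> ('r, ('r, 'o, 'a, 'p, 'b) B_elt) module" where
  "B_Hom R C D = scalar_extension R (groth_group D C)"

definition B_class ::
  "('r, 'm) ring_scheme \<Rightarrow> ('o, 'a) cat \<Rightarrow> ('p, 'b) cat \<Rightarrow> ('p, 'b, 'o, 'a, 'x) biset
    \<Rightarrow> ('r, 'o, 'a, 'p, 'b) B_elt" where
  "B_class R C D \<Omega> = simple_tensor R (groth_group D C) \<one>\<^bsub>R\<^esub> (groth_class D C \<Omega>)"

definition B_id :: "('r, 'm) ring_scheme \<Rightarrow> ('o, 'a) cat \<Rightarrow> ('r, 'o, 'a, 'o, 'a) B_elt" where
  "B_id R C = B_class R C C (biset_id C)"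

text \<open>The (bi)linear extensions below are uniquely determined on the carriers, because the classes of
  \<open>nat\<close>-valued bisets generate the modules \<open>B_Hom R C D\<close>.\<close>

definition B_comp ::
  "('r, 'm) ring_scheme \<Rightarrow> ('o, 'a) cat \<Rightarrow> ('p, 'b) cat \<Rightarrow> ('q, 'c) cat
    \<Rightarrow> ('r, 'p, 'b, 'q, 'c) B_elt \<Rightarrow> ('r, 'o, 'a, 'p, 'b) B_elt \<Rightarrow> ('r, 'o, 'a, 'q, 'c) B_elt" where
  "B_comp R C D E = (SOME b. bilinear_map R (B_Hom R D E) (B_Hom R C D) (B_Hom R C E) b \<and>
     (\<forall>(\<Psi> :: ('q, 'c, 'p, 'b, nat) biset) (\<Omega> :: ('p, 'b, 'o, 'a, nat) biset).
        is_biset E D \<Psi> \<longrightarrow> is_biset D C \<Omega> \<longrightarrow>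
        b (B_class R D E \<Psi>) (B_class R C D \<Omega>) = B_class R C E (biset_comp E D C \<Psi> \<Omega>)))"

definition B_tensor ::
  "('r, 'm) ring_scheme \<Rightarrow> ('o, 'a) cat \<Rightarrow> ('p, 'b) cat \<Rightarrow> ('s, 'd) cat \<Rightarrow> ('t, 'e) cat
    \<Rightarrow> ('r, 'o, 'a, 'p, 'b) B_elt \<Rightarrow> ('r, 's, 'd, 't, 'e) B_elt
    \<Rightarrow> ('r, 'o \<times> 's, 'a \<times> 'd, 'p \<times> 't, 'b \<times> 'e) B_elt" where
  "B_tensor R C D C' D' = (SOME b.
     bilinear_map R (B_Hom R C D) (B_Hom R C' D') (B_Hom R (prod_cat C C') (prod_cat D D')) b \<and>
     (\<forall>(\<Omega> :: ('p, 'b, 'o, 'a, nat) biset) (\<Psi> :: ('t, 'e, 's, 'd, nat) biset).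
        is_biset D C \<Omega> \<longrightarrow> is_biset D' C' \<Psi> \<longrightarrow>
        b (B_class R C D \<Omega>) (B_class R C' D' \<Psi>)
          = B_class R (prod_cat C C') (prod_cat D D') (biset_prod \<Omega> \<Psi>)))"

definition B_iso ::
  "('r, 'm) ring_scheme \<Rightarrow> ('o, 'a) cat \<Rightarrow> ('p, 'b) cat \<Rightarrow> ('r, 'o, 'a, 'p, 'b) B_elt \<Rightarrow> bool" where
  "B_iso R C D f \<longleftrightarrow> f \<in> carrier (B_Hom R C D) \<and>
     (\<exists>g\<in>carrier (B_Hom R D C). B_comp R C D C g f = B_id R C \<and> B_comp R D C D f g = B_id R D)"

text \<open>The contravariant functor \<open>\<tau>\<close> is \<open>op_cat\<close> on objects; on morphisms it maps
  \<open>B_Hom R C D\<close> to \<open>B_Hom R (op_cat D) (op_cat C)\<close>.\<close>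

definition B_tau ::
  "('r, 'm) ring_scheme \<Rightarrow> ('o, 'a) cat \<Rightarrow> ('p, 'b) cat
    \<Rightarrow> ('r, 'o, 'a, 'p, 'b) B_elt \<Rightarrow> ('r, 'p, 'b, 'o, 'a) B_elt" where
  "B_tau R C D = (SOME t.
     linear_map R (B_Hom R C D) (B_Hom R (op_cat D) (op_cat C)) t \<and>
     (\<forall>\<Omega> :: ('p, 'b, 'o, 'a, nat) biset. is_biset D C \<Omega> \<longrightarrow>
        t (B_class R C D \<Omega>) = B_class R (op_cat D) (op_cat C) (biset_op \<Omega>)))"

definition intern_hom :: "('o, 'a) cat \<Rightarrow> ('q, 'c) cat \<Rightarrow> ('q \<times> 'o, 'c \<times> 'a) cat" where
  "intern_hom C E = prod_cat E (op_cat C)"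

text \<open>For \<open>f : C' \<rightarrow> C\<close> and \<open>g : E \<rightarrow> E'\<close> the morphism \<open>g \<otimes> \<tau>(f)\<close> from \<open>intern_hom C E\<close> to
  \<open>intern_hom C' E'\<close>.\<close>

definition intern_hom_mor ::
  "('r, 'm) ring_scheme \<Rightarrow> ('s, 'd) cat \<Rightarrow> ('o, 'a) cat \<Rightarrow> ('q, 'c) cat \<Rightarrow> ('t, 'e) cat
    \<Rightarrow> ('r, 's, 'd, 'o, 'a) B_elt \<Rightarrow> ('r, 'q, 'c, 't, 'e) B_elt
    \<Rightarrow> ('r, 'q \<times> 'o, 'c \<times> 'a, 't \<times> 's, 'e \<times> 'd) B_elt" where
  "intern_hom_mor R C' C E E' f g =
     B_tensor R E E' (op_cat C) (op_cat C') g (B_tau R C' C f)"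

end

theory Submission
  imports Defs
begin

text \<open>
  A \<open>(D, C)\<close>-biset is a functor of \<open>D \<times> C\<^sup>o\<^sup>p\<close>, so an \<open>(E, C \<times> D)\<close>-biset and an
  \<open>(E \<times> C\<^sup>o\<^sup>p, D)\<close>-biset are the same functor up to reassociating a triple product. This reindexing
  induces the adjunction isomorphism. The isomorphism between the two iterated internal Homs is the
  class of the biset represented by the associativity isomorphism of categories; by the co-Yoneda
  lemma, composing with it amounts to reindexing. Every equation between morphisms is multilinear
  in its arguments, so it suffices to check it on classes of bisets. There it becomes a natural
  isomorphism between composites, which are coends, and is constructed from their universal
  property.
\<close>

section \<open>Quotients of free abelian groups\<close>

text \<open>The operations on morphisms are specified by Hilbert choice, as (bi)linear maps with
  prescribed values on classes of \<open>nat\<close>-valued bisets. Nothing can be said about them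
  until such maps are known to exist, so every operation on bisets must first be shown to respect
  isomorphism and disjoint union in each variable. The module of morphisms is presented in two
  layers, bisets modulo unions and then tensors with \<open>R\<close>, and a map is lifted through
  both universal properties. A second obstacle is typing: unions, products and composites of
  \<open>nat\<close>-valued bisets take values in other types, so a specification cannot be applied
  to its own output. Each formula on classes is therefore extended to bisets with arbitrary value
  types by passing to isomorphic \<open>nat\<close>-valued copies. Finally, a nested composite has
  equivalence classes inside its representatives. Maps out of it are written on representatives and
  descended through one coend at a time.\<close>

lemma free_Abelian_induct [consumes 1, case_names zero diff gen]:
  assumes "Poly_Mapping.keys x \<subseteq> S" "P 0"
    and "\<And>x y. \<lbrakk>Poly_Mapping.keys x \<subseteq> S; Poly_Mapping.keys y \<subseteq> S; P x; P y\<rbrakk> \<Longrightarrow> P (x - y)"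
    and "\<And>a. a \<in> S \<Longrightarrow> P (frag_of a)"
  shows "P x"
  using assms by (rule free_Abelian_group_induct)

text \<open>Generators and relations, stated once for two uses: the Grothendieck group (generators
  are isomorphism classes, relators come from unions) and the tensor product (generators are pairs
  of a scalar and a group element).\<close>

locale free_quotient =
  fixes S :: "'s set" and Rel :: "('s \<Rightarrow>\<^sub>0 int) set"
  assumes Rel_keys: "c \<in> Rel \<Longrightarrow> Poly_Mapping.keys c \<subseteq> S"
begin

abbreviation F where "F \<equiv> free_Abelian_group S"
abbreviation N where "N \<equiv> generate F Rel"
abbreviation Q where "Q \<equiv> F Mod N"
abbreviation cs where "cs p \<equiv> N #>\<^bsub>F\<^esub> p"

lemma N_normal: "N \<lhd> F"
proof -
  have "subgroup N F"
    using Rel_keys by (intro group.generate_is_subgroup) auto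
  then show ?thesis
    by (rule comm_group.normal_iff_subgroup[OF abelian_free_Abelian_group, THEN iffD2])
qed

lemma N_subgroup: "subgroup N F"
  using N_normal by (rule normal_imp_subgroup)

lemma comm_group_Q: "comm_group Q"
  using comm_group.abelian_FactGroup[OF abelian_free_Abelian_group N_subgroup] .

lemma zero_in_N: "0 \<in> N"
  using subgroup.one_closed[OF N_subgroup] by simp

lemma add_in_N: "p \<in> N \<Longrightarrow> q \<in> N \<Longrightarrow> p + q \<in> N"
  using subgroup.m_closed[OF N_subgroup, of p q] by simp

lemma N_keys: "p \<in> N \<Longrightarrow> Poly_Mapping.keys p \<subseteq> S"
  using subgroup.mem_carrier[OF N_subgroup] by simp

lemma uminus_in_N: "p \<in> N \<Longrightarrow> - p \<in> N"
  using subgroup.m_inv_closed[OF N_subgroup, of p] N_keys[of p] by simp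

lemma diff_in_N: "p \<in> N \<Longrightarrow> q \<in> N \<Longrightarrow> p - q \<in> N"
  using add_in_N[of p "- q"] uminus_in_N[of q] by simp

lemma Rel_in_N: "c \<in> Rel \<Longrightarrow> c \<in> N"
  by (rule generate.incl)

lemma cs_eq_iff:
  assumes "Poly_Mapping.keys p \<subseteq> S" "Poly_Mapping.keys q \<subseteq> S"
  shows "cs p = cs q \<longleftrightarrow> p - q \<in> N"
proof
  assume "cs p = cs q"
  then have "p \<in> cs q"
    using assms group.rcos_self[OF group_free_Abelian_group _ N_subgroup, of p] by simp
  then obtain n where "n \<in> N" "p = n + q"
    unfolding r_coset_def by auto
  then show "p - q \<in> N"
    by simp
next
  assume "p - q \<in> N"
  then have "p \<in> cs q"
    unfolding r_coset_def by (auto intro!: bexI[of _ "p - q"])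
  then show "cs p = cs q"
    using assms by (metis group.repr_independence[OF group_free_Abelian_group] N_subgroup
        carrier_free_Abelian_group_iff)
qed

lemma carrier_Q_iff: "X \<in> carrier Q \<longleftrightarrow> (\<exists>p. Poly_Mapping.keys p \<subseteq> S \<and> X = cs p)"
  unfolding carrier_FactGroup image_iff Bex_def carrier_free_Abelian_group_iff ..

lemma mult_cs:
  assumes "Poly_Mapping.keys p \<subseteq> S" "Poly_Mapping.keys q \<subseteq> S"
  shows "cs p \<otimes>\<^bsub>Q\<^esub> cs q = cs (p + q)"
  using normal.rcos_sum[OF N_normal, of p q] assms by simp

lemma one_Q: "\<one>\<^bsub>Q\<^esub> = cs 0"
  using group.coset_mult_one[OF group_free_Abelian_group, of N S] N_keys
  by (simp add: subset_iff)

text \<open>The extension of \<open>h\<close> to the free group is known only through its universal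
  property. Hence \<open>rel\<close> is asked of every homomorphism \<open>k\<close> that agrees
  with \<open>h\<close> on generators; it puts the relators, and so the subgroup \<open>N\<close>,
  into the kernel.\<close>

lemma lift:
  assumes H: "comm_group H" and h: "h ` S \<subseteq> carrier H"
    and rel: "\<And>k c. \<lbrakk>group_hom F H k; \<And>s. s \<in> S \<Longrightarrow> k (frag_of s) = h s; c \<in> Rel\<rbrakk> \<Longrightarrow> k c = \<one>\<^bsub>H\<^esub>"
  obtains f where "f \<in> hom Q H" "\<And>s. s \<in> S \<Longrightarrow> f (cs (frag_of s)) = h s"
proof -
  obtain k where k: "k \<in> hom F H" "\<And>s. s \<in> S \<Longrightarrow> k (frag_of s) = h s"
    using comm_group.free_Abelian_group_universal[OF H h] by blast
  interpret k: group_hom F H k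
    using H k(1) by (simp add: group_hom_def group_hom_axioms_def comm_group_def)
  have "N \<subseteq> kernel F H k"
    using Rel_keys rel[OF k.group_hom_axioms k(2)]
    by (intro k.G.generate_subgroup_incl k.subgroup_kernel) (auto simp: kernel_def)
  then obtain f where "f \<in> hom Q H" "\<And>x. x \<in> carrier F \<Longrightarrow> f (cs x) = k x"
    using k.FactGroup_universal_kernel[OF N_normal] by blast
  with k(2) show thesis
    by (intro that) auto
qed

end

lemma group_hom_free_add:
  assumes "group_hom (free_Abelian_group S) H k" "Poly_Mapping.keys x \<subseteq> S" "Poly_Mapping.keys y \<subseteq> S"
  shows "k (x + y) = k x \<otimes>\<^bsub>H\<^esub> k y"
  using group_hom.hom_mult[OF assms(1), of x y] assms(2,3) by simp

lemma group_hom_free_diff: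
  assumes "group_hom (free_Abelian_group S) H k" "Poly_Mapping.keys x \<subseteq> S" "Poly_Mapping.keys y \<subseteq> S"
  shows "k (x - y) = k x \<otimes>\<^bsub>H\<^esub> inv\<^bsub>H\<^esub> k y"
  using group_hom_free_add[OF assms(1,2), of "- y"] group_hom.hom_inv[OF assms(1), of y] assms(3)
  by (simp add: keys_minus)

text \<open>All relators, those for unions and both kinds for tensors, have the shape
  \<open>a - b - c\<close>. This turns additivity of the intended map into the vanishing that
  \<open>free_quotient.lift\<close> asks for.\<close>

lemma group_hom_free_relator:
  assumes k: "group_hom (free_Abelian_group S) H k" and "{a, b, c} \<subseteq> S"
    and eq: "k (frag_of a) = k (frag_of b) \<otimes>\<^bsub>H\<^esub> k (frag_of c)" and "comm_group H"
  shows "k (frag_of a - frag_of b - frag_of c) = \<one>\<^bsub>H\<^esub>"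
proof -
  interpret H: comm_group H by fact
  interpret k: group_hom "free_Abelian_group S" H k by (rule k)
  have [simp]: "k (frag_of a) \<in> carrier H" "k (frag_of b) \<in> carrier H" "k (frag_of c) \<in> carrier H"
    using assms(2) by (auto intro!: k.hom_closed)
  have "Poly_Mapping.keys (frag_of a - frag_of b) \<subseteq> S"
    using assms(2) keys_diff[of "frag_of a" "frag_of b"] by auto
  with assms(2) have "k (frag_of a - frag_of b - frag_of c)
      = k (frag_of a) \<otimes>\<^bsub>H\<^esub> inv\<^bsub>H\<^esub> k (frag_of b) \<otimes>\<^bsub>H\<^esub> inv\<^bsub>H\<^esub> k (frag_of c)"
    by (simp add: group_hom_free_diff[OF k])
  also have "\<dots> = \<one>\<^bsub>H\<^esub>"
    by (simp add: eq H.m_comm[of "k (frag_of b)" "k (frag_of c)"] H.m_assoc)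
  finally show ?thesis .
qed

section \<open>Extension of scalars\<close>

locale scalar_ext = R?: cring R + A: comm_group A
  for R :: "('r, 'm) ring_scheme" (structure) and A :: "('g, 'n) monoid_scheme"
begin

abbreviation M where "M \<equiv> scalar_extension R A"

sublocale T: free_quotient "carrier R \<times> carrier A" "tensor_relators R A"
proof
  fix c assume "c \<in> tensor_relators R A"
  then show "Poly_Mapping.keys c \<subseteq> carrier R \<times> carrier A"
    unfolding tensor_relators_def by (auto dest!: subsetD[OF keys_diff])
qed

text \<open>The scalar action before passing to cosets; it is the term that occurs inside the union
  in \<open>scalar_extension\<close>.\<close>

definition scale :: "'r \<Rightarrow> ('r \<times> 'g \<Rightarrow>\<^sub>0 int) \<Rightarrow> ('r \<times> 'g \<Rightarrow>\<^sub>0 int)" where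
  "scale r = frag_extend (\<lambda>(s, a). frag_of (r \<otimes> s, a))"

lemma scale_simps:
  "scale r 0 = 0" "scale r (p - q) = scale r p - scale r q" "scale r (p + q) = scale r p + scale r q"
  "scale r (frag_of (s, a)) = frag_of (r \<otimes> s, a)"
  by (simp_all add: scale_def frag_extend_diff frag_extend_add)

lemma scale_keys:
  assumes "r \<in> carrier R" "Poly_Mapping.keys p \<subseteq> carrier R \<times> carrier A"
  shows "Poly_Mapping.keys (scale r p) \<subseteq> carrier R \<times> carrier A"
  using assms(2)
proof (induction p rule: free_Abelian_induct)
  case (diff p q)
  then show ?case
    using keys_diff[of "scale r p" "scale r q"] by (auto simp: scale_simps)
qed (use assms(1) in \<open>auto simp: scale_simps\<close>)

lemma relator_left:
  assumes "r \<in> carrier R" "s \<in> carrier R" "a \<in> carrier A"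
  shows "frag_of (r \<oplus> s, a) - frag_of (r, a) - frag_of (s, a) \<in> T.N"
  using assms by (intro T.Rel_in_N) (auto simp: tensor_relators_def)

lemma relator_right:
  assumes "r \<in> carrier R" "a \<in> carrier A" "b \<in> carrier A"
  shows "frag_of (r, a \<otimes>\<^bsub>A\<^esub> b) - frag_of (r, a) - frag_of (r, b) \<in> T.N"
  using assms by (intro T.Rel_in_N) (auto simp: tensor_relators_def)

lemma scale_relators:
  assumes "r \<in> carrier R" "c \<in> tensor_relators R A"
  shows "scale r c \<in> tensor_relators R A"
  using assms(2) unfolding tensor_relators_def
proof (elim UnE CollectE exE conjE)
  fix s t a assume "c = frag_of (s \<oplus> t, a) - frag_of (s, a) - frag_of (t, a)"
    "s \<in> carrier R" "t \<in> carrier R" "a \<in> carrier A"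
  with assms(1) show "scale r c \<in> {frag_of (r \<oplus> s, a) - frag_of (r, a) - frag_of (s, a) | r s a.
        r \<in> carrier R \<and> s \<in> carrier R \<and> a \<in> carrier A} \<union>
     {frag_of (r, a \<otimes>\<^bsub>A\<^esub> b) - frag_of (r, a) - frag_of (r, b) | r a b.
        r \<in> carrier R \<and> a \<in> carrier A \<and> b \<in> carrier A}"
    by (intro UnI1 CollectI exI[of _ "r \<otimes> s"] exI[of _ "r \<otimes> t"] exI[of _ a])
      (simp add: scale_simps r_distr)
next
  fix s a b assume "c = frag_of (s, a \<otimes>\<^bsub>A\<^esub> b) - frag_of (s, a) - frag_of (s, b)"
    "s \<in> carrier R" "a \<in> carrier A" "b \<in> carrier A"
  with assms(1) show "scale r c \<in> {frag_of (r \<oplus> s, a) - frag_of (r, a) - frag_of (s, a) | r s a.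
        r \<in> carrier R \<and> s \<in> carrier R \<and> a \<in> carrier A} \<union>
     {frag_of (r, a \<otimes>\<^bsub>A\<^esub> b) - frag_of (r, a) - frag_of (r, b) | r a b.
        r \<in> carrier R \<and> a \<in> carrier A \<and> b \<in> carrier A}"
    by (intro UnI2 CollectI exI[of _ "r \<otimes> s"] exI[of _ a] exI[of _ b]) (simp add: scale_simps)
qed

lemma scale_N:
  assumes r: "r \<in> carrier R" and "p \<in> T.N"
  shows "scale r p \<in> T.N"
  using assms(2)
proof (induction p rule: generate.induct)
  case one
  then show ?case by (simp add: scale_simps T.zero_in_N)
next
  case (incl h)
  then show ?case
    using r by (intro T.Rel_in_N scale_relators)
next
  case (inv h)
  then have "scale r h \<in> T.N"
    using r by (intro T.Rel_in_N scale_relators)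
  moreover have "inv\<^bsub>T.F\<^esub> h = 0 - h"
    using inv T.Rel_keys by simp
  ultimately show ?case
    by (simp only: scale_simps) (simp add: T.uminus_in_N)
next
  case (eng h1 h2)
  then show ?case by (simp add: scale_simps T.add_in_N)
qed

lemma carrier_M: "carrier M = carrier T.Q"
  by (simp add: scalar_extension_def tensor_free_def tensor_subgroup_def)

lemma zero_M: "\<zero>\<^bsub>M\<^esub> = T.cs 0"
  by (simp add: scalar_extension_def tensor_free_def tensor_subgroup_def T.one_Q[symmetric])

lemma add_M: "X \<oplus>\<^bsub>M\<^esub> Y = X \<otimes>\<^bsub>T.Q\<^esub> Y"
  by (simp add: scalar_extension_def tensor_free_def tensor_subgroup_def)

lemma add_cs:
  assumes "Poly_Mapping.keys p \<subseteq> carrier R \<times> carrier A" "Poly_Mapping.keys q \<subseteq> carrier R \<times> carrier A"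
  shows "T.cs p \<oplus>\<^bsub>M\<^esub> T.cs q = T.cs (p + q)"
  using T.mult_cs[OF assms] by (simp add: add_M)

text \<open>The action on a coset is defined as a union over all its elements. Since
  \<open>scale r\<close> preserves \<open>N\<close>, all cosets in that union coincide, so any
  representative may be used.\<close>

lemma smult_cs:
  assumes r: "r \<in> carrier R" and p: "Poly_Mapping.keys p \<subseteq> carrier R \<times> carrier A"
  shows "r \<odot>\<^bsub>M\<^esub> T.cs p = T.cs (scale r p)"
proof -
  have "T.cs (scale r q) = T.cs (scale r p)" if "q \<in> T.cs p" for q
  proof -
    from that obtain n where n: "n \<in> T.N" "q = n + p"
      by (auto simp: r_coset_def)
    moreover from n p have "Poly_Mapping.keys q \<subseteq> carrier R \<times> carrier A"
      using T.N_keys[OF n(1)] keys_add[of n p] by auto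
    ultimately show ?thesis
      using scale_N[OF r n(1)] T.cs_eq_iff[OF scale_keys[OF r, of q] scale_keys[OF r p]]
      by (simp add: scale_simps)
  qed
  moreover have "p \<in> T.cs p"
    using p group.rcos_self[OF group_free_Abelian_group _ T.N_subgroup, of p] by simp
  moreover have "r \<odot>\<^bsub>M\<^esub> T.cs p = (\<Union>q\<in>T.cs p. T.cs (scale r q))"
    by (simp add: scalar_extension_def tensor_free_def tensor_subgroup_def scale_def)
  ultimately show ?thesis
    by blast
qed

lemma carrier_M_iff:
  "X \<in> carrier M \<longleftrightarrow> (\<exists>p. Poly_Mapping.keys p \<subseteq> carrier R \<times> carrier A \<and> X = T.cs p)"
  by (simp add: carrier_M T.carrier_Q_iff)

lemma cs_closed:
  assumes "Poly_Mapping.keys p \<subseteq> carrier R \<times> carrier A"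
  shows "T.cs p \<in> carrier M" "T.cs (- p) \<in> carrier M"
  using assms unfolding carrier_M_iff by (metis, metis keys_minus)

lemma keys_add_subset:
  "Poly_Mapping.keys p \<subseteq> B \<Longrightarrow> Poly_Mapping.keys q \<subseteq> B \<Longrightarrow> Poly_Mapping.keys (p + q) \<subseteq> B"
  using keys_add[of p q] by auto

lemma module_M: "module R M"
proof (rule moduleI)
  show "cring R" by (rule is_cring)
  interpret Q: comm_group T.Q by (rule T.comm_group_Q)
  show "abelian_group M"
  proof (rule abelian_groupI)
    fix X assume "X \<in> carrier M"
    then show "\<exists>Y\<in>carrier M. Y \<oplus>\<^bsub>M\<^esub> X = \<zero>\<^bsub>M\<^esub>"
      unfolding carrier_M zero_M T.one_Q[symmetric] add_M by (intro bexI[of _ "inv\<^bsub>T.Q\<^esub> X"] Q.l_inv Q.inv_closed)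
  qed (simp_all only: carrier_M zero_M T.one_Q[symmetric] add_M Q.m_closed Q.one_closed Q.m_ac
      Q.l_one Q.r_one)
  fix r s X Y
  assume X: "X \<in> carrier M"
  from X obtain p where p: "Poly_Mapping.keys p \<subseteq> carrier R \<times> carrier A" "X = T.cs p"
    by (auto simp: carrier_M_iff)
  have "scale \<one> p = p"
    using p(1) by (induction p rule: free_Abelian_induct) (auto simp: scale_simps)
  then show "\<one> \<odot>\<^bsub>M\<^esub> X = X"
    using p by (simp add: smult_cs)
  assume r: "r \<in> carrier R"
  show "r \<odot>\<^bsub>M\<^esub> X \<in> carrier M"
    unfolding p(2) smult_cs[OF r p(1)] using scale_keys[OF r p(1)] by (auto simp: carrier_M_iff)
  show "r \<odot>\<^bsub>M\<^esub> (X \<oplus>\<^bsub>M\<^esub> Y) = r \<odot>\<^bsub>M\<^esub> X \<oplus>\<^bsub>M\<^esub> r \<odot>\<^bsub>M\<^esub> Y" if "Y \<in> carrier M"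
  proof -
    from that obtain q where q: "Poly_Mapping.keys q \<subseteq> carrier R \<times> carrier A" "Y = T.cs q"
      by (auto simp: carrier_M_iff)
    show ?thesis
      using r p q by (simp add: smult_cs add_cs scale_simps scale_keys keys_add_subset)
  qed
  assume s: "s \<in> carrier R"
  have "scale (r \<otimes> s) p = scale r (scale s p)"
    using p(1) r s by (induction p rule: free_Abelian_induct) (auto simp: scale_simps m_assoc)
  then show "(r \<otimes> s) \<odot>\<^bsub>M\<^esub> X = r \<odot>\<^bsub>M\<^esub> (s \<odot>\<^bsub>M\<^esub> X)"
    using p r s by (simp add: smult_cs scale_keys)
  \<comment> \<open>Distributivity in the scalar fails in the free group and holds only modulo the
    relators that are additive in the first slot; the other scalar laws already hold for
    \<open>scale\<close> itself.\<close>
  have "scale (r \<oplus> s) p - (scale r p + scale s p) \<in> T.N"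
    using p(1)
  proof (induction p rule: free_Abelian_induct)
    case zero
    then show ?case by (simp add: scale_simps T.zero_in_N)
  next
    case (diff x y)
    then have "scale (r \<oplus> s) x - (scale r x + scale s x) - (scale (r \<oplus> s) y - (scale r y + scale s y)) \<in> T.N"
      by (blast intro: T.diff_in_N)
    then show ?case by (simp add: scale_simps algebra_simps)
  next
    case (gen ta)
    then obtain t a where "ta = (t, a)" "t \<in> carrier R" "a \<in> carrier A" by auto
    then show ?case
      using relator_left[of "r \<otimes> t" "s \<otimes> t" a] r s
      by (simp add: scale_simps l_distr algebra_simps)
  qed
  then show "(r \<oplus> s) \<odot>\<^bsub>M\<^esub> X = r \<odot>\<^bsub>M\<^esub> X \<oplus>\<^bsub>M\<^esub> s \<odot>\<^bsub>M\<^esub> X"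
    using p r s by (simp add: smult_cs add_cs T.cs_eq_iff scale_keys keys_add_subset)
qed

abbreviation st where "st \<equiv> simple_tensor R A"

lemma st_cs: "st r a = T.cs (frag_of (r, a))"
  by (simp add: simple_tensor_def tensor_free_def tensor_subgroup_def)

lemma st_closed: "r \<in> carrier R \<Longrightarrow> a \<in> carrier A \<Longrightarrow> st r a \<in> carrier M"
  by (auto simp: st_cs carrier_M_iff intro!: exI[of _ "frag_of (r, a)"])

lemma smult_st: "r \<in> carrier R \<Longrightarrow> s \<in> carrier R \<Longrightarrow> a \<in> carrier A \<Longrightarrow> r \<odot>\<^bsub>M\<^esub> st s a = st (r \<otimes> s) a"
  by (simp add: st_cs smult_cs scale_simps)

lemma st_mult:
  assumes "r \<in> carrier R" "a \<in> carrier A" "b \<in> carrier A"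
  shows "st r (a \<otimes>\<^bsub>A\<^esub> b) = st r a \<oplus>\<^bsub>M\<^esub> st r b"
  using assms relator_right[OF assms]
  by (simp add: st_cs add_cs T.cs_eq_iff keys_add_subset algebra_simps)

text \<open>Closure under sums is enough because the opposite of a simple tensor is again a simple
  tensor, with the opposite scalar.\<close>

lemma M_induct [consumes 1, case_names tensor add]:
  assumes X: "X \<in> carrier M"
    and tensor: "\<And>r a. r \<in> carrier R \<Longrightarrow> a \<in> carrier A \<Longrightarrow> P (st r a)"
    and add: "\<And>X Y. X \<in> carrier M \<Longrightarrow> Y \<in> carrier M \<Longrightarrow> P X \<Longrightarrow> P Y \<Longrightarrow> P (X \<oplus>\<^bsub>M\<^esub> Y)"
  shows "P X"
proof -
  interpret M: module R M by (rule module_M)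
  from X obtain p where p: "Poly_Mapping.keys p \<subseteq> carrier R \<times> carrier A" "X = T.cs p"
    by (auto simp: carrier_M_iff)
  have neg: "T.cs (- frag_of (r, a)) = st (\<ominus> r) a" if "r \<in> carrier R" "a \<in> carrier A" for r a
  proof -
    \<comment> \<open>The relator for \<open>\<zero> \<oplus> \<zero> = \<zero>\<close> collapses to
      \<open>- frag_of (\<zero>, a)\<close>.\<close>
    have "frag_of (\<zero>, a) \<in> T.N"
      using relator_left[of \<zero> \<zero> a] that T.uminus_in_N by fastforce
    then have "- (frag_of (r, a) + frag_of (\<ominus> r, a)) \<in> T.N"
      using T.diff_in_N[OF relator_left[of r "\<ominus> r" a], of "frag_of (\<zero>, a)"] that
      by (simp add: r_neg algebra_simps)
    then show ?thesis
      using that by (simp add: st_cs T.cs_eq_iff keys_minus algebra_simps)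
  qed
  \<comment> \<open>carrying \<open>- p\<close> along avoids assuming that \<open>P\<close> is preserved by negation\<close>
  have "P (T.cs p) \<and> P (T.cs (- p))"
    using p(1)
  proof (induction p rule: free_Abelian_induct)
    case zero
    have "T.cs 0 = st \<zero> \<one>\<^bsub>A\<^esub>"
      using smult_st[of \<zero> \<zero> "\<one>\<^bsub>A\<^esub>"] M.smult_l_null[OF st_closed[of \<zero> "\<one>\<^bsub>A\<^esub>"]] by (simp add: zero_M)
    then show ?case using tensor by simp
  next
    case (diff x y)
    have eq: "T.cs (x - y) = T.cs x \<oplus>\<^bsub>M\<^esub> T.cs (- y)" "T.cs (- (x - y)) = T.cs y \<oplus>\<^bsub>M\<^esub> T.cs (- x)"
      using diff by (simp_all add: add_cs keys_minus)
    show ?case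
      unfolding eq using diff by (auto intro!: add simp del: keys_minus simp: cs_closed)
  next
    case (gen ra)
    then obtain r a where ra: "ra = (r, a)" "r \<in> carrier R" "a \<in> carrier A" by auto
    with tensor[of r a] tensor[of "\<ominus> r" a] show ?case
      by (simp add: neg) (simp add: st_cs)
  qed
  then show ?thesis using p by simp
qed

text \<open>The universal property of extension of scalars: restricting an \<open>R\<close>-linear
  map to the tensors \<open>st \<one> a\<close> is undone by sending \<open>st r a\<close> to
  \<open>r\<close> times the value of \<open>\<psi>\<close> at \<open>a\<close>. Additivity comes
  from the group quotient, homogeneity is then checked on simple tensors.\<close>

lemma M_lift:
  assumes L: "module R L" and \<psi>: "\<psi> \<in> hom A (add_monoid L)"
  obtains f where "linear_map R M L f"
    "\<And>r a. r \<in> carrier R \<Longrightarrow> a \<in> carrier A \<Longrightarrow> f (st r a) = r \<odot>\<^bsub>L\<^esub> \<psi> a"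
proof -
  interpret L: module R L by (rule L)
  have \<psi>_closed: "\<psi> a \<in> carrier L" if "a \<in> carrier A" for a
    using hom_in_carrier[OF \<psi> that] by simp
  obtain f where f: "f \<in> hom T.Q (add_monoid L)"
    "\<And>s. s \<in> carrier R \<times> carrier A \<Longrightarrow> f (T.cs (frag_of s)) = (case s of (r, a) \<Rightarrow> r \<odot>\<^bsub>L\<^esub> \<psi> a)"
  proof (rule T.lift[of "add_monoid L" "\<lambda>(r, a). r \<odot>\<^bsub>L\<^esub> \<psi> a"])
    show "comm_group (add_monoid L)"
      by (rule L.a_comm_group)
    fix k c
    assume k: "group_hom T.F (add_monoid L) k"
      "\<And>s. s \<in> carrier R \<times> carrier A \<Longrightarrow> k (frag_of s) = (case s of (r, a) \<Rightarrow> r \<odot>\<^bsub>L\<^esub> \<psi> a)"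
      and c: "c \<in> tensor_relators R A"
    show "k c = \<one>\<^bsub>add_monoid L\<^esub>"
      using c unfolding tensor_relators_def
    proof safe
      fix r s a assume "r \<in> carrier R" "s \<in> carrier R" "a \<in> carrier A"
      then show "k (frag_of (r \<oplus> s, a) - frag_of (r, a) - frag_of (s, a)) = \<one>\<^bsub>add_monoid L\<^esub>"
        using \<psi>_closed by (intro group_hom_free_relator[OF k(1)])
            (auto simp: k(2) L.smult_l_distr L.a_comm_group)
    next
      fix r a b assume "r \<in> carrier R" "a \<in> carrier A" "b \<in> carrier A"
      then show "k (frag_of (r, a \<otimes>\<^bsub>A\<^esub> b) - frag_of (r, a) - frag_of (r, b)) = \<one>\<^bsub>add_monoid L\<^esub>"
        using \<psi>_closed hom_mult[OF \<psi>, of a b] by (intro group_hom_free_relator[OF k(1)])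
            (auto simp: k(2) L.smult_r_distr L.a_comm_group)
    qed
  qed (use \<psi>_closed in auto)
  have f_closed: "f X \<in> carrier L" if "X \<in> carrier M" for X
    using hom_in_carrier[OF f(1)] that by (simp add: carrier_M)
  have f_add: "f (X \<oplus>\<^bsub>M\<^esub> Y) = f X \<oplus>\<^bsub>L\<^esub> f Y" if "X \<in> carrier M" "Y \<in> carrier M" for X Y
    using hom_mult[OF f(1), of X Y] that by (simp add: carrier_M add_M)
  have f_st: "f (st r a) = r \<odot>\<^bsub>L\<^esub> \<psi> a" if "r \<in> carrier R" "a \<in> carrier A" for r a
    using f(2)[of "(r, a)"] that by (simp add: st_cs)
  interpret M: module R M by (rule module_M)
  have "f (r \<odot>\<^bsub>M\<^esub> X) = r \<odot>\<^bsub>L\<^esub> f X" if r: "r \<in> carrier R" and "X \<in> carrier M" for r X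
    using that(2)
  proof (induction X rule: M_induct)
    case (tensor s a)
    then show ?case
      using r \<psi>_closed by (simp add: smult_st f_st L.smult_assoc1)
  next
    case (add X Y)
    then show ?case
      using r f_closed by (simp add: M.smult_r_distr L.smult_r_distr f_add)
  qed
  then have "linear_map R M L f"
    using f_closed f_add by (auto simp: linear_map_def)
  with f_st show thesis by (rule that[rotated])
qed

end

section \<open>Finite categories and functors\<close>

lemma prod_cat_simps [simp]:
  "Obj (prod_cat C D) = Obj C \<times> Obj D" "Arr (prod_cat C D) = Arr C \<times> Arr D"
  "Dom (prod_cat C D) (f, g) = (Dom C f, Dom D g)" "Cod (prod_cat C D) (f, g) = (Cod C f, Cod D g)"
  "Ident (prod_cat C D) (x, y) = (Ident C x, Ident D y)"
  "Comp (prod_cat C D) (f, g) (f', g') = (Comp C f f', Comp D g g')"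
  by (simp_all add: prod_cat_def)

lemma op_cat_simps [simp]:
  "Obj (op_cat C) = Obj C" "Arr (op_cat C) = Arr C" "Dom (op_cat C) = Cod C" "Cod (op_cat C) = Dom C"
  "Ident (op_cat C) = Ident C" "Comp (op_cat C) f g = Comp C g f"
  by (simp_all add: op_cat_def)

lemma category_prod_cat:
  assumes "category C" "category D"
  shows "category (prod_cat C D)"
proof -
  interpret C: category C by fact
  interpret D: category D by fact
  show ?thesis
    by unfold_locales
      (auto simp: C.Dom_closed D.Dom_closed C.Cod_closed D.Cod_closed C.Ident_closed D.Ident_closed
        C.Dom_Ident D.Dom_Ident C.Cod_Ident D.Cod_Ident C.Comp_closed D.Comp_closed C.Dom_Comp D.Dom_Comp
        C.Cod_Comp D.Cod_Comp C.Comp_Ident D.Comp_Ident C.Ident_Comp D.Ident_Comp C.Comp_assoc D.Comp_assoc)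
qed

lemma category_op_cat:
  assumes "category C"
  shows "category (op_cat C)"
proof -
  interpret C: category C by fact
  show ?thesis
    by unfold_locales
      (auto simp: C.Dom_closed C.Cod_closed C.Ident_closed C.Dom_Ident C.Cod_Ident C.Comp_closed
        C.Dom_Comp C.Cod_Comp C.Comp_Ident C.Ident_Comp C.Comp_assoc)
qed

lemma finite_categoryD: "finite_category C \<Longrightarrow> category C" "finite_category C \<Longrightarrow> finite (Obj C)"
  by (simp_all add: finite_category_def finite_category_axioms_def)

lemma finite_category_prod_cat:
  "finite_category C \<Longrightarrow> finite_category D \<Longrightarrow> finite_category (prod_cat C D)"
  by (simp add: finite_category_def finite_category_axioms_def category_prod_cat)

lemma finite_category_op_cat: "finite_category C \<Longrightarrow> finite_category (op_cat C)"
  by (simp add: finite_category_def finite_category_axioms_def category_op_cat)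

section \<open>Reindexing and natural isomorphism of set-valued functors\<close>

definition is_functor ::
  "('o, 'a) cat \<Rightarrow> ('p, 'b) cat \<Rightarrow> ('o \<Rightarrow> 'p) \<Rightarrow> ('a \<Rightarrow> 'b) \<Rightarrow> bool" where
  "is_functor P Q j J \<longleftrightarrow> (\<forall>x\<in>Obj P. j x \<in> Obj Q \<and> J (Ident P x) = Ident Q (j x)) \<and>
     (\<forall>f\<in>Arr P. J f \<in> Arr Q \<and> Dom Q (J f) = j (Dom P f) \<and> Cod Q (J f) = j (Cod P f)) \<and>
     (\<forall>f\<in>Arr P. \<forall>g\<in>Arr P. Dom P g = Cod P f \<longrightarrow> J (Comp P g f) = Comp Q (J g) (J f))"

text \<open>Precomposition with a functor. The opposite of a biset, currying, and representable
  bisets are all instances, so they share the lemmas on functoriality and isomorphism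
  invariance.\<close>

definition reindex ::
  "('o \<Rightarrow> 'p) \<Rightarrow> ('a \<Rightarrow> 'b) \<Rightarrow> ('p, 'b, 'x) set_fun \<Rightarrow> ('o, 'a, 'x) set_fun" where
  "reindex j J F = \<lparr>fobj = fobj F \<circ> j, fmor = fmor F \<circ> J\<rparr>"

lemma reindex_simps [simp]:
  "fobj (reindex j J F) x = fobj F (j x)" "fmor (reindex j J F) f = fmor F (J f)"
  by (simp_all add: reindex_def)

lemma finset_functor_reindex:
  assumes "finset_functor Q F" "category P" and J: "is_functor P Q j J"
  shows "finset_functor P (reindex j J F)"
proof -
  interpret F: finset_functor Q F by fact
  interpret P: category P by fact
  have "fmor F (J f) u \<in> fobj F (j (Cod P f))" if "f \<in> Arr P" "u \<in> fobj F (j (Dom P f))" for f u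
    using J that F.fmor_closed[of "J f" u] by (simp add: is_functor_def)
  with J show ?thesis
    by unfold_locales (auto simp: is_functor_def F.finite_fobj F.fmor_Ident F.fmor_Comp)
qed

lemma naturally_iso_reindex:
  assumes "naturally_iso Q F G" "category P" and J: "is_functor P Q j J"
  shows "naturally_iso P (reindex j J F) (reindex j J G)"
proof -
  interpret P: category P by fact
  obtain \<eta> where \<eta>: "\<And>x. x \<in> Obj Q \<Longrightarrow> bij_betw (\<eta> x) (fobj F x) (fobj G x)"
    "\<And>f u. f \<in> Arr Q \<Longrightarrow> u \<in> fobj F (Dom Q f) \<Longrightarrow> \<eta> (Cod Q f) (fmor F f u) = fmor G f (\<eta> (Dom Q f) u)"
    using assms(1) unfolding naturally_iso_def by blast
  show ?thesis
    unfolding naturally_iso_def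
  proof (intro exI[of _ "\<eta> \<circ> j"] conjI ballI)
    fix f u assume "f \<in> Arr P" "u \<in> fobj (reindex j J F) (Dom P f)"
    with J \<eta>(2)[of "J f" u] show "(\<eta> \<circ> j) (Cod P f) (fmor (reindex j J F) f u)
      = fmor (reindex j J G) f ((\<eta> \<circ> j) (Dom P f) u)"
      by (simp add: is_functor_def)
  qed (use J \<eta>(1) in \<open>simp add: is_functor_def\<close>)
qed

lemma naturally_iso_refl: "naturally_iso P F F"
  unfolding naturally_iso_def by (rule exI[of _ "\<lambda>_ u. u"]) (simp add: bij_betw_def)

lemma naturally_iso_trans:
  assumes "category P" "naturally_iso P F G" "naturally_iso P G H"
  shows "naturally_iso P F H"
proof -
  interpret P: category P by fact
  obtain \<eta> where \<eta>: "\<And>x. x \<in> Obj P \<Longrightarrow> bij_betw (\<eta> x) (fobj F x) (fobj G x)"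
    "\<And>f u. f \<in> Arr P \<Longrightarrow> u \<in> fobj F (Dom P f) \<Longrightarrow> \<eta> (Cod P f) (fmor F f u) = fmor G f (\<eta> (Dom P f) u)"
    using assms(2) unfolding naturally_iso_def by blast
  obtain \<theta> where \<theta>: "\<And>x. x \<in> Obj P \<Longrightarrow> bij_betw (\<theta> x) (fobj G x) (fobj H x)"
    "\<And>f u. f \<in> Arr P \<Longrightarrow> u \<in> fobj G (Dom P f) \<Longrightarrow> \<theta> (Cod P f) (fmor G f u) = fmor H f (\<theta> (Dom P f) u)"
    using assms(3) unfolding naturally_iso_def by blast
  show ?thesis
    unfolding naturally_iso_def
  proof (intro exI[of _ "\<lambda>x u. \<theta> x (\<eta> x u)"] conjI ballI)
    fix x assume "x \<in> Obj P"
    then show "bij_betw (\<lambda>u. \<theta> x (\<eta> x u)) (fobj F x) (fobj H x)"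
      using bij_betw_trans[OF \<eta>(1) \<theta>(1)] by (simp add: comp_def)
  next
    fix f u assume f: "f \<in> Arr P" "u \<in> fobj F (Dom P f)"
    then have "\<eta> (Dom P f) u \<in> fobj G (Dom P f)"
      using \<eta>(1) P.Dom_closed bij_betwE by blast
    with f show "\<theta> (Cod P f) (\<eta> (Cod P f) (fmor F f u)) = fmor H f (\<theta> (Dom P f) (\<eta> (Dom P f) u))"
      by (simp add: \<eta> \<theta>)
  qed
qed

text \<open>The definition of natural isomorphism only records bijectivity of the components.
  Naturality of the inverse follows by applying \<open>\<theta>\<close> to the naturality square of
  \<open>\<eta>\<close> at \<open>\<theta> v\<close>.\<close>

lemma naturally_iso_inverseE:
  assumes F: "finset_functor P F" and "naturally_iso P F G"
  obtains \<eta> \<theta> where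
    "\<And>x u. x \<in> Obj P \<Longrightarrow> u \<in> fobj F x \<Longrightarrow> \<eta> x u \<in> fobj G x \<and> \<theta> x (\<eta> x u) = u"
    "\<And>x v. x \<in> Obj P \<Longrightarrow> v \<in> fobj G x \<Longrightarrow> \<theta> x v \<in> fobj F x \<and> \<eta> x (\<theta> x v) = v"
    "\<And>f u. f \<in> Arr P \<Longrightarrow> u \<in> fobj F (Dom P f) \<Longrightarrow> \<eta> (Cod P f) (fmor F f u) = fmor G f (\<eta> (Dom P f) u)"
    "\<And>f v. f \<in> Arr P \<Longrightarrow> v \<in> fobj G (Dom P f) \<Longrightarrow> \<theta> (Cod P f) (fmor G f v) = fmor F f (\<theta> (Dom P f) v)"
proof -
  interpret F: finset_functor P F by fact
  obtain \<eta> where \<eta>: "\<And>x. x \<in> Obj P \<Longrightarrow> bij_betw (\<eta> x) (fobj F x) (fobj G x)"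
    "\<And>f u. f \<in> Arr P \<Longrightarrow> u \<in> fobj F (Dom P f) \<Longrightarrow> \<eta> (Cod P f) (fmor F f u) = fmor G f (\<eta> (Dom P f) u)"
    using assms(2) unfolding naturally_iso_def by blast
  define \<theta> where "\<theta> x = inv_into (fobj F x) (\<eta> x)" for x
  have \<eta>\<theta>: "\<eta> x u \<in> fobj G x \<and> \<theta> x (\<eta> x u) = u" if "x \<in> Obj P" "u \<in> fobj F x" for x u
    using \<eta>(1)[OF that(1)] that(2) unfolding \<theta>_def by (auto simp: bij_betw_def)
  have \<theta>\<eta>: "\<theta> x v \<in> fobj F x \<and> \<eta> x (\<theta> x v) = v" if "x \<in> Obj P" "v \<in> fobj G x" for x v
    using \<eta>(1)[OF that(1)] that(2) unfolding \<theta>_def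
    by (auto simp: bij_betw_def inv_into_into f_inv_into_f)
  have "\<theta> (Cod P f) (fmor G f v) = fmor F f (\<theta> (Dom P f) v)"
    if f: "f \<in> Arr P" "v \<in> fobj G (Dom P f)" for f v
  proof -
    from f have u: "\<theta> (Dom P f) v \<in> fobj F (Dom P f)" "\<eta> (Dom P f) (\<theta> (Dom P f) v) = v"
      using \<theta>\<eta> F.Dom_closed by blast+
    with f have "\<theta> (Cod P f) (fmor G f v) = \<theta> (Cod P f) (\<eta> (Cod P f) (fmor F f (\<theta> (Dom P f) v)))"
      by (simp add: \<eta>(2))
    also have "\<dots> = fmor F f (\<theta> (Dom P f) v)"
      using f u(1) F.fmor_closed F.Cod_closed \<eta>\<theta> by blast
    finally show ?thesis .
  qed
  with \<eta>\<theta> \<theta>\<eta> \<eta>(2) show thesis by (rule that)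
qed

lemma naturally_isoI:
  assumes "\<And>x u. x \<in> Obj P \<Longrightarrow> u \<in> fobj F x \<Longrightarrow> \<eta> x u \<in> fobj G x \<and> \<theta> x (\<eta> x u) = u"
    and "\<And>x v. x \<in> Obj P \<Longrightarrow> v \<in> fobj G x \<Longrightarrow> \<theta> x v \<in> fobj F x \<and> \<eta> x (\<theta> x v) = v"
    and "\<And>f u. f \<in> Arr P \<Longrightarrow> u \<in> fobj F (Dom P f) \<Longrightarrow> \<eta> (Cod P f) (fmor F f u) = fmor G f (\<eta> (Dom P f) u)"
  shows "naturally_iso P F G"
  unfolding naturally_iso_def
proof (intro exI[of _ \<eta>] conjI ballI)
  fix x assume "x \<in> Obj P"
  then show "bij_betw (\<eta> x) (fobj F x) (fobj G x)"
    using assms(1,2) by (intro bij_betwI[of _ _ _ "\<theta> x"]) auto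
qed (use assms(3) in auto)

lemma naturally_iso_sym:
  assumes "finset_functor P F" "naturally_iso P F G"
  shows "naturally_iso P G F"
  using assms by (rule naturally_iso_inverseE) (rule naturally_isoI)

text \<open>Transport of structure along injections of the finite values into the natural numbers.
  It is the bridge from arbitrary value types to the \<open>nat\<close>-valued functors of which
  classes are made.\<close>

lemma nat_copy:
  fixes F :: "('o, 'a, 'x) set_fun"
  assumes F: "finset_functor P F"
  obtains G :: "('o, 'a, nat) set_fun" where "finset_functor P G" "naturally_iso P F G"
proof -
  interpret F: finset_functor P F by fact
  obtain \<eta> :: "'o \<Rightarrow> 'x \<Rightarrow> nat" where \<eta>: "\<And>x. x \<in> Obj P \<Longrightarrow> inj_on (\<eta> x) (fobj F x)"
    using finite_imp_inj_to_nat_seg[OF F.finite_fobj] by metis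
  define \<theta> where "\<theta> x = inv_into (fobj F x) (\<eta> x)" for x
  have [simp]: "\<theta> x (\<eta> x u) = u" if "x \<in> Obj P" "u \<in> fobj F x" for x u
    using \<eta>[OF that(1)] that(2) by (simp add: \<theta>_def)
  define G :: "('o, 'a, nat) set_fun" where
    "G = \<lparr>fobj = (\<lambda>x. \<eta> x ` fobj F x), fmor = (\<lambda>f v. \<eta> (Cod P f) (fmor F f (\<theta> (Dom P f) v)))\<rparr>"
  have "finset_functor P G"
    by unfold_locales
      (auto simp: G_def F.finite_fobj F.fmor_closed F.fmor_Ident F.fmor_Comp F.Dom_closed F.Cod_closed
        F.Dom_Ident F.Cod_Ident F.Dom_Comp F.Cod_Comp)
  moreover have "naturally_iso P F G"
    by (rule naturally_isoI[of _ _ \<eta> _ \<theta>]) (auto simp: G_def F.Dom_closed)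
  ultimately show thesis by (rule that)
qed

section \<open>Bisets\<close>

abbreviation biset_iso where "biset_iso C D \<equiv> naturally_iso (prod_cat C (op_cat D))"

text \<open>The functor axioms with arrows split into pairs and the second variable written
  contravariantly, so that neither \<open>prod_cat\<close> nor \<open>op_cat\<close> has to be
  unfolded in calculations.\<close>

locale biset = C: category C + D: category D
  for C :: "('o, 'a) cat" and D :: "('p, 'b) cat" and \<Omega> :: "('o, 'a, 'p, 'b, 'x) biset" +
  assumes fin: "x \<in> Obj C \<Longrightarrow> y \<in> Obj D \<Longrightarrow> finite (fobj \<Omega> (x, y))"
    and closed: "\<alpha> \<in> Arr C \<Longrightarrow> \<beta> \<in> Arr D \<Longrightarrow> u \<in> fobj \<Omega> (Dom C \<alpha>, Cod D \<beta>)
      \<Longrightarrow> fmor \<Omega> (\<alpha>, \<beta>) u \<in> fobj \<Omega> (Cod C \<alpha>, Dom D \<beta>)"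
    and ident: "x \<in> Obj C \<Longrightarrow> y \<in> Obj D \<Longrightarrow> u \<in> fobj \<Omega> (x, y)
      \<Longrightarrow> fmor \<Omega> (Ident C x, Ident D y) u = u"
    and comp: "\<alpha> \<in> Arr C \<Longrightarrow> \<alpha>' \<in> Arr C \<Longrightarrow> \<beta> \<in> Arr D \<Longrightarrow> \<beta>' \<in> Arr D \<Longrightarrow> Dom C \<alpha>' = Cod C \<alpha>
      \<Longrightarrow> Dom D \<beta> = Cod D \<beta>' \<Longrightarrow> u \<in> fobj \<Omega> (Dom C \<alpha>, Cod D \<beta>)
      \<Longrightarrow> fmor \<Omega> (\<alpha>', \<beta>') (fmor \<Omega> (\<alpha>, \<beta>) u) = fmor \<Omega> (Comp C \<alpha>' \<alpha>, Comp D \<beta> \<beta>') u"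
begin

lemma as_functor: "finset_functor (prod_cat C (op_cat D)) \<Omega>"
proof -
  interpret P: category "prod_cat C (op_cat D)"
    by (intro category_prod_cat category_op_cat C.category_axioms D.category_axioms)
  show ?thesis
    by unfold_locales (auto simp: fin closed ident comp)
qed

lemma is_biset: "is_biset C D \<Omega>"
  using as_functor by (simp add: is_biset_def)

lemma left_closed:
  "\<alpha> \<in> Arr C \<Longrightarrow> y \<in> Obj D \<Longrightarrow> u \<in> fobj \<Omega> (Dom C \<alpha>, y)
    \<Longrightarrow> fmor \<Omega> (\<alpha>, Ident D y) u \<in> fobj \<Omega> (Cod C \<alpha>, y)"
  using closed[of \<alpha> "Ident D y" u] by (simp add: D.Ident_closed D.Dom_Ident D.Cod_Ident)

lemma right_closed:
  "x \<in> Obj C \<Longrightarrow> \<beta> \<in> Arr D \<Longrightarrow> u \<in> fobj \<Omega> (x, Cod D \<beta>)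
    \<Longrightarrow> fmor \<Omega> (Ident C x, \<beta>) u \<in> fobj \<Omega> (x, Dom D \<beta>)"
  using closed[of "Ident C x" \<beta> u] by (simp add: C.Ident_closed C.Dom_Ident C.Cod_Ident)

text \<open>Together with \<open>right_left\<close> this says that the left and the right action
  commute: either order composes to the two-sided action.\<close>

lemma left_right:
  assumes "\<alpha> \<in> Arr C" "\<beta> \<in> Arr D" "u \<in> fobj \<Omega> (Dom C \<alpha>, Cod D \<beta>)"
  shows "fmor \<Omega> (\<alpha>, Ident D (Dom D \<beta>)) (fmor \<Omega> (Ident C (Dom C \<alpha>), \<beta>) u) = fmor \<Omega> (\<alpha>, \<beta>) u"
  using assms comp[of "Ident C (Dom C \<alpha>)" \<alpha> \<beta> "Ident D (Dom D \<beta>)" u]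
  by (simp add: C.Ident_closed D.Ident_closed C.Dom_closed D.Dom_closed C.Cod_Ident C.Dom_Ident
      D.Cod_Ident C.Comp_Ident D.Comp_Ident)

lemma right_left:
  assumes "\<alpha> \<in> Arr C" "\<beta> \<in> Arr D" "u \<in> fobj \<Omega> (Dom C \<alpha>, Cod D \<beta>)"
  shows "fmor \<Omega> (Ident C (Cod C \<alpha>), \<beta>) (fmor \<Omega> (\<alpha>, Ident D (Cod D \<beta>)) u) = fmor \<Omega> (\<alpha>, \<beta>) u"
  using assms comp[of \<alpha> "Ident C (Cod C \<alpha>)" "Ident D (Cod D \<beta>)" \<beta> u]
  by (simp add: C.Ident_closed D.Ident_closed C.Cod_closed D.Cod_closed C.Cod_Ident C.Dom_Ident
      D.Cod_Ident D.Dom_Ident C.Ident_Comp D.Ident_Comp)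

lemma iso_inverseE:
  assumes "biset_iso C D \<Omega> \<Omega>'"
  obtains \<eta> \<theta> where
    "\<And>x y u. x \<in> Obj C \<Longrightarrow> y \<in> Obj D \<Longrightarrow> u \<in> fobj \<Omega> (x, y) \<Longrightarrow> \<eta> x y u \<in> fobj \<Omega>' (x, y)"
    "\<And>x y u. x \<in> Obj C \<Longrightarrow> y \<in> Obj D \<Longrightarrow> u \<in> fobj \<Omega> (x, y) \<Longrightarrow> \<theta> x y (\<eta> x y u) = u"
    "\<And>x y v. x \<in> Obj C \<Longrightarrow> y \<in> Obj D \<Longrightarrow> v \<in> fobj \<Omega>' (x, y) \<Longrightarrow> \<theta> x y v \<in> fobj \<Omega> (x, y)"
    "\<And>x y v. x \<in> Obj C \<Longrightarrow> y \<in> Obj D \<Longrightarrow> v \<in> fobj \<Omega>' (x, y) \<Longrightarrow> \<eta> x y (\<theta> x y v) = v"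
    "\<And>\<alpha> \<beta> u. \<alpha> \<in> Arr C \<Longrightarrow> \<beta> \<in> Arr D \<Longrightarrow> u \<in> fobj \<Omega> (Dom C \<alpha>, Cod D \<beta>)
      \<Longrightarrow> \<eta> (Cod C \<alpha>) (Dom D \<beta>) (fmor \<Omega> (\<alpha>, \<beta>) u) = fmor \<Omega>' (\<alpha>, \<beta>) (\<eta> (Dom C \<alpha>) (Cod D \<beta>) u)"
    "\<And>\<alpha> \<beta> v. \<alpha> \<in> Arr C \<Longrightarrow> \<beta> \<in> Arr D \<Longrightarrow> v \<in> fobj \<Omega>' (Dom C \<alpha>, Cod D \<beta>)
      \<Longrightarrow> \<theta> (Cod C \<alpha>) (Dom D \<beta>) (fmor \<Omega>' (\<alpha>, \<beta>) v) = fmor \<Omega> (\<alpha>, \<beta>) (\<theta> (Dom C \<alpha>) (Cod D \<beta>) v)"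
proof -
  obtain \<eta> \<theta> where *:
    "\<And>z u. z \<in> Obj (prod_cat C (op_cat D)) \<Longrightarrow> u \<in> fobj \<Omega> z \<Longrightarrow> \<eta> z u \<in> fobj \<Omega>' z \<and> \<theta> z (\<eta> z u) = u"
    "\<And>z v. z \<in> Obj (prod_cat C (op_cat D)) \<Longrightarrow> v \<in> fobj \<Omega>' z \<Longrightarrow> \<theta> z v \<in> fobj \<Omega> z \<and> \<eta> z (\<theta> z v) = v"
    "\<And>f u. f \<in> Arr (prod_cat C (op_cat D)) \<Longrightarrow> u \<in> fobj \<Omega> (Dom (prod_cat C (op_cat D)) f)
      \<Longrightarrow> \<eta> (Cod (prod_cat C (op_cat D)) f) (fmor \<Omega> f u) = fmor \<Omega>' f (\<eta> (Dom (prod_cat C (op_cat D)) f) u)"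
    "\<And>f v. f \<in> Arr (prod_cat C (op_cat D)) \<Longrightarrow> v \<in> fobj \<Omega>' (Dom (prod_cat C (op_cat D)) f)
      \<Longrightarrow> \<theta> (Cod (prod_cat C (op_cat D)) f) (fmor \<Omega>' f v) = fmor \<Omega> f (\<theta> (Dom (prod_cat C (op_cat D)) f) v)"
    using naturally_iso_inverseE[OF as_functor assms] by blast
  show thesis
    by (rule that[of "\<lambda>x y. \<eta> (x, y)" "\<lambda>x y. \<theta> (x, y)"])
      (use *(1)[of "(_, _)"] *(2)[of "(_, _)"] *(3)[of "(_, _)"] *(4)[of "(_, _)"] in auto)
qed

end

lemma biset_iff_is_biset:
  assumes "category C" "category D"
  shows "is_biset C D \<Omega> \<longleftrightarrow> biset C D \<Omega>"
proof
  assume "is_biset C D \<Omega>"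
  then interpret F: finset_functor "prod_cat C (op_cat D)" \<Omega> by (simp add: is_biset_def)
  show "biset C D \<Omega>"
    using assms F.finite_fobj[of "(_, _)"] F.fmor_closed[of "(_, _)"] F.fmor_Ident[of "(_, _)"]
      F.fmor_Comp[of "(_, _)" "(_, _)"]
    by (auto simp: biset_def biset_axioms_def)
qed (rule biset.is_biset)

lemma biset_isoI:
  assumes "\<And>x y u. x \<in> Obj C \<Longrightarrow> y \<in> Obj D \<Longrightarrow> u \<in> fobj \<Omega> (x, y) \<Longrightarrow> \<eta> x y u \<in> fobj \<Omega>' (x, y)"
    and "\<And>x y u. x \<in> Obj C \<Longrightarrow> y \<in> Obj D \<Longrightarrow> u \<in> fobj \<Omega> (x, y) \<Longrightarrow> \<theta> x y (\<eta> x y u) = u"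
    and "\<And>x y v. x \<in> Obj C \<Longrightarrow> y \<in> Obj D \<Longrightarrow> v \<in> fobj \<Omega>' (x, y) \<Longrightarrow> \<theta> x y v \<in> fobj \<Omega> (x, y)"
    and "\<And>x y v. x \<in> Obj C \<Longrightarrow> y \<in> Obj D \<Longrightarrow> v \<in> fobj \<Omega>' (x, y) \<Longrightarrow> \<eta> x y (\<theta> x y v) = v"
    and "\<And>\<alpha> \<beta> u. \<alpha> \<in> Arr C \<Longrightarrow> \<beta> \<in> Arr D \<Longrightarrow> u \<in> fobj \<Omega> (Dom C \<alpha>, Cod D \<beta>)
      \<Longrightarrow> \<eta> (Cod C \<alpha>) (Dom D \<beta>) (fmor \<Omega> (\<alpha>, \<beta>) u) = fmor \<Omega>' (\<alpha>, \<beta>) (\<eta> (Dom C \<alpha>) (Cod D \<beta>) u)"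
  shows "biset_iso C D \<Omega> \<Omega>'"
  by (rule naturally_isoI[of _ _ "\<lambda>(x, y). \<eta> x y" _ "\<lambda>(x, y). \<theta> x y"]) (use assms in auto)

section \<open>Identity, union and product of bisets, and opposites as reindexing\<close>

lemma biset_union_simps [simp]:
  "fobj (biset_union X Y) z = fobj X z <+> fobj Y z"
  "fmor (biset_union X Y) f (Inl u) = Inl (fmor X f u)"
  "fmor (biset_union X Y) f (Inr v) = Inr (fmor Y f v)"
  by (simp_all add: biset_union_def)

lemma biset_prod_simps [simp]:
  "fobj (biset_prod X Y) ((x, x'), (y, y')) = fobj X (x, y) \<times> fobj Y (x', y')"
  "fmor (biset_prod X Y) ((\<alpha>, \<alpha>'), (\<beta>, \<beta>')) (u, v) = (fmor X (\<alpha>, \<beta>) u, fmor Y (\<alpha>', \<beta>') v)"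
  by (simp_all add: biset_prod_def)

lemma biset_op_simps [simp]:
  "fobj (biset_op X) (y, x) = fobj X (x, y)" "fmor (biset_op X) (\<beta>, \<alpha>) = fmor X (\<alpha>, \<beta>)"
  by (simp_all add: biset_op_def)

lemma biset_id_simps [simp]:
  "fobj (biset_id C) (x, y) = {f \<in> Arr C. Dom C f = y \<and> Cod C f = x}"
  "fmor (biset_id C) (\<alpha>, \<beta>) f = Comp C \<alpha> (Comp C f \<beta>)"
  by (simp_all add: biset_id_def)

lemma biset_biset_id:
  assumes "finite_category C"
  shows "biset C C (biset_id C)"
proof -
  interpret C: finite_category C by fact
  show ?thesis
    by unfold_locales
      (auto simp: C.finite_Arr C.Comp_closed C.Dom_Comp C.Cod_Comp C.Comp_Ident C.Ident_Comp
        C.Dom_closed C.Cod_closed C.Comp_assoc)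
qed

lemma biset_biset_union:
  assumes "biset C D \<Omega>" "biset C D \<Psi>"
  shows "biset C D (biset_union \<Omega> \<Psi>)"
proof -
  interpret A: biset C D \<Omega> by fact
  interpret B: biset C D \<Psi> by fact
  show ?thesis
    by unfold_locales
      (auto simp: A.fin B.fin A.closed B.closed A.ident B.ident A.comp B.comp)
qed

lemma biset_iso_union:
  assumes "biset C D \<Omega>" "biset C D \<Psi>" "biset_iso C D \<Omega> \<Omega>'" "biset_iso C D \<Psi> \<Psi>'"
  shows "biset_iso C D (biset_union \<Omega> \<Psi>) (biset_union \<Omega>' \<Psi>')"
proof -
  interpret A: biset C D \<Omega> by fact
  interpret B: biset C D \<Psi> by fact
  show ?thesis
  proof (rule A.iso_inverseE[OF assms(3)], rule B.iso_inverseE[OF assms(4)])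
    fix \<eta> \<theta> \<eta>' \<theta>'
    assume *: "\<And>x y u. x \<in> Obj C \<Longrightarrow> y \<in> Obj D \<Longrightarrow> u \<in> fobj \<Omega> (x, y) \<Longrightarrow> \<eta> x y u \<in> fobj \<Omega>' (x, y)"
    "\<And>x y u. x \<in> Obj C \<Longrightarrow> y \<in> Obj D \<Longrightarrow> u \<in> fobj \<Omega> (x, y) \<Longrightarrow> \<theta> x y (\<eta> x y u) = u"
    "\<And>x y v. x \<in> Obj C \<Longrightarrow> y \<in> Obj D \<Longrightarrow> v \<in> fobj \<Omega>' (x, y) \<Longrightarrow> \<theta> x y v \<in> fobj \<Omega> (x, y)"
    "\<And>x y v. x \<in> Obj C \<Longrightarrow> y \<in> Obj D \<Longrightarrow> v \<in> fobj \<Omega>' (x, y) \<Longrightarrow> \<eta> x y (\<theta> x y v) = v"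
    "\<And>\<alpha> \<beta> u. \<alpha> \<in> Arr C \<Longrightarrow> \<beta> \<in> Arr D \<Longrightarrow> u \<in> fobj \<Omega> (Dom C \<alpha>, Cod D \<beta>)
      \<Longrightarrow> \<eta> (Cod C \<alpha>) (Dom D \<beta>) (fmor \<Omega> (\<alpha>, \<beta>) u) = fmor \<Omega>' (\<alpha>, \<beta>) (\<eta> (Dom C \<alpha>) (Cod D \<beta>) u)"
    "\<And>x y u. x \<in> Obj C \<Longrightarrow> y \<in> Obj D \<Longrightarrow> u \<in> fobj \<Psi> (x, y) \<Longrightarrow> \<eta>' x y u \<in> fobj \<Psi>' (x, y)"
    "\<And>x y u. x \<in> Obj C \<Longrightarrow> y \<in> Obj D \<Longrightarrow> u \<in> fobj \<Psi> (x, y) \<Longrightarrow> \<theta>' x y (\<eta>' x y u) = u"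
    "\<And>x y v. x \<in> Obj C \<Longrightarrow> y \<in> Obj D \<Longrightarrow> v \<in> fobj \<Psi>' (x, y) \<Longrightarrow> \<theta>' x y v \<in> fobj \<Psi> (x, y)"
    "\<And>x y v. x \<in> Obj C \<Longrightarrow> y \<in> Obj D \<Longrightarrow> v \<in> fobj \<Psi>' (x, y) \<Longrightarrow> \<eta>' x y (\<theta>' x y v) = v"
    "\<And>\<alpha> \<beta> u. \<alpha> \<in> Arr C \<Longrightarrow> \<beta> \<in> Arr D \<Longrightarrow> u \<in> fobj \<Psi> (Dom C \<alpha>, Cod D \<beta>)
      \<Longrightarrow> \<eta>' (Cod C \<alpha>) (Dom D \<beta>) (fmor \<Psi> (\<alpha>, \<beta>) u) = fmor \<Psi>' (\<alpha>, \<beta>) (\<eta>' (Dom C \<alpha>) (Cod D \<beta>) u)"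
    show ?thesis
      by (rule biset_isoI[of _ _ _ "\<lambda>x y. map_sum (\<eta> x y) (\<eta>' x y)" _ "\<lambda>x y. map_sum (\<theta> x y) (\<theta>' x y)"])
        (auto simp: *)
  qed
qed

lemma biset_biset_prod:
  assumes "biset C D \<Omega>" "biset C' D' \<Psi>"
  shows "biset (prod_cat C C') (prod_cat D D') (biset_prod \<Omega> \<Psi>)"
proof -
  interpret A: biset C D \<Omega> by fact
  interpret B: biset C' D' \<Psi> by fact
  interpret L: category "prod_cat C C'"
    by (intro category_prod_cat A.C.category_axioms B.C.category_axioms)
  interpret R: category "prod_cat D D'"
    by (intro category_prod_cat A.D.category_axioms B.D.category_axioms)
  show ?thesis
    by unfold_locales
      (auto simp: A.fin B.fin A.closed B.closed A.ident B.ident A.comp B.comp)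
qed

lemma biset_iso_prod:
  assumes "biset C D \<Omega>" "biset C' D' \<Psi>" "biset_iso C D \<Omega> \<Omega>'" "biset_iso C' D' \<Psi> \<Psi>'"
  shows "biset_iso (prod_cat C C') (prod_cat D D') (biset_prod \<Omega> \<Psi>) (biset_prod \<Omega>' \<Psi>')"
proof -
  interpret A: biset C D \<Omega> by fact
  interpret B: biset C' D' \<Psi> by fact
  show ?thesis
  proof (rule A.iso_inverseE[OF assms(3)], rule B.iso_inverseE[OF assms(4)])
    fix \<eta> \<theta> \<eta>' \<theta>'
    assume *: "\<And>x y u. x \<in> Obj C \<Longrightarrow> y \<in> Obj D \<Longrightarrow> u \<in> fobj \<Omega> (x, y) \<Longrightarrow> \<eta> x y u \<in> fobj \<Omega>' (x, y)"
    "\<And>x y u. x \<in> Obj C \<Longrightarrow> y \<in> Obj D \<Longrightarrow> u \<in> fobj \<Omega> (x, y) \<Longrightarrow> \<theta> x y (\<eta> x y u) = u"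
    "\<And>x y v. x \<in> Obj C \<Longrightarrow> y \<in> Obj D \<Longrightarrow> v \<in> fobj \<Omega>' (x, y) \<Longrightarrow> \<theta> x y v \<in> fobj \<Omega> (x, y)"
    "\<And>x y v. x \<in> Obj C \<Longrightarrow> y \<in> Obj D \<Longrightarrow> v \<in> fobj \<Omega>' (x, y) \<Longrightarrow> \<eta> x y (\<theta> x y v) = v"
    "\<And>\<alpha> \<beta> u. \<alpha> \<in> Arr C \<Longrightarrow> \<beta> \<in> Arr D \<Longrightarrow> u \<in> fobj \<Omega> (Dom C \<alpha>, Cod D \<beta>)
      \<Longrightarrow> \<eta> (Cod C \<alpha>) (Dom D \<beta>) (fmor \<Omega> (\<alpha>, \<beta>) u) = fmor \<Omega>' (\<alpha>, \<beta>) (\<eta> (Dom C \<alpha>) (Cod D \<beta>) u)"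
    "\<And>x y u. x \<in> Obj C' \<Longrightarrow> y \<in> Obj D' \<Longrightarrow> u \<in> fobj \<Psi> (x, y) \<Longrightarrow> \<eta>' x y u \<in> fobj \<Psi>' (x, y)"
    "\<And>x y u. x \<in> Obj C' \<Longrightarrow> y \<in> Obj D' \<Longrightarrow> u \<in> fobj \<Psi> (x, y) \<Longrightarrow> \<theta>' x y (\<eta>' x y u) = u"
    "\<And>x y v. x \<in> Obj C' \<Longrightarrow> y \<in> Obj D' \<Longrightarrow> v \<in> fobj \<Psi>' (x, y) \<Longrightarrow> \<theta>' x y v \<in> fobj \<Psi> (x, y)"
    "\<And>x y v. x \<in> Obj C' \<Longrightarrow> y \<in> Obj D' \<Longrightarrow> v \<in> fobj \<Psi>' (x, y) \<Longrightarrow> \<eta>' x y (\<theta>' x y v) = v"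
    "\<And>\<alpha> \<beta> u. \<alpha> \<in> Arr C' \<Longrightarrow> \<beta> \<in> Arr D' \<Longrightarrow> u \<in> fobj \<Psi> (Dom C' \<alpha>, Cod D' \<beta>)
      \<Longrightarrow> \<eta>' (Cod C' \<alpha>) (Dom D' \<beta>) (fmor \<Psi> (\<alpha>, \<beta>) u) = fmor \<Psi>' (\<alpha>, \<beta>) (\<eta>' (Dom C' \<alpha>) (Cod D' \<beta>) u)"
    show ?thesis
      by (rule biset_isoI[of _ _ _ "\<lambda>(x, x') (y, y'). map_prod (\<eta> x y) (\<eta>' x' y')"
            _ "\<lambda>(x, x') (y, y'). map_prod (\<theta> x y) (\<theta>' x' y')"])
        (auto simp: *)
  qed
qed

lemma biset_prod_union_left:
  "biset_iso (prod_cat C C') (prod_cat D D') (biset_prod (biset_union \<Omega> \<Omega>') \<Psi>)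
     (biset_union (biset_prod \<Omega> \<Psi>) (biset_prod \<Omega>' \<Psi>))"
  by (rule biset_isoI[of _ _ _
        "\<lambda>_ _ (s, v). case s of Inl u \<Rightarrow> Inl (u, v) | Inr u \<Rightarrow> Inr (u, v)" _
        "\<lambda>_ _ s. case s of Inl (u, v) \<Rightarrow> (Inl u, v) | Inr (u, v) \<Rightarrow> (Inr u, v)"])
    auto

lemma biset_prod_union_right:
  "biset_iso (prod_cat C C') (prod_cat D D') (biset_prod \<Omega> (biset_union \<Psi> \<Psi>'))
     (biset_union (biset_prod \<Omega> \<Psi>) (biset_prod \<Omega> \<Psi>'))"
  by (rule biset_isoI[of _ _ _
        "\<lambda>_ _ (u, s). case s of Inl v \<Rightarrow> Inl (u, v) | Inr v \<Rightarrow> Inr (u, v)" _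
        "\<lambda>_ _ s. case s of Inl (u, v) \<Rightarrow> (u, Inl v) | Inr (u, v) \<Rightarrow> (u, Inr v)"])
    auto

lemma reindex_biset_union:
  "reindex j J (biset_union \<Omega> \<Psi>) = biset_union (reindex j J \<Omega>) (reindex j J \<Psi>)"
  by (simp add: reindex_def biset_union_def comp_def)

lemma biset_op_eq_reindex: "biset_op \<Omega> = reindex prod.swap prod.swap \<Omega>"
  by (simp add: reindex_def biset_op_def fun_eq_iff)

lemma is_functor_swap:
  "is_functor (prod_cat (op_cat D) (op_cat (op_cat C))) (prod_cat C (op_cat D)) prod.swap prod.swap"
  by (auto simp: is_functor_def)

lemma biset_reindex:
  assumes "biset C D \<Omega>" "category C'" "category D'"
    "is_functor (prod_cat C' (op_cat D')) (prod_cat C (op_cat D)) j J"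
  shows "biset C' D' (reindex j J \<Omega>)"
  using finset_functor_reindex[OF biset.as_functor[OF assms(1)] _ assms(4)] assms(2,3)
  by (simp add: biset_iff_is_biset[symmetric] is_biset_def category_prod_cat category_op_cat)

section \<open>Composition of bisets as a coend\<close>

text \<open>The class of \<open>(u, v)\<close> in the summand at \<open>y\<close>. It is formed for
  arbitrary triples, without membership conditions, which keeps equations between classes free of
  side conditions.\<close>

definition coend_cls where
  "coend_cls C D E \<Omega> \<Psi> x z y u v = comp_rel C D E \<Omega> \<Psi> x z `` {(y, u, v)}"

text \<open>The value on an equivalence class is computed from an arbitrary representative, so it is
  meaningful only if \<open>k\<close> is balanced.\<close>

definition coend_lift :: "('p \<Rightarrow> 'x \<Rightarrow> 'y \<Rightarrow> 'w) \<Rightarrow> ('p \<times> 'x \<times> 'y) set \<Rightarrow> 'w" where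
  "coend_lift k K = (case SOME t. t \<in> K of (y, u, v) \<Rightarrow> k y u v)"

locale composable = L: biset C D \<Omega> + R: biset D E \<Psi>
  for C :: "('o, 'a) cat" and D :: "('p, 'b) cat" and E :: "('q, 'c) cat"
    and \<Omega> :: "('o, 'a, 'p, 'b, 'x) biset" and \<Psi> :: "('p, 'b, 'q, 'c, 'y) biset" +
  assumes finite_Obj_D: "finite (Obj D)"
begin

abbreviation cl where "cl \<equiv> coend_cls C D E \<Omega> \<Psi>"
abbreviation P where "P \<equiv> biset_comp C D E \<Omega> \<Psi>"

text \<open>Compatibility with the generating relation, as for balanced maps out of a tensor
  product: exactly what a function on representatives must satisfy to descend to the coend.\<close>

definition balanced :: "'o \<Rightarrow> 'q \<Rightarrow> ('p \<Rightarrow> 'x \<Rightarrow> 'y \<Rightarrow> 'w) \<Rightarrow> bool" where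
  "balanced x z k \<longleftrightarrow> (\<forall>\<beta>\<in>Arr D. \<forall>u\<in>fobj \<Omega> (x, Cod D \<beta>). \<forall>v\<in>fobj \<Psi> (Dom D \<beta>, z).
     k (Dom D \<beta>) (fmor \<Omega> (Ident C x, \<beta>) u) v = k (Cod D \<beta>) u (fmor \<Psi> (\<beta>, Ident E z) v))"

lemma balancedI:
  assumes "\<And>\<beta> u v. \<beta> \<in> Arr D \<Longrightarrow> u \<in> fobj \<Omega> (x, Cod D \<beta>) \<Longrightarrow> v \<in> fobj \<Psi> (Dom D \<beta>, z)
    \<Longrightarrow> k (Dom D \<beta>) (fmor \<Omega> (Ident C x, \<beta>) u) v = k (Cod D \<beta>) u (fmor \<Psi> (\<beta>, Ident E z) v)"
  shows "balanced x z k"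
  using assms by (simp add: balanced_def)

text \<open>\<open>equivclp\<close> is reflexive on the whole type, so the relation is an
  equivalence on \<open>UNIV\<close> and not only on the carrier.\<close>

lemma equiv_comp_rel: "equiv UNIV (comp_rel C D E \<Omega> \<Psi> x z)"
  unfolding comp_rel_def
  by (rule equivI) (auto simp: refl_on_def sym_def trans_def intro: equivclp_sym equivclp_trans)

lemma cl_eq_iff:
  "cl x z y u v = cl x z y' u' v' \<longleftrightarrow> equivclp (comp_step C D E \<Omega> \<Psi> x z) (y, u, v) (y', u', v')"
  unfolding coend_cls_def using eq_equiv_class_iff[OF equiv_comp_rel, of "(y, u, v)" "(y', u', v')"]
  by (simp add: comp_rel_def)

lemma glue:
  assumes "\<beta> \<in> Arr D" "u \<in> fobj \<Omega> (x, Cod D \<beta>)" "v \<in> fobj \<Psi> (Dom D \<beta>, z)"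
  shows "cl x z (Dom D \<beta>) (fmor \<Omega> (Ident C x, \<beta>) u) v = cl x z (Cod D \<beta>) u (fmor \<Psi> (\<beta>, Ident E z) v)"
  unfolding cl_eq_iff using assms by (intro r_into_equivclp comp_step.intros)

lemma cl_in:
  assumes "y \<in> Obj D" "u \<in> fobj \<Omega> (x, y)" "v \<in> fobj \<Psi> (y, z)"
  shows "cl x z y u v \<in> fobj P (x, z)"
  using assms by (auto simp: biset_comp_def coend_cls_def comp_carrier_def intro!: quotientI)

lemma in_cl:
  assumes "K \<in> fobj P (x, z)"
  obtains y u v where "y \<in> Obj D" "u \<in> fobj \<Omega> (x, y)" "v \<in> fobj \<Psi> (y, z)" "K = cl x z y u v"
  using assms by (auto simp: biset_comp_def coend_cls_def comp_carrier_def elim!: quotientE)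

lemma balanced_equivclp:
  assumes "balanced x z k" "x \<in> Obj C" "z \<in> Obj E"
    and "equivclp (comp_step C D E \<Omega> \<Psi> x z) s t"
  shows "(case s of (y, u, v) \<Rightarrow> k y u v) = (case t of (y, u, v) \<Rightarrow> k y u v)"
  using assms(4)
proof (induction rule: equivclp_induct)
  case (step t t')
  then show ?case
    using assms(1) by (auto simp: balanced_def elim!: comp_step.cases)
qed simp

text \<open>The chosen representative is linked to \<open>(y, u, v)\<close> by a zigzag of
  generating steps, along which a balanced function is constant. Each step carries its own
  membership conditions, so \<open>y\<close>, \<open>u\<close>, \<open>v\<close> are
  unconstrained.\<close>

lemma lift_cl [simp]:
  assumes "balanced x z k" "x \<in> Obj C" "z \<in> Obj E"
  shows "coend_lift k (cl x z y u v) = k y u v"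
proof -
  have "(y, u, v) \<in> cl x z y u v"
    by (simp add: coend_cls_def comp_rel_def)
  then have "(SOME t. t \<in> cl x z y u v) \<in> cl x z y u v"
    by (rule someI)
  then have "equivclp (comp_step C D E \<Omega> \<Psi> x z) (y, u, v) (SOME t. t \<in> cl x z y u v)"
    by (simp add: coend_cls_def comp_rel_def)
  from balanced_equivclp[OF assms this] show ?thesis
    by (simp add: coend_lift_def)
qed

lemma fmor_cl:
  assumes \<alpha>: "\<alpha> \<in> Arr C" and \<gamma>: "\<gamma> \<in> Arr E" and y: "y \<in> Obj D"
    and u: "u \<in> fobj \<Omega> (Dom C \<alpha>, y)" and v: "v \<in> fobj \<Psi> (y, Cod E \<gamma>)"
  shows "fmor P (\<alpha>, \<gamma>) (cl (Dom C \<alpha>) (Cod E \<gamma>) y u v)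
    = cl (Cod C \<alpha>) (Dom E \<gamma>) y (fmor \<Omega> (\<alpha>, Ident D y) u) (fmor \<Psi> (Ident D y, \<gamma>) v)"
proof -
  \<comment> \<open>The class produced by acting on one representative. It is balanced: move
    \<open>\<beta>\<close> past \<open>\<alpha>\<close> on the left, glue, and move it past
    \<open>\<gamma>\<close> on the right.\<close>
  define k where "k y u v = cl (Cod C \<alpha>) (Dom E \<gamma>) y (fmor \<Omega> (\<alpha>, Ident D y) u) (fmor \<Psi> (Ident D y, \<gamma>) v)"
    for y u v
  have "balanced (Dom C \<alpha>) (Cod E \<gamma>) k"
  proof (rule balancedI)
    fix \<beta> u v assume \<beta>: "\<beta> \<in> Arr D" and u: "u \<in> fobj \<Omega> (Dom C \<alpha>, Cod D \<beta>)" and v: "v \<in> fobj \<Psi> (Dom D \<beta>, Cod E \<gamma>)"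
    have "k (Dom D \<beta>) (fmor \<Omega> (Ident C (Dom C \<alpha>), \<beta>) u) v
      = cl (Cod C \<alpha>) (Dom E \<gamma>) (Dom D \<beta>) (fmor \<Omega> (Ident C (Cod C \<alpha>), \<beta>) (fmor \<Omega> (\<alpha>, Ident D (Cod D \<beta>)) u))
          (fmor \<Psi> (Ident D (Dom D \<beta>), \<gamma>) v)"
      unfolding k_def using \<alpha> \<beta> u by (simp add: L.left_right L.right_left)
    also have "\<dots> = cl (Cod C \<alpha>) (Dom E \<gamma>) (Cod D \<beta>) (fmor \<Omega> (\<alpha>, Ident D (Cod D \<beta>)) u)
          (fmor \<Psi> (\<beta>, Ident E (Dom E \<gamma>)) (fmor \<Psi> (Ident D (Dom D \<beta>), \<gamma>) v))"
      using \<alpha> \<beta> \<gamma> u v by (intro glue L.left_closed R.right_closed) (auto simp: L.D.Dom_closed L.D.Cod_closed)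
    also have "\<dots> = k (Cod D \<beta>) u (fmor \<Psi> (\<beta>, Ident E (Cod E \<gamma>)) v)"
      unfolding k_def using \<beta> \<gamma> v by (simp add: R.left_right R.right_left)
    finally show "k (Dom D \<beta>) (fmor \<Omega> (Ident C (Dom C \<alpha>), \<beta>) u) v = k (Cod D \<beta>) u (fmor \<Psi> (\<beta>, Ident E (Cod E \<gamma>)) v)" .
  qed
  note resp = balanced_equivclp[OF this L.C.Dom_closed[OF \<alpha>] R.D.Cod_closed[OF \<gamma>]]
  have mem: "(y', u', v') \<in> cl x z y u v \<longleftrightarrow> equivclp (comp_step C D E \<Omega> \<Psi> x z) (y, u, v) (y', u', v')"
    for x z y u v y' u' v'
    by (simp add: coend_cls_def comp_rel_def)
  \<comment> \<open>Saturating the image of the class yields the union of the classes of its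
    elements; by balancedness all of these are one and the same class.\<close>
  have "fmor P (\<alpha>, \<gamma>) (cl (Dom C \<alpha>) (Cod E \<gamma>) y u v)
     = (\<Union>(y', u', v')\<in>cl (Dom C \<alpha>) (Cod E \<gamma>) y u v. k y' u' v')"
    unfolding biset_comp_def k_def coend_cls_def
    by (simp add: Image_eq_UN[of _ "_ ` _"]) (auto simp: split_beta)
  also have "\<dots> = k y u v"
  proof (intro equalityI subsetI)
    fix t assume "t \<in> (\<Union>(y', u', v')\<in>cl (Dom C \<alpha>) (Cod E \<gamma>) y u v. k y' u' v')"
    then obtain y' u' v' where "(y', u', v') \<in> cl (Dom C \<alpha>) (Cod E \<gamma>) y u v" "t \<in> k y' u' v'"
      by auto
    with resp[of "(y, u, v)" "(y', u', v')"] show "t \<in> k y u v" by (simp add: mem)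
  next
    fix t assume "t \<in> k y u v"
    moreover have "(y, u, v) \<in> cl (Dom C \<alpha>) (Cod E \<gamma>) y u v" by (simp add: mem)
    ultimately show "t \<in> (\<Union>(y', u', v')\<in>cl (Dom C \<alpha>) (Cod E \<gamma>) y u v. k y' u' v')" by blast
  qed
  finally show ?thesis by (simp add: k_def)
qed

lemma fmor_cl_left:
  assumes "\<alpha> \<in> Arr C" "z \<in> Obj E" "y \<in> Obj D" "u \<in> fobj \<Omega> (Dom C \<alpha>, y)" "v \<in> fobj \<Psi> (y, z)"
  shows "fmor P (\<alpha>, Ident E z) (cl (Dom C \<alpha>) z y u v) = cl (Cod C \<alpha>) z y (fmor \<Omega> (\<alpha>, Ident D y) u) v"
  using fmor_cl[of \<alpha> "Ident E z" y u v] assms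
  by (simp add: R.D.Ident_closed R.D.Cod_Ident R.D.Dom_Ident R.ident)

lemma fmor_cl_right:
  assumes "x \<in> Obj C" "\<gamma> \<in> Arr E" "y \<in> Obj D" "u \<in> fobj \<Omega> (x, y)" "v \<in> fobj \<Psi> (y, Cod E \<gamma>)"
  shows "fmor P (Ident C x, \<gamma>) (cl x (Cod E \<gamma>) y u v) = cl x (Dom E \<gamma>) y u (fmor \<Psi> (Ident D y, \<gamma>) v)"
  using fmor_cl[of "Ident C x" \<gamma> y u v] assms
  by (simp add: L.C.Ident_closed L.C.Cod_Ident L.C.Dom_Ident L.ident)

lemma biset_P: "biset C E P"
proof
  fix x z assume x: "x \<in> Obj C" and z: "z \<in> Obj E"
  \<comment> \<open>Finiteness: the quotient is covered by the disjoint union, over the finitely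
    many objects of \<open>D\<close>, of products of finite sets.\<close>
  have "fobj P (x, z) \<subseteq> (\<lambda>(y, u, v). cl x z y u v) ` (SIGMA y:Obj D. fobj \<Omega> (x, y) \<times> fobj \<Psi> (y, z))"
    by (auto elim!: in_cl)
  moreover have "finite (SIGMA y:Obj D. fobj \<Omega> (x, y) \<times> fobj \<Psi> (y, z))"
    using x z by (auto intro!: finite_SigmaI finite_Obj_D L.fin R.fin)
  ultimately show "finite (fobj P (x, z))"
    by (blast intro: finite_subset)
next
  fix \<alpha> \<gamma> K assume "\<alpha> \<in> Arr C" "\<gamma> \<in> Arr E" "K \<in> fobj P (Dom C \<alpha>, Cod E \<gamma>)"
  then show "fmor P (\<alpha>, \<gamma>) K \<in> fobj P (Cod C \<alpha>, Dom E \<gamma>)"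
    by (elim in_cl) (auto simp: fmor_cl intro!: cl_in L.left_closed R.right_closed)
next
  fix x z K assume "x \<in> Obj C" "z \<in> Obj E" "K \<in> fobj P (x, z)"
  then show "fmor P (Ident C x, Ident E z) K = K"
    using fmor_cl[of "Ident C x" "Ident E z"]
    by (elim in_cl) (auto simp: L.C.Ident_closed L.C.Cod_Ident L.C.Dom_Ident L.ident
        R.D.Ident_closed R.D.Cod_Ident R.D.Dom_Ident R.ident)
next
  fix \<alpha> \<alpha>' \<gamma> \<gamma>' K
  assume *: "\<alpha> \<in> Arr C" "\<alpha>' \<in> Arr C" "\<gamma> \<in> Arr E" "\<gamma>' \<in> Arr E" "Dom C \<alpha>' = Cod C \<alpha>" "Dom E \<gamma> = Cod E \<gamma>'"
    and K: "K \<in> fobj P (Dom C \<alpha>, Cod E \<gamma>)"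
  from K obtain y u v where y: "y \<in> Obj D" and u: "u \<in> fobj \<Omega> (Dom C \<alpha>, y)" and v: "v \<in> fobj \<Psi> (y, Cod E \<gamma>)"
    and K_eq: "K = cl (Dom C \<alpha>) (Cod E \<gamma>) y u v" by (elim in_cl)
  have "fmor P (\<alpha>', \<gamma>') (cl (Dom C \<alpha>') (Cod E \<gamma>') y (fmor \<Omega> (\<alpha>, Ident D y) u) (fmor \<Psi> (Ident D y, \<gamma>) v))
    = cl (Cod C \<alpha>') (Dom E \<gamma>') y (fmor \<Omega> (\<alpha>', Ident D y) (fmor \<Omega> (\<alpha>, Ident D y) u))
        (fmor \<Psi> (Ident D y, \<gamma>') (fmor \<Psi> (Ident D y, \<gamma>) v))"
    using * y u v L.left_closed[of \<alpha> y u] R.right_closed[of y \<gamma> v] by (intro fmor_cl) auto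
  then show "fmor P (\<alpha>', \<gamma>') (fmor P (\<alpha>, \<gamma>) K) = fmor P (Comp C \<alpha>' \<alpha>, Comp E \<gamma> \<gamma>') K"
    using * y u v L.comp[of \<alpha> \<alpha>' "Ident D y" "Ident D y" u] R.comp[of "Ident D y" "Ident D y" \<gamma> \<gamma>' v]
      L.D.Comp_Ident[of "Ident D y"] fmor_cl[of "Comp C \<alpha>' \<alpha>" "Comp E \<gamma> \<gamma>'" y u v]
    by (simp add: K_eq fmor_cl L.C.Dom_Comp L.C.Cod_Comp R.D.Dom_Comp R.D.Cod_Comp L.C.Comp_closed
        R.D.Comp_closed L.D.Ident_closed L.D.Dom_Ident L.D.Cod_Ident)
qed

text \<open>Since \<open>l\<close> is only tested on values of \<open>k\<close>, which is surjective, an isomorphism out of a composite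
  can be given on representatives in both directions.\<close>

lemma comp_isoI:
  assumes k_in: "\<And>x z y u v. x \<in> Obj C \<Longrightarrow> z \<in> Obj E \<Longrightarrow> y \<in> Obj D \<Longrightarrow> u \<in> fobj \<Omega> (x, y)
      \<Longrightarrow> v \<in> fobj \<Psi> (y, z) \<Longrightarrow> k x z y u v \<in> fobj \<Gamma> (x, z)"
    and k_resp: "\<And>x z \<beta> u v. x \<in> Obj C \<Longrightarrow> z \<in> Obj E \<Longrightarrow> \<beta> \<in> Arr D \<Longrightarrow> u \<in> fobj \<Omega> (x, Cod D \<beta>)
      \<Longrightarrow> v \<in> fobj \<Psi> (Dom D \<beta>, z) \<Longrightarrow> k x z (Dom D \<beta>) (fmor \<Omega> (Ident C x, \<beta>) u) v
        = k x z (Cod D \<beta>) u (fmor \<Psi> (\<beta>, Ident E z) v)"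
    and k_nat: "\<And>\<alpha> \<gamma> y u v. \<alpha> \<in> Arr C \<Longrightarrow> \<gamma> \<in> Arr E \<Longrightarrow> y \<in> Obj D \<Longrightarrow> u \<in> fobj \<Omega> (Dom C \<alpha>, y)
      \<Longrightarrow> v \<in> fobj \<Psi> (y, Cod E \<gamma>)
      \<Longrightarrow> k (Cod C \<alpha>) (Dom E \<gamma>) y (fmor \<Omega> (\<alpha>, Ident D y) u) (fmor \<Psi> (Ident D y, \<gamma>) v)
        = fmor \<Gamma> (\<alpha>, \<gamma>) (k (Dom C \<alpha>) (Cod E \<gamma>) y u v)"
    and l_k: "\<And>x z y u v. x \<in> Obj C \<Longrightarrow> z \<in> Obj E \<Longrightarrow> y \<in> Obj D \<Longrightarrow> u \<in> fobj \<Omega> (x, y)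
      \<Longrightarrow> v \<in> fobj \<Psi> (y, z) \<Longrightarrow> l x z (k x z y u v) = cl x z y u v"
    and k_surj: "\<And>x z w. x \<in> Obj C \<Longrightarrow> z \<in> Obj E \<Longrightarrow> w \<in> fobj \<Gamma> (x, z)
      \<Longrightarrow> \<exists>y\<in>Obj D. \<exists>u\<in>fobj \<Omega> (x, y). \<exists>v\<in>fobj \<Psi> (y, z). w = k x z y u v"
  shows "biset_iso C E P \<Gamma>"
proof -
  have k_resp': "balanced x z (k x z)" if "x \<in> Obj C" "z \<in> Obj E" for x z
    using that k_resp by (intro balancedI)
  show ?thesis
  proof (rule biset_isoI[of _ _ _ "\<lambda>x z. coend_lift (k x z)" _ l])
    fix x z K assume x: "x \<in> Obj C" and z: "z \<in> Obj E" and K: "K \<in> fobj P (x, z)"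
    from K obtain y u v where *: "y \<in> Obj D" "u \<in> fobj \<Omega> (x, y)" "v \<in> fobj \<Psi> (y, z)" "K = cl x z y u v"
      by (elim in_cl)
    with x z show "coend_lift (k x z) K \<in> fobj \<Gamma> (x, z)" "l x z (coend_lift (k x z) K) = K"
      by (auto simp: k_resp' k_in l_k)
  next
    fix x z w assume x: "x \<in> Obj C" and z: "z \<in> Obj E" and w: "w \<in> fobj \<Gamma> (x, z)"
    with k_surj obtain y u v where *: "y \<in> Obj D" "u \<in> fobj \<Omega> (x, y)" "v \<in> fobj \<Psi> (y, z)" "w = k x z y u v"
      by blast
    with x z show "l x z w \<in> fobj P (x, z)" "coend_lift (k x z) (l x z w) = w"
      by (auto simp: k_resp' l_k intro: cl_in)
  next
    fix \<alpha> \<gamma> K assume *: "\<alpha> \<in> Arr C" "\<gamma> \<in> Arr E" "K \<in> fobj P (Dom C \<alpha>, Cod E \<gamma>)"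
    then show "coend_lift (k (Cod C \<alpha>) (Dom E \<gamma>)) (fmor P (\<alpha>, \<gamma>) K)
      = fmor \<Gamma> (\<alpha>, \<gamma>) (coend_lift (k (Dom C \<alpha>) (Cod E \<gamma>)) K)"
      by (elim in_cl) (simp add: fmor_cl k_resp' k_nat L.C.Dom_closed L.C.Cod_closed
          R.D.Dom_closed R.D.Cod_closed)
  qed
qed

end

lemma composableI:
  "biset C D \<Omega> \<Longrightarrow> biset D E \<Psi> \<Longrightarrow> finite_category D \<Longrightarrow> composable C D E \<Omega> \<Psi>"
  by (simp add: composable_def composable_axioms_def finite_categoryD)

lemma biset_biset_comp:
  "biset C D \<Omega> \<Longrightarrow> biset D E \<Psi> \<Longrightarrow> finite_category D \<Longrightarrow> biset C E (biset_comp C D E \<Omega> \<Psi>)"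
  by (intro composable.biset_P composableI)

section \<open>Compatibility of the operations on bisets\<close>

text \<open>A pair of isomorphisms acts on representatives, and naturality of each with respect to
  \<open>D\<close> makes this action balanced; the inverses \<open>\<theta>\<close> and
  \<open>\<theta>'\<close> do the same in the other direction.\<close>

lemma biset_iso_comp:
  assumes "biset C D \<Omega>" "biset D E \<Psi>" "biset C D \<Omega>'" "biset D E \<Psi>'" "finite_category D"
    and \<Omega>: "biset_iso C D \<Omega> \<Omega>'" and \<Psi>: "biset_iso D E \<Psi> \<Psi>'"
  shows "biset_iso C E (biset_comp C D E \<Omega> \<Psi>) (biset_comp C D E \<Omega>' \<Psi>')"
proof -
  interpret A: composable C D E \<Omega> \<Psi> by (intro composableI assms)
  interpret B: composable C D E \<Omega>' \<Psi>' by (intro composableI assms)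
  show ?thesis
  proof (rule A.L.iso_inverseE[OF \<Omega>], rule A.R.iso_inverseE[OF \<Psi>])
    fix \<eta> \<theta> \<eta>' \<theta>'
    assume \<eta>: "\<And>x y u. x \<in> Obj C \<Longrightarrow> y \<in> Obj D \<Longrightarrow> u \<in> fobj \<Omega> (x, y) \<Longrightarrow> \<eta> x y u \<in> fobj \<Omega>' (x, y)"
    "\<And>x y u. x \<in> Obj C \<Longrightarrow> y \<in> Obj D \<Longrightarrow> u \<in> fobj \<Omega> (x, y) \<Longrightarrow> \<theta> x y (\<eta> x y u) = u"
    "\<And>x y v. x \<in> Obj C \<Longrightarrow> y \<in> Obj D \<Longrightarrow> v \<in> fobj \<Omega>' (x, y) \<Longrightarrow> \<theta> x y v \<in> fobj \<Omega> (x, y)"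
    "\<And>x y v. x \<in> Obj C \<Longrightarrow> y \<in> Obj D \<Longrightarrow> v \<in> fobj \<Omega>' (x, y) \<Longrightarrow> \<eta> x y (\<theta> x y v) = v"
    "\<And>\<alpha> \<beta> u. \<alpha> \<in> Arr C \<Longrightarrow> \<beta> \<in> Arr D \<Longrightarrow> u \<in> fobj \<Omega> (Dom C \<alpha>, Cod D \<beta>)
      \<Longrightarrow> \<eta> (Cod C \<alpha>) (Dom D \<beta>) (fmor \<Omega> (\<alpha>, \<beta>) u) = fmor \<Omega>' (\<alpha>, \<beta>) (\<eta> (Dom C \<alpha>) (Cod D \<beta>) u)"
    "\<And>\<alpha> \<beta> v. \<alpha> \<in> Arr C \<Longrightarrow> \<beta> \<in> Arr D \<Longrightarrow> v \<in> fobj \<Omega>' (Dom C \<alpha>, Cod D \<beta>)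
      \<Longrightarrow> \<theta> (Cod C \<alpha>) (Dom D \<beta>) (fmor \<Omega>' (\<alpha>, \<beta>) v) = fmor \<Omega> (\<alpha>, \<beta>) (\<theta> (Dom C \<alpha>) (Cod D \<beta>) v)"
    and \<eta>': "\<And>x y u. x \<in> Obj D \<Longrightarrow> y \<in> Obj E \<Longrightarrow> u \<in> fobj \<Psi> (x, y) \<Longrightarrow> \<eta>' x y u \<in> fobj \<Psi>' (x, y)"
    "\<And>x y u. x \<in> Obj D \<Longrightarrow> y \<in> Obj E \<Longrightarrow> u \<in> fobj \<Psi> (x, y) \<Longrightarrow> \<theta>' x y (\<eta>' x y u) = u"
    "\<And>x y v. x \<in> Obj D \<Longrightarrow> y \<in> Obj E \<Longrightarrow> v \<in> fobj \<Psi>' (x, y) \<Longrightarrow> \<theta>' x y v \<in> fobj \<Psi> (x, y)"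
    "\<And>x y v. x \<in> Obj D \<Longrightarrow> y \<in> Obj E \<Longrightarrow> v \<in> fobj \<Psi>' (x, y) \<Longrightarrow> \<eta>' x y (\<theta>' x y v) = v"
    "\<And>\<alpha> \<beta> u. \<alpha> \<in> Arr D \<Longrightarrow> \<beta> \<in> Arr E \<Longrightarrow> u \<in> fobj \<Psi> (Dom D \<alpha>, Cod E \<beta>)
      \<Longrightarrow> \<eta>' (Cod D \<alpha>) (Dom E \<beta>) (fmor \<Psi> (\<alpha>, \<beta>) u) = fmor \<Psi>' (\<alpha>, \<beta>) (\<eta>' (Dom D \<alpha>) (Cod E \<beta>) u)"
    "\<And>\<alpha> \<beta> v. \<alpha> \<in> Arr D \<Longrightarrow> \<beta> \<in> Arr E \<Longrightarrow> v \<in> fobj \<Psi>' (Dom D \<alpha>, Cod E \<beta>)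
      \<Longrightarrow> \<theta>' (Cod D \<alpha>) (Dom E \<beta>) (fmor \<Psi>' (\<alpha>, \<beta>) v) = fmor \<Psi> (\<alpha>, \<beta>) (\<theta>' (Dom D \<alpha>) (Cod E \<beta>) v)"
    note cat = A.L.C.Ident_closed A.L.C.Dom_Ident A.L.C.Cod_Ident A.L.D.Ident_closed A.L.D.Dom_Ident
      A.L.D.Cod_Ident A.R.D.Ident_closed A.R.D.Dom_Ident A.R.D.Cod_Ident
      A.L.C.Dom_closed A.L.C.Cod_closed A.L.D.Dom_closed A.L.D.Cod_closed A.R.D.Dom_closed A.R.D.Cod_closed
    have \<eta>_right: "\<eta> x (Dom D \<beta>) (fmor \<Omega> (Ident C x, \<beta>) u) = fmor \<Omega>' (Ident C x, \<beta>) (\<eta> x (Cod D \<beta>) u)"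
      if "x \<in> Obj C" "\<beta> \<in> Arr D" "u \<in> fobj \<Omega> (x, Cod D \<beta>)" for x \<beta> u
      using \<eta>(5)[of "Ident C x" \<beta> u] that by (simp add: cat)
    have \<theta>_right: "\<theta> x (Dom D \<beta>) (fmor \<Omega>' (Ident C x, \<beta>) u) = fmor \<Omega> (Ident C x, \<beta>) (\<theta> x (Cod D \<beta>) u)"
      if "x \<in> Obj C" "\<beta> \<in> Arr D" "u \<in> fobj \<Omega>' (x, Cod D \<beta>)" for x \<beta> u
      using \<eta>(6)[of "Ident C x" \<beta> u] that by (simp add: cat)
    have \<eta>_left: "\<eta> (Cod C \<alpha>) y (fmor \<Omega> (\<alpha>, Ident D y) u) = fmor \<Omega>' (\<alpha>, Ident D y) (\<eta> (Dom C \<alpha>) y u)"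
      if "\<alpha> \<in> Arr C" "y \<in> Obj D" "u \<in> fobj \<Omega> (Dom C \<alpha>, y)" for \<alpha> y u
      using \<eta>(5)[of \<alpha> "Ident D y" u] that by (simp add: cat)
    have \<eta>'_right: "\<eta>' y (Dom E \<gamma>) (fmor \<Psi> (Ident D y, \<gamma>) v) = fmor \<Psi>' (Ident D y, \<gamma>) (\<eta>' y (Cod E \<gamma>) v)"
      if "y \<in> Obj D" "\<gamma> \<in> Arr E" "v \<in> fobj \<Psi> (y, Cod E \<gamma>)" for y \<gamma> v
      using \<eta>'(5)[of "Ident D y" \<gamma> v] that by (simp add: cat)
    have \<eta>'_left: "\<eta>' (Cod D \<beta>) z (fmor \<Psi> (\<beta>, Ident E z) v) = fmor \<Psi>' (\<beta>, Ident E z) (\<eta>' (Dom D \<beta>) z v)"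
      if "\<beta> \<in> Arr D" "z \<in> Obj E" "v \<in> fobj \<Psi> (Dom D \<beta>, z)" for \<beta> z v
      using \<eta>'(5)[of \<beta> "Ident E z" v] that by (simp add: cat)
    have \<theta>'_left: "\<theta>' (Cod D \<beta>) z (fmor \<Psi>' (\<beta>, Ident E z) v) = fmor \<Psi> (\<beta>, Ident E z) (\<theta>' (Dom D \<beta>) z v)"
      if "\<beta> \<in> Arr D" "z \<in> Obj E" "v \<in> fobj \<Psi>' (Dom D \<beta>, z)" for \<beta> z v
      using \<eta>'(6)[of \<beta> "Ident E z" v] that by (simp add: cat)
    \<comment> \<open>The inverse is specified on classes of the target, so it has to be descended
      explicitly before it can be evaluated on representatives.\<close>
    define l where "l x z = coend_lift (\<lambda>y u v. A.cl x z y (\<theta> x y u) (\<theta>' y z v))" for x z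
    have l: "l x z (B.cl x z y u v) = A.cl x z y (\<theta> x y u) (\<theta>' y z v)"
      if "x \<in> Obj C" "z \<in> Obj E" for x z y u v
      unfolding l_def
      by (rule B.lift_cl[OF B.balancedI that])
        (simp add: that cat \<theta>_right \<theta>'_left \<eta>(3) \<eta>'(3) A.glue)
    show ?thesis
    proof (rule A.comp_isoI[of "\<lambda>x z y u v. B.cl x z y (\<eta> x y u) (\<eta>' y z v)" _ l])
      fix x z \<beta> u v assume *: "x \<in> Obj C" "z \<in> Obj E" "\<beta> \<in> Arr D" "u \<in> fobj \<Omega> (x, Cod D \<beta>)"
        "v \<in> fobj \<Psi> (Dom D \<beta>, z)"
      then show "B.cl x z (Dom D \<beta>) (\<eta> x (Dom D \<beta>) (fmor \<Omega> (Ident C x, \<beta>) u)) (\<eta>' (Dom D \<beta>) z v) =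
         B.cl x z (Cod D \<beta>) (\<eta> x (Cod D \<beta>) u) (\<eta>' (Cod D \<beta>) z (fmor \<Psi> (\<beta>, Ident E z) v))"
        by (simp add: cat \<eta>_right \<eta>'_left \<eta>(1) \<eta>'(1) B.glue)
    next
      fix \<alpha> \<gamma> y u v assume *: "\<alpha> \<in> Arr C" "\<gamma> \<in> Arr E" "y \<in> Obj D" "u \<in> fobj \<Omega> (Dom C \<alpha>, y)"
        "v \<in> fobj \<Psi> (y, Cod E \<gamma>)"
      then show "B.cl (Cod C \<alpha>) (Dom E \<gamma>) y (\<eta> (Cod C \<alpha>) y (fmor \<Omega> (\<alpha>, Ident D y) u))
          (\<eta>' y (Dom E \<gamma>) (fmor \<Psi> (Ident D y, \<gamma>) v))
        = fmor B.P (\<alpha>, \<gamma>) (B.cl (Dom C \<alpha>) (Cod E \<gamma>) y (\<eta> (Dom C \<alpha>) y u) (\<eta>' y (Cod E \<gamma>) v))"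
        by (simp add: cat \<eta>_left \<eta>'_right \<eta>(1) \<eta>'(1) B.fmor_cl)
    next
      fix x z w assume *: "x \<in> Obj C" "z \<in> Obj E" "w \<in> fobj B.P (x, z)"
      then obtain y u v where "y \<in> Obj D" "u \<in> fobj \<Omega>' (x, y)" "v \<in> fobj \<Psi>' (y, z)" "w = B.cl x z y u v"
        by (elim B.in_cl)
      with * show "\<exists>y\<in>Obj D. \<exists>u\<in>fobj \<Omega> (x, y). \<exists>v\<in>fobj \<Psi> (y, z). w = B.cl x z y (\<eta> x y u) (\<eta>' y z v)"
        by (intro bexI[of _ y] bexI[of _ "\<theta> x y u"] bexI[of _ "\<theta>' y z v"]) (auto simp: \<eta> \<eta>')
    qed (auto simp: l \<eta> \<eta>' intro: B.cl_in)
  qed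
qed

text \<open>Generating steps never leave their summand of the union, so the coend splits along
  it.\<close>

lemma biset_comp_union_left:
  assumes "biset C D \<Omega>" "biset C D \<Omega>'" "biset D E \<Psi>" "finite_category D"
  shows "biset_iso C E (biset_comp C D E (biset_union \<Omega> \<Omega>') \<Psi>)
    (biset_union (biset_comp C D E \<Omega> \<Psi>) (biset_comp C D E \<Omega>' \<Psi>))"
proof -
  interpret A: composable C D E "biset_union \<Omega> \<Omega>'" \<Psi> by (intro composableI biset_biset_union assms)
  interpret B: composable C D E \<Omega> \<Psi> by (intro composableI assms)
  interpret B': composable C D E \<Omega>' \<Psi> by (intro composableI assms)
  have l: "coend_lift (\<lambda>y u v. A.cl x z y (Inl u) v) (B.cl x z y u v) = A.cl x z y (Inl u) v"
    if "x \<in> Obj C" "z \<in> Obj E" for x z y u v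
  proof (rule B.lift_cl[OF B.balancedI that])
    fix \<beta> u v assume "\<beta> \<in> Arr D" "u \<in> fobj \<Omega> (x, Cod D \<beta>)" "v \<in> fobj \<Psi> (Dom D \<beta>, z)"
    then show "A.cl x z (Dom D \<beta>) (Inl (fmor \<Omega> (Ident C x, \<beta>) u)) v = A.cl x z (Cod D \<beta>) (Inl u) (fmor \<Psi> (\<beta>, Ident E z) v)"
      using A.glue[of \<beta> "Inl u" x v z] by (simp add: InlI InrI)
  qed
  have l': "coend_lift (\<lambda>y u v. A.cl x z y (Inr u) v) (B'.cl x z y u v) = A.cl x z y (Inr u) v"
    if "x \<in> Obj C" "z \<in> Obj E" for x z y u v
  proof (rule B'.lift_cl[OF B'.balancedI that])
    fix \<beta> u v assume "\<beta> \<in> Arr D" "u \<in> fobj \<Omega>' (x, Cod D \<beta>)" "v \<in> fobj \<Psi> (Dom D \<beta>, z)"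
    then show "A.cl x z (Dom D \<beta>) (Inr (fmor \<Omega>' (Ident C x, \<beta>) u)) v = A.cl x z (Cod D \<beta>) (Inr u) (fmor \<Psi> (\<beta>, Ident E z) v)"
      using A.glue[of \<beta> "Inr u" x v z] by (simp add: InlI InrI)
  qed
  show ?thesis
  proof (rule A.comp_isoI[of "\<lambda>x z y s v. case s of Inl u \<Rightarrow> Inl (B.cl x z y u v) | Inr u \<Rightarrow> Inr (B'.cl x z y u v)" _
        "\<lambda>x z K. case K of Inl K \<Rightarrow> coend_lift (\<lambda>y u v. A.cl x z y (Inl u) v) K
          | Inr K \<Rightarrow> coend_lift (\<lambda>y u v. A.cl x z y (Inr u) v) K"])
    fix x z w assume "w \<in> fobj (biset_union B.P B'.P) (x, z)"
    then show "\<exists>y\<in>Obj D. \<exists>u\<in>fobj (biset_union \<Omega> \<Omega>') (x, y). \<exists>v\<in>fobj \<Psi> (y, z).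
       w = (case u of Inl u \<Rightarrow> Inl (B.cl x z y u v) | Inr u \<Rightarrow> Inr (B'.cl x z y u v))"
      by (force elim: B.in_cl B'.in_cl)
  qed (auto simp: l l' B.fmor_cl B'.fmor_cl B.glue B'.glue intro: B.cl_in B'.cl_in)
qed

lemma biset_comp_union_right:
  assumes "biset C D \<Omega>" "biset D E \<Psi>" "biset D E \<Psi>'" "finite_category D"
  shows "biset_iso C E (biset_comp C D E \<Omega> (biset_union \<Psi> \<Psi>'))
    (biset_union (biset_comp C D E \<Omega> \<Psi>) (biset_comp C D E \<Omega> \<Psi>'))"
proof -
  interpret A: composable C D E \<Omega> "biset_union \<Psi> \<Psi>'" by (intro composableI biset_biset_union assms)
  interpret B: composable C D E \<Omega> \<Psi> by (intro composableI assms)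
  interpret B': composable C D E \<Omega> \<Psi>' by (intro composableI assms)
  have l: "coend_lift (\<lambda>y u v. A.cl x z y u (Inl v)) (B.cl x z y u v) = A.cl x z y u (Inl v)"
    if "x \<in> Obj C" "z \<in> Obj E" for x z y u v
  proof (rule B.lift_cl[OF B.balancedI that])
    fix \<beta> u v assume "\<beta> \<in> Arr D" "u \<in> fobj \<Omega> (x, Cod D \<beta>)" "v \<in> fobj \<Psi> (Dom D \<beta>, z)"
    then show "A.cl x z (Dom D \<beta>) (fmor \<Omega> (Ident C x, \<beta>) u) (Inl v) = A.cl x z (Cod D \<beta>) u (Inl (fmor \<Psi> (\<beta>, Ident E z) v))"
      using A.glue[of \<beta> u x "Inl v" z] by (simp add: InlI InrI)
  qed
  have l': "coend_lift (\<lambda>y u v. A.cl x z y u (Inr v)) (B'.cl x z y u v) = A.cl x z y u (Inr v)"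
    if "x \<in> Obj C" "z \<in> Obj E" for x z y u v
  proof (rule B'.lift_cl[OF B'.balancedI that])
    fix \<beta> u v assume "\<beta> \<in> Arr D" "u \<in> fobj \<Omega> (x, Cod D \<beta>)" "v \<in> fobj \<Psi>' (Dom D \<beta>, z)"
    then show "A.cl x z (Dom D \<beta>) (fmor \<Omega> (Ident C x, \<beta>) u) (Inr v) = A.cl x z (Cod D \<beta>) u (Inr (fmor \<Psi>' (\<beta>, Ident E z) v))"
      using A.glue[of \<beta> u x "Inr v" z] by (simp add: InlI InrI)
  qed
  show ?thesis
  proof (rule A.comp_isoI[of "\<lambda>x z y u s. case s of Inl v \<Rightarrow> Inl (B.cl x z y u v) | Inr v \<Rightarrow> Inr (B'.cl x z y u v)" _
        "\<lambda>x z K. case K of Inl K \<Rightarrow> coend_lift (\<lambda>y u v. A.cl x z y u (Inl v)) K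
          | Inr K \<Rightarrow> coend_lift (\<lambda>y u v. A.cl x z y u (Inr v)) K"])
    fix x z w assume "w \<in> fobj (biset_union B.P B'.P) (x, z)"
    then show "\<exists>y\<in>Obj D. \<exists>u\<in>fobj \<Omega> (x, y). \<exists>v\<in>fobj (biset_union \<Psi> \<Psi>') (y, z).
       w = (case v of Inl v \<Rightarrow> Inl (B.cl x z y u v) | Inr v \<Rightarrow> Inr (B'.cl x z y u v))"
      by (force elim: B.in_cl B'.in_cl)
  qed (auto simp: l l' B.fmor_cl B'.fmor_cl B.glue B'.glue intro: B.cl_in B'.cl_in)
qed

text \<open>The interchange law for composition and products. The inverse takes a pair of
  independently formed classes, so it is descended in two stages: \<open>l'\<close> with the first
  representative fixed, then \<open>l\<close> in the first class. Each stage glues along an arrow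
  paired with an identity in the other factor.\<close>

lemma biset_comp_prod:
  assumes "biset C D \<Omega>" "biset D E \<Psi>" "biset C' D' \<Omega>'" "biset D' E' \<Psi>'"
    "finite_category D" "finite_category D'"
  shows "biset_iso (prod_cat C C') (prod_cat E E')
    (biset_comp (prod_cat C C') (prod_cat D D') (prod_cat E E') (biset_prod \<Omega> \<Omega>') (biset_prod \<Psi> \<Psi>'))
    (biset_prod (biset_comp C D E \<Omega> \<Psi>) (biset_comp C' D' E' \<Omega>' \<Psi>'))"
proof -
  interpret A: composable "prod_cat C C'" "prod_cat D D'" "prod_cat E E'" "biset_prod \<Omega> \<Omega>'" "biset_prod \<Psi> \<Psi>'"
    by (intro composableI biset_biset_prod finite_category_prod_cat assms)
  interpret B: composable C D E \<Omega> \<Psi> by (intro composableI assms)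
  interpret B': composable C' D' E' \<Omega>' \<Psi>' by (intro composableI assms)
  define l' where "l' x x' z z' y u v = coend_lift (\<lambda>y' u' v'. A.cl (x, x') (z, z') (y, y') (u, u') (v, v'))"
    for x x' z z' y u v
  define l where "l x x' z z' K L = coend_lift (\<lambda>y u v. l' x x' z z' y u v L) K" for x x' z z' K L
  note cat = B.L.C.Ident_closed B.L.C.Dom_Ident B.L.C.Cod_Ident B.L.D.Ident_closed B.L.D.Dom_Ident
      B.L.D.Cod_Ident B.R.D.Ident_closed B.R.D.Dom_Ident B.R.D.Cod_Ident
      B.L.D.Dom_closed B.L.D.Cod_closed B'.L.C.Ident_closed B'.L.C.Dom_Ident B'.L.C.Cod_Ident
      B'.L.D.Ident_closed B'.L.D.Dom_Ident B'.L.D.Cod_Ident B'.R.D.Ident_closed B'.R.D.Dom_Ident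
      B'.R.D.Cod_Ident B'.L.D.Dom_closed B'.L.D.Cod_closed
  have l': "l' x x' z z' y u v (B'.cl x' z' y' u' v') = A.cl (x, x') (z, z') (y, y') (u, u') (v, v')"
    if "x \<in> Obj C" "x' \<in> Obj C'" "z \<in> Obj E" "z' \<in> Obj E'" "y \<in> Obj D" "u \<in> fobj \<Omega> (x, y)" "v \<in> fobj \<Psi> (y, z)"
    for x x' z z' y u v y' u' v'
    unfolding l'_def
  proof (rule B'.lift_cl)
    show "B'.balanced x' z' (\<lambda>y' u' v'. A.cl (x, x') (z, z') (y, y') (u, u') (v, v'))"
    proof (rule B'.balancedI)
      fix \<beta> u' v' assume "\<beta> \<in> Arr D'" "u' \<in> fobj \<Omega>' (x', Cod D' \<beta>)" "v' \<in> fobj \<Psi>' (Dom D' \<beta>, z')"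
      then show "A.cl (x, x') (z, z') (y, Dom D' \<beta>) (u, fmor \<Omega>' (Ident C' x', \<beta>) u') (v, v')
        = A.cl (x, x') (z, z') (y, Cod D' \<beta>) (u, u') (v, fmor \<Psi>' (\<beta>, Ident E' z') v')"
        using that A.glue[of "(Ident D y, \<beta>)" "(u, u')" "(x, x')" "(v, v')" "(z, z')"]
        by (simp add: cat B.L.ident B.R.ident)
    qed
  qed (use that in auto)
  have l: "l x x' z z' (B.cl x z y u v) (B'.cl x' z' y' u' v') = A.cl (x, x') (z, z') (y, y') (u, u') (v, v')"
    if "x \<in> Obj C" "x' \<in> Obj C'" "z \<in> Obj E" "z' \<in> Obj E'" "y \<in> Obj D" "u \<in> fobj \<Omega> (x, y)" "v \<in> fobj \<Psi> (y, z)"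
      "y' \<in> Obj D'" "u' \<in> fobj \<Omega>' (x', y')" "v' \<in> fobj \<Psi>' (y', z')"
    for x x' z z' y u v y' u' v'
  proof -
    have "l x x' z z' (B.cl x z y u v) (B'.cl x' z' y' u' v') = l' x x' z z' y u v (B'.cl x' z' y' u' v')"
      unfolding l_def
    proof (rule B.lift_cl)
      show "B.balanced x z (\<lambda>y u v. l' x x' z z' y u v (B'.cl x' z' y' u' v'))"
      proof (rule B.balancedI)
        fix \<beta> u v assume "\<beta> \<in> Arr D" "u \<in> fobj \<Omega> (x, Cod D \<beta>)" "v \<in> fobj \<Psi> (Dom D \<beta>, z)"
        then show "l' x x' z z' (Dom D \<beta>) (fmor \<Omega> (Ident C x, \<beta>) u) v (B'.cl x' z' y' u' v')
          = l' x x' z z' (Cod D \<beta>) u (fmor \<Psi> (\<beta>, Ident E z) v) (B'.cl x' z' y' u' v')"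
          using that A.glue[of "(\<beta>, Ident D' y')" "(u, u')" "(x, x')" "(v, v')" "(z, z')"]
          by (simp add: cat B'.L.ident B'.R.ident l' B.L.right_closed B.R.left_closed)
      qed
    qed (use that in auto)
    with that show ?thesis by (simp add: l')
  qed
  show ?thesis
  proof (rule A.comp_isoI[of "\<lambda>(x, x') (z, z') (y, y') (u, u') (v, v'). (B.cl x z y u v, B'.cl x' z' y' u' v')" _
        "\<lambda>(x, x') (z, z') (K, L). l x x' z z' K L"])
    fix x z w assume "w \<in> fobj (biset_prod B.P B'.P) (x, z)"
    then obtain K L where w: "w = (K, L)" "K \<in> fobj B.P (fst x, fst z)" "L \<in> fobj B'.P (snd x, snd z)"
      by (cases x; cases z) auto
    from w(2) obtain y u v where 1: "y \<in> Obj D" "u \<in> fobj \<Omega> (fst x, y)" "v \<in> fobj \<Psi> (y, fst z)"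
        "K = B.cl (fst x) (fst z) y u v" by (elim B.in_cl)
    from w(3) obtain y' u' v' where 2: "y' \<in> Obj D'" "u' \<in> fobj \<Omega>' (snd x, y')" "v' \<in> fobj \<Psi>' (y', snd z)"
        "L = B'.cl (snd x) (snd z) y' u' v'" by (elim B'.in_cl)
    show "\<exists>y\<in>Obj (prod_cat D D'). \<exists>u\<in>fobj (biset_prod \<Omega> \<Omega>') (x, y). \<exists>v\<in>fobj (biset_prod \<Psi> \<Psi>') (y, z).
       w = (case x of (x, x') \<Rightarrow> \<lambda>(z, z') (y, y') (u, u') (v, v'). (B.cl x z y u v, B'.cl x' z' y' u' v')) z y u v"
      using 1 2 w(1)
      by (cases x; cases z; intro bexI[of _ "(y, y')"] bexI[of _ "(u, u')"] bexI[of _ "(v, v')"]) auto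
  qed (auto simp: l B.fmor_cl B'.fmor_cl B.glue B'.glue intro: B.cl_in B'.cl_in)
qed

text \<open>Exchanging the two entries of a representative reverses each generating step, and the
  generated equivalence is symmetric.\<close>

lemma biset_comp_op:
  assumes "biset C D \<Omega>" "biset D E \<Psi>" "finite_category D"
  shows "biset_iso (op_cat E) (op_cat C)
    (biset_comp (op_cat E) (op_cat D) (op_cat C) (biset_op \<Psi>) (biset_op \<Omega>))
    (biset_op (biset_comp C D E \<Omega> \<Psi>))"
proof -
  interpret B: composable C D E \<Omega> \<Psi> by (intro composableI assms)
  interpret A: composable "op_cat E" "op_cat D" "op_cat C" "biset_op \<Psi>" "biset_op \<Omega>"
    unfolding biset_op_eq_reindex
    by (intro composableI biset_reindex[OF assms(1)] biset_reindex[OF assms(2)] is_functor_swap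
        finite_category_op_cat category_op_cat assms B.L.C.category_axioms B.L.D.category_axioms B.R.D.category_axioms)
  have l: "coend_lift (\<lambda>y u v. A.cl z x y v u) (B.cl x z y u v) = A.cl z x y v u"
    if "x \<in> Obj C" "z \<in> Obj E" for x z y u v
  proof (rule B.lift_cl[OF B.balancedI that])
    fix \<beta> u v assume "\<beta> \<in> Arr D" "u \<in> fobj \<Omega> (x, Cod D \<beta>)" "v \<in> fobj \<Psi> (Dom D \<beta>, z)"
    then show "A.cl z x (Dom D \<beta>) v (fmor \<Omega> (Ident C x, \<beta>) u) = A.cl z x (Cod D \<beta>) (fmor \<Psi> (\<beta>, Ident E z) v) u"
      using A.glue[of \<beta> v z u x] by simp
  qed
  show ?thesis
    by (rule A.comp_isoI[of "\<lambda>z x y v u. B.cl x z y u v" _ "\<lambda>z x. coend_lift (\<lambda>y u v. A.cl z x y v u)"])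
      (auto simp: l B.fmor_cl B.glue intro: B.cl_in elim!: B.in_cl)
qed

lemma biset_op_id:
  assumes "category C"
  shows "biset_iso (op_cat C) (op_cat C) (biset_op (biset_id C)) (biset_id (op_cat C))"
proof -
  interpret C: category C by fact
  show ?thesis
    by (rule biset_isoI[of _ _ _ "\<lambda>_ _ f. f" _ "\<lambda>_ _ f. f"])
      (auto simp: C.Comp_closed C.Dom_Comp C.Cod_Comp C.Comp_assoc)
qed

lemma biset_prod_id:
  "biset_iso (prod_cat C D) (prod_cat C D) (biset_prod (biset_id C) (biset_id D)) (biset_id (prod_cat C D))"
  by (rule biset_isoI[of _ _ _ "\<lambda>_ _ f. f" _ "\<lambda>_ _ f. f"]) auto

section \<open>Representable bisets\<close>

text \<open>Inverse functors: \<open>(j, J)\<close> goes from \<open>B\<close> to \<open>A\<close>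
  and \<open>(k, K)\<close> goes back. Object and arrow maps are kept separate so that they can be
  passed to \<open>reindex\<close> directly.\<close>

locale cat_iso = A: category A + B: category B
  for A :: "('o, 'a) cat" and B :: "('p, 'b) cat" +
  fixes j :: "'p \<Rightarrow> 'o" and J :: "'b \<Rightarrow> 'a" and k :: "'o \<Rightarrow> 'p" and K :: "'a \<Rightarrow> 'b"
  assumes J: "is_functor B A j J" and K: "is_functor A B k K"
    and jk: "a \<in> Obj A \<Longrightarrow> j (k a) = a" and kj: "b \<in> Obj B \<Longrightarrow> k (j b) = b"
    and JK: "f \<in> Arr A \<Longrightarrow> J (K f) = f" and KJ: "g \<in> Arr B \<Longrightarrow> K (J g) = g"
begin

lemma J_simps:
  "b \<in> Obj B \<Longrightarrow> j b \<in> Obj A" "b \<in> Obj B \<Longrightarrow> J (Ident B b) = Ident A (j b)"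
  "g \<in> Arr B \<Longrightarrow> J g \<in> Arr A" "g \<in> Arr B \<Longrightarrow> Dom A (J g) = j (Dom B g)"
  "g \<in> Arr B \<Longrightarrow> Cod A (J g) = j (Cod B g)"
  "g \<in> Arr B \<Longrightarrow> h \<in> Arr B \<Longrightarrow> Dom B h = Cod B g \<Longrightarrow> J (Comp B h g) = Comp A (J h) (J g)"
  using J by (auto simp: is_functor_def)

lemma K_simps:
  "a \<in> Obj A \<Longrightarrow> k a \<in> Obj B" "a \<in> Obj A \<Longrightarrow> K (Ident A a) = Ident B (k a)"
  "f \<in> Arr A \<Longrightarrow> K f \<in> Arr B" "f \<in> Arr A \<Longrightarrow> Dom B (K f) = k (Dom A f)"
  "f \<in> Arr A \<Longrightarrow> Cod B (K f) = k (Cod A f)"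
  "f \<in> Arr A \<Longrightarrow> h \<in> Arr A \<Longrightarrow> Dom A h = Cod A f \<Longrightarrow> K (Comp A h f) = Comp B (K h) (K f)"
  using K by (auto simp: is_functor_def)

lemmas cat_simps = J_simps K_simps jk kj JK KJ A.Dom_closed A.Cod_closed A.Ident_closed A.Dom_Ident
  A.Cod_Ident A.Comp_closed A.Dom_Comp A.Cod_Comp B.Dom_closed B.Cod_closed B.Ident_closed B.Dom_Ident
  B.Cod_Ident B.Comp_closed B.Dom_Comp B.Cod_Comp

text \<open>The \<open>(A, B)\<close>-biset represented by the functor \<open>j : B \<rightarrow> A\<close>.\<close>

definition rep :: "('o, 'a, 'p, 'b, 'a) biset" where
  "rep = reindex (map_prod id j) (map_prod id J) (biset_id A)"

lemma rep_simps [simp]: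
  "fobj rep (a, b) = {f \<in> Arr A. Dom A f = j b \<and> Cod A f = a}"
  "fmor rep (\<alpha>, \<beta>) f = Comp A \<alpha> (Comp A f (J \<beta>))"
  by (simp_all add: rep_def)

lemma biset_rep:
  assumes "finite_category A"
  shows "biset A B rep"
  unfolding rep_def
  by (rule biset_reindex[OF biset_biset_id[OF assms] A.category_axioms B.category_axioms])
    (auto simp: is_functor_def cat_simps)

lemma Comp_IdentA:
  "f \<in> Arr A \<Longrightarrow> a = Dom A f \<Longrightarrow> Comp A f (Ident A a) = f"
  "f \<in> Arr A \<Longrightarrow> a = Cod A f \<Longrightarrow> Comp A (Ident A a) f = f"
  by (simp_all add: A.Comp_Ident A.Ident_Comp)

text \<open>Co-Yoneda: an element \<open>f : j b \<rightarrow> a\<close> of the representable gives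
  \<open>K f : b \<rightarrow> k a\<close>, which can be moved onto the factor from \<Omega>. This
  is why the inverse functor appears in the reindexing.\<close>

lemma comp_rep:
  assumes "finite_category A" "finite_category B" "biset B Z \<Omega>"
  shows "biset_iso A Z (biset_comp A B Z rep \<Omega>) (reindex (map_prod k id) (map_prod K id) \<Omega>)"
proof -
  interpret P: composable A B Z rep \<Omega> by (intro composableI biset_rep assms)
  note simps = cat_simps Comp_IdentA P.R.D.Ident_closed P.R.D.Cod_Ident P.R.D.Dom_Ident
    P.R.D.Dom_closed P.R.D.Cod_closed
  \<comment> \<open>Glue along \<open>K f\<close> starting from the identity of \<open>a\<close>:
    acting by \<open>K f\<close> on it on the right gives \<open>J (K f) = f\<close>. Every class
    thus has a representative with an identity in the first entry.\<close>
  have eq: "P.cl a z (k a) (Ident A a) (fmor \<Omega> (K f, Ident Z z) w) = P.cl a z b f w"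
    if "a \<in> Obj A" "z \<in> Obj Z" "b \<in> Obj B" "f \<in> fobj rep (a, b)" "w \<in> fobj \<Omega> (b, z)" for a z b f w
    using P.glue[of "K f" "Ident A a" a w z] that by (auto simp: simps)
  show ?thesis
  proof (rule P.comp_isoI[of "\<lambda>a z b f w. fmor \<Omega> (K f, Ident Z z) w" _ "\<lambda>a z w. P.cl a z (k a) (Ident A a) w"])
    fix a z b f w assume *: "a \<in> Obj A" "z \<in> Obj Z" "b \<in> Obj B" "f \<in> fobj rep (a, b)" "w \<in> fobj \<Omega> (b, z)"
    then show "fmor \<Omega> (K f, Ident Z z) w \<in> fobj (reindex (map_prod k id) (map_prod K id) \<Omega>) (a, z)"
      using P.R.left_closed[of "K f" z w] by (auto simp: simps)
    show "P.cl a z (k a) (Ident A a) (fmor \<Omega> (K f, Ident Z z) w) = P.cl a z b f w"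
      using * by (rule eq)
  next
    fix a z \<beta> f w assume "a \<in> Obj A" "z \<in> Obj Z" "\<beta> \<in> Arr B" "f \<in> fobj rep (a, Cod B \<beta>)"
      "w \<in> fobj \<Omega> (Dom B \<beta>, z)"
    then show "fmor \<Omega> (K (fmor rep (Ident A a, \<beta>) f), Ident Z z) w
      = fmor \<Omega> (K f, Ident Z z) (fmor \<Omega> (\<beta>, Ident Z z) w)"
      using P.R.D.Comp_Ident[of "Ident Z z"] by (auto simp: simps P.R.comp)
  next
    fix \<alpha> \<gamma> b f w assume *: "\<alpha> \<in> Arr A" "\<gamma> \<in> Arr Z" "b \<in> Obj B" "f \<in> fobj rep (Dom A \<alpha>, b)"
      "w \<in> fobj \<Omega> (b, Cod Z \<gamma>)"
    then have "fmor \<Omega> (K \<alpha>, \<gamma>) (fmor \<Omega> (K f, Ident Z (Cod Z \<gamma>)) w) = fmor \<Omega> (Comp B (K \<alpha>) (K f), \<gamma>) w"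
      using P.R.comp[of "K f" "K \<alpha>" "Ident Z (Cod Z \<gamma>)" \<gamma> w] by (auto simp: simps P.R.D.Ident_Comp)
    moreover have "fmor \<Omega> (Comp B (K \<alpha>) (K f), Ident Z (Dom Z \<gamma>)) (fmor \<Omega> (Ident B b, \<gamma>) w)
        = fmor \<Omega> (Comp B (K \<alpha>) (K f), \<gamma>) w"
      using P.R.left_right[of "Comp B (K \<alpha>) (K f)" \<gamma> w] * by (auto simp: simps)
    ultimately show "fmor \<Omega> (K (fmor rep (\<alpha>, Ident B b) f), Ident Z (Dom Z \<gamma>)) (fmor \<Omega> (Ident B b, \<gamma>) w)
      = fmor (reindex (map_prod k id) (map_prod K id) \<Omega>) (\<alpha>, \<gamma>) (fmor \<Omega> (K f, Ident Z (Cod Z \<gamma>)) w)"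
      using * by (auto simp: simps)
  next
    fix a z w assume "a \<in> Obj A" "z \<in> Obj Z" "w \<in> fobj (reindex (map_prod k id) (map_prod K id) \<Omega>) (a, z)"
    then show "\<exists>b\<in>Obj B. \<exists>f\<in>fobj rep (a, b). \<exists>w'\<in>fobj \<Omega> (b, z). w = fmor \<Omega> (K f, Ident Z z) w'"
      by (intro bexI[of _ "k a"] bexI[of _ "Ident A a"] bexI[of _ w]) (auto simp: simps P.R.ident)
  qed
qed

text \<open>The mirror image of \<open>comp_rep\<close>. Here \<open>f : j b \<rightarrow> a\<close>
  acts on \<Upsilon> from the right and lands at \<open>j b\<close>, so \<open>j\<close> itself
  appears.\<close>

lemma rep_comp:
  assumes "finite_category A" "finite_category B" "biset Z A \<Upsilon>"
  shows "biset_iso Z B (biset_comp Z A B \<Upsilon> rep) (reindex (map_prod id j) (map_prod id J) \<Upsilon>)"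
proof -
  interpret P: composable Z A B \<Upsilon> rep by (intro composableI biset_rep assms)
  note simps = cat_simps Comp_IdentA P.L.C.Ident_closed P.L.C.Cod_Ident P.L.C.Dom_Ident
    P.L.C.Dom_closed P.L.C.Cod_closed
  have eq: "P.cl z b (j b) (fmor \<Upsilon> (Ident Z z, f) u) (Ident A (j b)) = P.cl z b a u f"
    if "z \<in> Obj Z" "b \<in> Obj B" "a \<in> Obj A" "u \<in> fobj \<Upsilon> (z, a)" "f \<in> fobj rep (a, b)" for z b a u f
    using P.glue[of f u z "Ident A (j b)" b] that by (auto simp: simps)
  show ?thesis
  proof (rule P.comp_isoI[of "\<lambda>z b a u f. fmor \<Upsilon> (Ident Z z, f) u" _
        "\<lambda>z b w. P.cl z b (j b) w (Ident A (j b))"])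
    fix z b a u f assume *: "z \<in> Obj Z" "b \<in> Obj B" "a \<in> Obj A" "u \<in> fobj \<Upsilon> (z, a)" "f \<in> fobj rep (a, b)"
    then show "fmor \<Upsilon> (Ident Z z, f) u \<in> fobj (reindex (map_prod id j) (map_prod id J) \<Upsilon>) (z, b)"
      using P.L.right_closed[of z f u] by (auto simp: simps)
    show "P.cl z b (j b) (fmor \<Upsilon> (Ident Z z, f) u) (Ident A (j b)) = P.cl z b a u f"
      using * by (rule eq)
  next
    fix z b \<beta> u f assume *: "z \<in> Obj Z" "b \<in> Obj B" "\<beta> \<in> Arr A" "u \<in> fobj \<Upsilon> (z, Cod A \<beta>)"
      "f \<in> fobj rep (Dom A \<beta>, b)"
    then show "fmor \<Upsilon> (Ident Z z, f) (fmor \<Upsilon> (Ident Z z, \<beta>) u)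
      = fmor \<Upsilon> (Ident Z z, fmor rep (\<beta>, Ident B b) f) u"
      using P.L.comp[of "Ident Z z" "Ident Z z" \<beta> f u] P.L.C.Comp_Ident[of "Ident Z z"]
      by (auto simp: simps)
  next
    fix \<alpha> \<beta> a u f assume *: "\<alpha> \<in> Arr Z" "\<beta> \<in> Arr B" "a \<in> Obj A" "u \<in> fobj \<Upsilon> (Dom Z \<alpha>, a)"
      "f \<in> fobj rep (a, Cod B \<beta>)"
    then have "fmor \<Upsilon> (\<alpha>, J \<beta>) (fmor \<Upsilon> (Ident Z (Dom Z \<alpha>), f) u) = fmor \<Upsilon> (\<alpha>, Comp A f (J \<beta>)) u"
      using P.L.comp[of "Ident Z (Dom Z \<alpha>)" \<alpha> f "J \<beta>" u] by (auto simp: simps P.L.C.Comp_Ident)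
    moreover have "fmor \<Upsilon> (Ident Z (Cod Z \<alpha>), Comp A f (J \<beta>)) (fmor \<Upsilon> (\<alpha>, Ident A a) u)
        = fmor \<Upsilon> (\<alpha>, Comp A f (J \<beta>)) u"
      using P.L.right_left[of \<alpha> "Comp A f (J \<beta>)" u] * by (auto simp: simps)
    ultimately show "fmor \<Upsilon> (Ident Z (Cod Z \<alpha>), fmor rep (Ident A a, \<beta>) f) (fmor \<Upsilon> (\<alpha>, Ident A a) u)
      = fmor (reindex (map_prod id j) (map_prod id J) \<Upsilon>) (\<alpha>, \<beta>) (fmor \<Upsilon> (Ident Z (Dom Z \<alpha>), f) u)"
      using * by (auto simp: simps)
  next
    fix z b w assume "z \<in> Obj Z" "b \<in> Obj B" "w \<in> fobj (reindex (map_prod id j) (map_prod id J) \<Upsilon>) (z, b)"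
    then show "\<exists>a\<in>Obj A. \<exists>u\<in>fobj \<Upsilon> (z, a). \<exists>f\<in>fobj rep (a, b). w = fmor \<Upsilon> (Ident Z z, f) u"
      by (intro bexI[of _ "j b"] bexI[of _ w] bexI[of _ "Ident A (j b)"]) (auto simp: simps P.L.ident)
  qed
qed

lemma swap: "cat_iso B A k K j J"
  by unfold_locales (auto simp: J K jk kj JK KJ)

end

text \<open>By \<open>comp_rep\<close> the composite at \<open>(x, y)\<close> consists of the arrows
  \<open>k y \<rightarrow> k x\<close> of \<open>B\<close>, which \<open>J\<close> identifies with
  the arrows \<open>y \<rightarrow> x\<close> of \<open>A\<close>. The opposite composite is the
  same statement for the swapped isomorphism.\<close>

lemma (in cat_iso) rep_inverse:
  assumes "finite_category A" "finite_category B"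
  shows "biset_iso A A (biset_comp A B A rep (cat_iso.rep B k K)) (biset_id A)"
proof -
  interpret S: cat_iso B A k K j J by (rule swap)
  have "biset_iso A A (reindex (map_prod k id) (map_prod K id) S.rep) (biset_id A)"
  proof (rule biset_isoI[of _ _ _ "\<lambda>_ _. J" _ "\<lambda>_ _. K"])
    fix x y assume "x \<in> Obj A" "y \<in> Obj A"
    moreover fix g assume "g \<in> fobj (reindex (map_prod k id) (map_prod K id) S.rep) (x, y)"
    ultimately show "J g \<in> fobj (biset_id A) (x, y)" by (auto simp: cat_simps)
  qed (auto simp: cat_simps)
  then show ?thesis
    by (intro naturally_iso_trans[OF _ comp_rep[OF assms S.biset_rep[OF assms(2)]]]
        category_prod_cat category_op_cat A.category_axioms)
qed

section \<open>Currying a composite\<close>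

definition assocr :: "('a \<times> 'b) \<times> 'c \<Rightarrow> 'a \<times> 'b \<times> 'c" where
  "assocr = (\<lambda>((x, y), z). (x, y, z))"

definition assocl :: "'a \<times> 'b \<times> 'c \<Rightarrow> ('a \<times> 'b) \<times> 'c" where
  "assocl = (\<lambda>(x, y, z). ((x, y), z))"

lemma assoc_simps [simp]: "assocr ((x, y), z) = (x, y, z)" "assocl (x, y, z) = ((x, y), z)"
  by (simp_all add: assocr_def assocl_def)

text \<open>The two categories play two roles. As domains of functors they underlie the bisets for
  \<open>Hom(C \<times> D, E)\<close> and for \<open>Hom(D, H(C, E))\<close>; as objects of the
  biset category they are the two iterated internal Homs. Both isomorphisms of the theorem rest on
  this one.\<close>

lemma cat_iso_assoc:
  assumes "category C" "category D" "category E"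
  shows "cat_iso (prod_cat (prod_cat E (op_cat C)) (op_cat D)) (prod_cat E (op_cat (prod_cat C D)))
    assocl assocl assocr assocr"
proof -
  interpret A: category "prod_cat (prod_cat E (op_cat C)) (op_cat D)"
    by (intro category_prod_cat category_op_cat assms)
  interpret B: category "prod_cat E (op_cat (prod_cat C D))"
    by (intro category_prod_cat category_op_cat assms)
  show ?thesis
    by unfold_locales (auto simp: is_functor_def)
qed

text \<open>Naturality of currying at the level of bisets. Up to order, a representative on either
  side consists of objects \<open>e\<close>, \<open>c\<close>, \<open>d\<close> and elements
  \<open>g\<close>, \<open>w\<close>, \<open>f\<close>, \<open>h\<close>; only the grouping of the
  coends differs. On the left one first takes the coend over \<open>(e, c)\<close> and then over
  \<open>d\<close>, on the right first over \<open>e\<close> and then over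
  \<open>(c, d)\<close>.\<close>

lemma biset_comp_curry:
  assumes G: "biset E' E G" and F: "biset C C' F" and H: "biset D D' H" and W: "biset E (prod_cat C D) W"
    and fin: "finite_category C" "finite_category C'" "finite_category D" "finite_category D'"
      "finite_category E" "finite_category E'"
  shows "biset_iso (prod_cat E' (op_cat C')) D'
    (biset_comp (prod_cat E' (op_cat C')) D D'
      (biset_comp (prod_cat E' (op_cat C')) (prod_cat E (op_cat C)) D
        (biset_prod G (biset_op F)) (reindex assocr assocr W)) H)
    (reindex assocr assocr (biset_comp E' (prod_cat C D) (prod_cat C' D')
        (biset_comp E' E (prod_cat C D) G W) (biset_prod F H)))"
proof -
  note fins = fin finite_category_prod_cat finite_category_op_cat
  note cats = fin[THEN finite_categoryD(1)] category_prod_cat category_op_cat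
  interpret G: biset E' E G by fact
  interpret F: biset C C' F by fact
  interpret H: biset D D' H by fact
  interpret W: biset E "prod_cat C D" W by fact
  interpret S1: composable E' E "prod_cat C D" G W
    by (intro composableI G W fins)
  interpret S: composable E' "prod_cat C D" "prod_cat C' D'" "biset_comp E' E (prod_cat C D) G W" "biset_prod F H"
    by (intro composableI S1.biset_P biset_biset_prod F H fins)
  have F': "biset (op_cat C') (op_cat C) (biset_op F)"
    unfolding biset_op_eq_reindex by (intro biset_reindex[OF F] is_functor_swap cats)
  have W': "biset (prod_cat E (op_cat C)) D (reindex assocr assocr W)"
    by (intro biset_reindex[OF W] cats) (auto simp: is_functor_def)
  interpret T1: composable "prod_cat E' (op_cat C')" "prod_cat E (op_cat C)" D
      "biset_prod G (biset_op F)" "reindex assocr assocr W"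
    by (intro composableI biset_biset_prod G F' W' fins)
  interpret T: composable "prod_cat E' (op_cat C')" D D'
      "biset_comp (prod_cat E' (op_cat C')) (prod_cat E (op_cat C)) D
        (biset_prod G (biset_op F)) (reindex assocr assocr W)" H
    by (intro composableI T1.biset_P H fins)
  note cat = G.C.Ident_closed G.C.Dom_Ident G.C.Cod_Ident G.C.Dom_closed G.C.Cod_closed
    G.D.Ident_closed G.D.Dom_Ident G.D.Cod_Ident G.D.Dom_closed G.D.Cod_closed
    F.C.Ident_closed F.C.Dom_Ident F.C.Cod_Ident F.C.Dom_closed F.C.Cod_closed
    F.D.Ident_closed F.D.Dom_Ident F.D.Cod_Ident F.D.Dom_closed F.D.Cod_closed
    H.C.Ident_closed H.C.Dom_Ident H.C.Cod_Ident H.C.Dom_closed H.C.Cod_closed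
    H.D.Ident_closed H.D.Dom_Ident H.D.Cod_Ident H.D.Dom_closed H.D.Cod_closed
  note act = G.ident F.ident H.ident G.left_closed G.right_closed F.left_closed F.right_closed
    H.left_closed H.right_closed
  \<comment> \<open>\<open>K1\<close> descends through the inner coend over \<open>(e, c)\<close>
    with \<open>h\<close> fixed; compatibility with arrows of \<open>D\<close> is left to
    \<open>comp_isoI\<close>. In the other direction \<open>L1\<close> descends through the coend
    over \<open>e\<close>, and \<open>L\<close> through the one over \<open>(c, d)\<close>.\<close>
  define K1 where "K1 e' c' d' d h = coend_lift
    (\<lambda>(e, c) (g, f) w. S.cl e' (c', d') (c, d) (S1.cl e' (c, d) e g w) (f, h))" for e' c' d' d h
  define L1 where "L1 e' c' d' c d f h = coend_lift
    (\<lambda>e g w. T.cl (e', c') d' d (T1.cl (e', c') d (e, c) (g, f) w) h)" for e' c' d' c d f h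
  define L where "L e' c' d' = coend_lift (\<lambda>(c, d) N (f, h). L1 e' c' d' c d f h N)" for e' c' d'
  have K1: "K1 e' c' d' d h (T1.cl (e', c') d (e, c) (g, f) w)
      = S.cl e' (c', d') (c, d) (S1.cl e' (c, d) e g w) (f, h)"
    if "e' \<in> Obj E'" "c' \<in> Obj C'" "d' \<in> Obj D'" "d \<in> Obj D" "h \<in> fobj H (d, d')"
    for e' c' d' d h e c g f w
  proof -
    have "T1.balanced (e', c') d (\<lambda>(e, c) (g, f) w. S.cl e' (c', d') (c, d) (S1.cl e' (c, d) e g w) (f, h))"
    proof (rule T1.balancedI, clarsimp)
      fix \<epsilon> \<gamma> g f w assume *: "\<epsilon> \<in> Arr E" "\<gamma> \<in> Arr C" "g \<in> fobj G (e', Cod E \<epsilon>)"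
        "f \<in> fobj F (Dom C \<gamma>, c')" "w \<in> fobj W (Dom E \<epsilon>, Cod C \<gamma>, d)"
      \<comment> \<open>A single step over \<open>(\<epsilon>, \<gamma>)\<close> on the left becomes
        two on the right: \<open>\<gamma>\<close> crosses the outer coend, paired with the identity
        of \<open>d\<close>, and reaches \<open>w\<close> through the action on the inner class;
        \<open>\<epsilon>\<close> then crosses the inner coend.\<close>
      have "S.cl e' (c', d') (Cod C \<gamma>, d) (S1.cl e' (Cod C \<gamma>, d) (Dom E \<epsilon>) (fmor G (Ident E' e', \<epsilon>) g) w)
          (fmor F (\<gamma>, Ident C' c') f, h)
        = S.cl e' (c', d') (Dom C \<gamma>, d) (fmor S1.P (Ident E' e', (\<gamma>, Ident D d))
            (S1.cl e' (Cod C \<gamma>, d) (Dom E \<epsilon>) (fmor G (Ident E' e', \<epsilon>) g) w)) (f, h)"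
        using S.glue[of "(\<gamma>, Ident D d)" "S1.cl e' (Cod C \<gamma>, d) (Dom E \<epsilon>) (fmor G (Ident E' e', \<epsilon>) g) w"
            e' "(f, h)" "(c', d')"] that *
        by (simp add: cat act S1.cl_in)
      also have "fmor S1.P (Ident E' e', (\<gamma>, Ident D d))
            (S1.cl e' (Cod C \<gamma>, d) (Dom E \<epsilon>) (fmor G (Ident E' e', \<epsilon>) g) w)
        = S1.cl e' (Dom C \<gamma>, d) (Dom E \<epsilon>) (fmor G (Ident E' e', \<epsilon>) g)
            (fmor W (Ident E (Dom E \<epsilon>), (\<gamma>, Ident D d)) w)"
        using S1.fmor_cl_right[of e' "(\<gamma>, Ident D d)" "Dom E \<epsilon>" "fmor G (Ident E' e', \<epsilon>) g" w] that *
        by (simp add: cat act)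
      also have "\<dots> = S1.cl e' (Dom C \<gamma>, d) (Cod E \<epsilon>) g
          (fmor W (\<epsilon>, Ident (prod_cat C D) (Dom C \<gamma>, d)) (fmor W (Ident E (Dom E \<epsilon>), (\<gamma>, Ident D d)) w))"
        using that * W.right_closed[of "Dom E \<epsilon>" "(\<gamma>, Ident D d)" w]
        by (intro S1.glue) (simp_all add: cat act)
      also have "fmor W (\<epsilon>, Ident (prod_cat C D) (Dom C \<gamma>, d)) (fmor W (Ident E (Dom E \<epsilon>), (\<gamma>, Ident D d)) w)
        = fmor W (\<epsilon>, \<gamma>, Ident D d) w"
        using that * W.left_right[of \<epsilon> "(\<gamma>, Ident D d)" w] by (simp add: cat)
      finally show "S.cl e' (c', d') (Cod C \<gamma>, d) (S1.cl e' (Cod C \<gamma>, d) (Dom E \<epsilon>) (fmor G (Ident E' e', \<epsilon>) g) w)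
            (fmor F (\<gamma>, Ident C' c') f, h)
        = S.cl e' (c', d') (Dom C \<gamma>, d) (S1.cl e' (Dom C \<gamma>, d) (Cod E \<epsilon>) g (fmor W (\<epsilon>, \<gamma>, Ident D d) w)) (f, h)" .
    qed
    then show ?thesis
      unfolding K1_def using that by (subst T1.lift_cl) auto
  qed
  have L1: "L1 e' c' d' c d f h (S1.cl e' (c, d) e g w) = T.cl (e', c') d' d (T1.cl (e', c') d (e, c) (g, f) w) h"
    if "e' \<in> Obj E'" "c' \<in> Obj C'" "d' \<in> Obj D'" "c \<in> Obj C" "d \<in> Obj D" "f \<in> fobj F (c, c')"
    for e' c' d' c d f h e g w
  proof -
    have "S1.balanced e' (c, d) (\<lambda>e g w. T.cl (e', c') d' d (T1.cl (e', c') d (e, c) (g, f) w) h)"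
    proof (rule S1.balancedI)
      fix \<epsilon> g w assume *: "\<epsilon> \<in> Arr E" "g \<in> fobj G (e', Cod E \<epsilon>)" "w \<in> fobj W (Dom E \<epsilon>, c, d)"
      then have "T1.cl (e', c') d (Dom E \<epsilon>, c) (fmor G (Ident E' e', \<epsilon>) g, f) w
        = T1.cl (e', c') d (Cod E \<epsilon>, c) (g, f) (fmor W (\<epsilon>, Ident (prod_cat C D) (c, d)) w)"
        using T1.glue[of "(\<epsilon>, Ident C c)" "(g, f)" "(e', c')" w d] that by (simp add: cat act)
      then show "T.cl (e', c') d' d (T1.cl (e', c') d (Dom E \<epsilon>, c) (fmor G (Ident E' e', \<epsilon>) g, f) w) h
        = T.cl (e', c') d' d (T1.cl (e', c') d (Cod E \<epsilon>, c) (g, f) (fmor W (\<epsilon>, Ident (prod_cat C D) (c, d)) w)) h"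
        by simp
    qed
    then show ?thesis
      unfolding L1_def using that by (subst S1.lift_cl) auto
  qed
  have L: "L e' c' d' (S.cl e' (c', d') (c, d) (S1.cl e' (c, d) e g w) (f, h))
      = T.cl (e', c') d' d (T1.cl (e', c') d (e, c) (g, f) w) h"
    if ob: "e' \<in> Obj E'" "c' \<in> Obj C'" "d' \<in> Obj D'" and "c \<in> Obj C" "d \<in> Obj D" "f \<in> fobj F (c, c')"
    for e' c' d' c d f h e g w
  proof -
    have "S.balanced e' (c', d') (\<lambda>(c, d) N (f, h). L1 e' c' d' c d f h N)"
    proof (rule S.balancedI, clarsimp)
      fix \<gamma> \<delta> N f h assume *: "\<gamma> \<in> Arr C" "\<delta> \<in> Arr D" "N \<in> fobj S1.P (e', Cod C \<gamma>, Cod D \<delta>)"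
        "f \<in> fobj F (Dom C \<gamma>, c')" "h \<in> fobj H (Dom D \<delta>, d')"
      then obtain e g w where N: "e \<in> Obj E" "g \<in> fobj G (e', e)" "w \<in> fobj W (e, Cod C \<gamma>, Cod D \<delta>)"
        "N = S1.cl e' (Cod C \<gamma>, Cod D \<delta>) e g w" by (elim S1.in_cl)
      \<comment> \<open>The action of \<open>(\<gamma>, \<delta>)\<close> on \<open>w\<close> is
        split, \<open>\<delta>\<close> first. Then \<open>\<gamma>\<close> can be glued into
        \<open>F\<close> through the inner coend over \<open>(e, c)\<close>, and
        \<open>\<delta>\<close> into \<open>H\<close> through the outer coend over
        \<open>d\<close>.\<close>
      define wd where "wd = fmor W (Ident E e, Ident C (Cod C \<gamma>), \<delta>) w"
      have wd: "wd \<in> fobj W (e, Cod C \<gamma>, Dom D \<delta>)"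
        using W.right_closed[of e "(Ident C (Cod C \<gamma>), \<delta>)" w] N * by (simp add: wd_def cat)
      have w: "fmor W (Ident E e, \<gamma>, \<delta>) w = fmor W (Ident E e, \<gamma>, Ident D (Dom D \<delta>)) wd"
        using W.comp[of "Ident E e" "Ident E e" "(Ident C (Cod C \<gamma>), \<delta>)" "(\<gamma>, Ident D (Dom D \<delta>))" w] N *
        using G.D.Comp_Ident[of "Ident E e"] F.C.Ident_Comp[of \<gamma>] H.C.Comp_Ident[of \<delta>]
        by (simp add: wd_def cat)
      have "fmor S1.P (Ident E' e', \<gamma>, \<delta>) N = S1.cl e' (Dom C \<gamma>, Dom D \<delta>) e g (fmor W (Ident E e, \<gamma>, \<delta>) w)"
        using S1.fmor_cl_right[of e' "(\<gamma>, \<delta>)" e g w] N * ob by simp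
      then have "L1 e' c' d' (Dom C \<gamma>) (Dom D \<delta>) f h (fmor S1.P (Ident E' e', \<gamma>, \<delta>) N)
        = T.cl (e', c') d' (Dom D \<delta>)
            (T1.cl (e', c') (Dom D \<delta>) (e, Dom C \<gamma>) (g, f) (fmor W (Ident E e, \<gamma>, Ident D (Dom D \<delta>)) wd)) h"
        using * ob w by (simp add: L1 cat)
      also have "T1.cl (e', c') (Dom D \<delta>) (e, Dom C \<gamma>) (g, f) (fmor W (Ident E e, \<gamma>, Ident D (Dom D \<delta>)) wd)
        = T1.cl (e', c') (Dom D \<delta>) (e, Cod C \<gamma>) (g, fmor F (\<gamma>, Ident C' c') f) wd"
        using T1.glue[of "(Ident E e, \<gamma>)" "(g, f)" "(e', c')" wd "Dom D \<delta>"] * N ob wd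
        by (simp add: cat act)
      also have "\<dots> = fmor T1.P (Ident (prod_cat E' (op_cat C')) (e', c'), \<delta>)
          (T1.cl (e', c') (Cod D \<delta>) (e, Cod C \<gamma>) (g, fmor F (\<gamma>, Ident C' c') f) w)"
        using T1.fmor_cl_right[of "(e', c')" \<delta> "(e, Cod C \<gamma>)" "(g, fmor F (\<gamma>, Ident C' c') f)" w] * N ob
        by (simp add: cat act wd_def)
      also have "T.cl (e', c') d' (Dom D \<delta>) \<dots> h
        = T.cl (e', c') d' (Cod D \<delta>) (T1.cl (e', c') (Cod D \<delta>) (e, Cod C \<gamma>) (g, fmor F (\<gamma>, Ident C' c') f) w)
            (fmor H (\<delta>, Ident D' d') h)"
        using * N ob by (intro T.glue T1.cl_in) (auto simp: cat act)
      also have "\<dots> = L1 e' c' d' (Cod C \<gamma>) (Cod D \<delta>) (fmor F (\<gamma>, Ident C' c') f) (fmor H (\<delta>, Ident D' d') h) N"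
        using * N ob by (simp add: L1 cat act)
      finally show "L1 e' c' d' (Dom C \<gamma>) (Dom D \<delta>) f h (fmor S1.P (Ident E' e', \<gamma>, \<delta>) N)
        = L1 e' c' d' (Cod C \<gamma>) (Cod D \<delta>) (fmor F (\<gamma>, Ident C' c') f) (fmor H (\<delta>, Ident D' d') h) N" .
    qed
    then show ?thesis
      unfolding L_def using that by (subst S.lift_cl) (auto simp: L1)
  qed
  show ?thesis
  proof (rule T.comp_isoI[of "\<lambda>(e', c') d' d M h. K1 e' c' d' d h M" _ "\<lambda>(e', c') d'. L e' c' d'"])
    fix x d' d M h assume *: "x \<in> Obj (prod_cat E' (op_cat C'))" "d' \<in> Obj D'" "d \<in> Obj D"
      "M \<in> fobj T1.P (x, d)" "h \<in> fobj H (d, d')"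
    obtain e' c' where x: "x = (e', c')" by (cases x)
    from *(4) obtain y g f w where "y \<in> Obj (prod_cat E (op_cat C))" "(g, f) \<in> fobj (biset_prod G (biset_op F)) (x, y)"
      "w \<in> fobj (reindex assocr assocr W) (y, d)" "M = T1.cl x d y (g, f) w"
      by (elim T1.in_cl) auto
    then obtain e c where M: "e \<in> Obj E" "c \<in> Obj C" "g \<in> fobj G (e', e)" "f \<in> fobj F (c, c')"
      "w \<in> fobj W (e, c, d)" "M = T1.cl (e', c') d (e, c) (g, f) w"
      by (cases y) (auto simp: x)
    show "(case x of (e', c') \<Rightarrow> \<lambda>d' d M h. K1 e' c' d' d h M) d' d M h
      \<in> fobj (reindex assocr assocr S.P) (x, d')"
      using * M by (auto simp: x K1 intro!: S.cl_in S1.cl_in)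
    show "(case x of (e', c') \<Rightarrow> L e' c') d' ((case x of (e', c') \<Rightarrow> \<lambda>d' d M h. K1 e' c' d' d h M) d' d M h)
      = T.cl x d' d M h"
      using * M by (auto simp: x K1 L)
  next
    fix x d' \<delta> M h assume *: "x \<in> Obj (prod_cat E' (op_cat C'))" "d' \<in> Obj D'" "\<delta> \<in> Arr D"
      "M \<in> fobj T1.P (x, Cod D \<delta>)" "h \<in> fobj H (Dom D \<delta>, d')"
    obtain e' c' where x: "x = (e', c')" by (cases x)
    from *(4) obtain y g f w where "y \<in> Obj (prod_cat E (op_cat C))" "(g, f) \<in> fobj (biset_prod G (biset_op F)) (x, y)"
      "w \<in> fobj (reindex assocr assocr W) (y, Cod D \<delta>)" "M = T1.cl x (Cod D \<delta>) y (g, f) w"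
      by (elim T1.in_cl) auto
    then obtain e c where M: "e \<in> Obj E" "c \<in> Obj C" "g \<in> fobj G (e', e)" "f \<in> fobj F (c, c')"
      "w \<in> fobj W (e, c, Cod D \<delta>)" "M = T1.cl (e', c') (Cod D \<delta>) (e, c) (g, f) w"
      by (cases y) (auto simp: x)
    have "fmor T1.P ((Ident E' e', Ident C' c'), \<delta>) M = T1.cl (e', c') (Dom D \<delta>) (e, c) (g, f) (fmor W (Ident E e, Ident C c, \<delta>) w)"
      using T1.fmor_cl_right[of "(e', c')" \<delta> "(e, c)" "(g, f)" w] M * by (simp add: x)
    moreover have "S.cl e' (c', d') (c, Dom D \<delta>) (S1.cl e' (c, Dom D \<delta>) e g (fmor W (Ident E e, Ident C c, \<delta>) w)) (f, h)
      = S.cl e' (c', d') (c, Cod D \<delta>) (S1.cl e' (c, Cod D \<delta>) e g w) (f, fmor H (\<delta>, Ident D' d') h)"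
      using S.glue[of "(Ident C c, \<delta>)" "S1.cl e' (c, Cod D \<delta>) e g w" e' "(f, h)" "(c', d')"]
        S1.fmor_cl_right[of e' "(Ident C c, \<delta>)" e g w] * M
      by (simp add: cat act x S1.cl_in)
    ultimately show "(case x of (e', c') \<Rightarrow> \<lambda>d' d M h. K1 e' c' d' d h M) d' (Dom D \<delta>)
        (fmor T1.P (Ident (prod_cat E' (op_cat C')) x, \<delta>) M) h
      = (case x of (e', c') \<Rightarrow> \<lambda>d' d M h. K1 e' c' d' d h M) d' (Cod D \<delta>) M (fmor H (\<delta>, Ident D' d') h)"
      using * M by (simp add: x K1 cat act)
  next
    fix \<alpha> \<delta> d M h assume *: "\<alpha> \<in> Arr (prod_cat E' (op_cat C'))" "\<delta> \<in> Arr D'" "d \<in> Obj D"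
      "M \<in> fobj T1.P (Dom (prod_cat E' (op_cat C')) \<alpha>, d)" "h \<in> fobj H (d, Cod D' \<delta>)"
    obtain \<epsilon> \<gamma> where \<alpha>: "\<alpha> = (\<epsilon>, \<gamma>)" by (cases \<alpha>)
    from *(4) obtain y g f w where "y \<in> Obj (prod_cat E (op_cat C))"
      "(g, f) \<in> fobj (biset_prod G (biset_op F)) ((Dom E' \<epsilon>, Cod C' \<gamma>), y)"
      "w \<in> fobj (reindex assocr assocr W) (y, d)" "M = T1.cl (Dom E' \<epsilon>, Cod C' \<gamma>) d y (g, f) w"
      by (elim T1.in_cl) (auto simp: \<alpha>)
    then obtain e c where M: "e \<in> Obj E" "c \<in> Obj C" "g \<in> fobj G (Dom E' \<epsilon>, e)" "f \<in> fobj F (c, Cod C' \<gamma>)"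
      "w \<in> fobj W (e, c, d)" "M = T1.cl (Dom E' \<epsilon>, Cod C' \<gamma>) d (e, c) (g, f) w"
      by (cases y) auto
    have "fmor T1.P ((\<epsilon>, \<gamma>), Ident D d) M
      = T1.cl (Cod E' \<epsilon>, Dom C' \<gamma>) d (e, c) (fmor G (\<epsilon>, Ident E e) g, fmor F (Ident C c, \<gamma>) f) w"
      using T1.fmor_cl_left[of "(\<epsilon>, \<gamma>)" d "(e, c)" "(g, f)" w] M * by (simp add: \<alpha>)
    moreover have "fmor S.P (\<epsilon>, \<gamma>, \<delta>) (S.cl (Dom E' \<epsilon>) (Cod C' \<gamma>, Cod D' \<delta>) (c, d) (S1.cl (Dom E' \<epsilon>) (c, d) e g w) (f, h))
      = S.cl (Cod E' \<epsilon>) (Dom C' \<gamma>, Dom D' \<delta>) (c, d) (S1.cl (Cod E' \<epsilon>) (c, d) e (fmor G (\<epsilon>, Ident E e) g) w)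
          (fmor F (Ident C c, \<gamma>) f, fmor H (Ident D d, \<delta>) h)"
      using S.fmor_cl[of \<epsilon> "(\<gamma>, \<delta>)" "(c, d)" "S1.cl (Dom E' \<epsilon>) (c, d) e g w" "(f, h)"]
        S1.fmor_cl_left[of \<epsilon> "(c, d)" e g w] * M
      by (simp add: \<alpha> S1.cl_in)
    ultimately show "(case Cod (prod_cat E' (op_cat C')) \<alpha> of (e', c') \<Rightarrow> \<lambda>d' d M h. K1 e' c' d' d h M) (Dom D' \<delta>) d
        (fmor T1.P (\<alpha>, Ident D d) M) (fmor H (Ident D d, \<delta>) h)
      = fmor (reindex assocr assocr S.P) (\<alpha>, \<delta>)
        ((case Dom (prod_cat E' (op_cat C')) \<alpha> of (e', c') \<Rightarrow> \<lambda>d' d M h. K1 e' c' d' d h M) (Cod D' \<delta>) d M h)"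
      using * M by (simp add: \<alpha> K1 cat act)
  next
    fix x d' w' assume *: "x \<in> Obj (prod_cat E' (op_cat C'))" "d' \<in> Obj D'"
      "w' \<in> fobj (reindex assocr assocr S.P) (x, d')"
    obtain e' c' where x: "x = (e', c')" by (cases x)
    from *(3) obtain c d N f h where 1: "c \<in> Obj C" "d \<in> Obj D" "N \<in> fobj S1.P (e', c, d)"
      "f \<in> fobj F (c, c')" "h \<in> fobj H (d, d')" "w' = S.cl e' (c', d') (c, d) N (f, h)"
      by (auto simp: x elim!: S.in_cl)
    from 1(3) obtain e g w where 2: "e \<in> Obj E" "g \<in> fobj G (e', e)" "w \<in> fobj W (e, c, d)"
      "N = S1.cl e' (c, d) e g w" by (elim S1.in_cl)
    have "w' = K1 e' c' d' d h (T1.cl (e', c') d (e, c) (g, f) w)"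
      using * 1 2 by (simp add: K1 x)
    moreover have "T1.cl (e', c') d (e, c) (g, f) w \<in> fobj T1.P (x, d)"
      unfolding x using 1 2 by (intro T1.cl_in) auto
    ultimately show "\<exists>d\<in>Obj D. \<exists>M\<in>fobj T1.P (x, d). \<exists>h\<in>fobj H (d, d').
        w' = (case x of (e', c') \<Rightarrow> \<lambda>d' d M h. K1 e' c' d' d h M) d' d M h"
      using 1(2,5) by (auto simp: x)
  qed
qed

section \<open>Linear and bilinear extension from bisets\<close>

lemma biset_class_cong:
  assumes "biset C D \<Omega>" "biset_iso C D \<Omega> \<Omega>'"
  shows "biset_class C D \<Omega> = biset_class C D \<Omega>'"
proof -
  interpret biset C D \<Omega> by fact
  have cat: "category (prod_cat C (op_cat D))"
    by (intro category_prod_cat category_op_cat C.category_axioms D.category_axioms)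
  show ?thesis
    unfolding biset_class_def
    using naturally_iso_trans[OF cat assms(2)]
      naturally_iso_trans[OF cat naturally_iso_sym[OF as_functor assms(2)]] by blast
qed

lemma biset_nat_copy:
  assumes "biset C D \<Omega>"
  obtains \<Omega>' where "biset C D (\<Omega>' :: ('o, 'a, 'p, 'b, nat) biset)" "biset_iso C D \<Omega> \<Omega>'"
proof -
  interpret biset C D \<Omega> by fact
  obtain \<Omega>' :: "('o, 'a, 'p, 'b, nat) biset" where
    "finset_functor (prod_cat C (op_cat D)) \<Omega>'" "biset_iso C D \<Omega> \<Omega>'"
    using nat_copy[OF as_functor] .
  then show thesis
    using C.category_axioms D.category_axioms that
    by (simp add: biset_iff_is_biset[symmetric] is_biset_def)
qed

text \<open>\<open>biset_classes\<close> collects classes of \<open>nat\<close>-valued bisets only;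
  a \<open>nat\<close>-valued copy shows that bisets with any value type have their class
  there.\<close>

lemma biset_class_in:
  assumes "biset C D \<Omega>"
  shows "biset_class C D \<Omega> \<in> biset_classes C D"
proof -
  obtain \<Omega>' where \<Omega>': "biset C D (\<Omega>' :: ('a, 'b, 'c, 'd, nat) biset)" "biset_iso C D \<Omega> \<Omega>'"
    using biset_nat_copy[OF assms] .
  then show ?thesis
    unfolding biset_class_cong[OF assms \<Omega>'(2)] biset_classes_def by (auto intro: biset.is_biset)
qed

section \<open>The Grothendieck group and its universal property\<close>

locale category_pair = C: category C + D: category D
  for C :: "('o, 'a) cat" and D :: "('p, 'b) cat"
begin

lemma is_biset_iff: "is_biset C D \<Omega> \<longleftrightarrow> biset C D \<Omega>"
  by (rule biset_iff_is_biset[OF C.category_axioms D.category_axioms])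

sublocale G: free_quotient "biset_classes C D" "union_relators C D"
proof
  fix c assume "c \<in> union_relators C D"
  then show "Poly_Mapping.keys c \<subseteq> biset_classes C D"
    unfolding union_relators_def is_biset_iff
    by (auto dest!: subsetD[OF keys_diff] simp: biset_class_in biset_biset_union)
qed

lemma groth_group_eq: "groth_group C D = G.Q"
  by (simp add: groth_group_def union_subgroup_def)

lemma comm_group_groth: "comm_group (groth_group C D)"
  unfolding groth_group_eq by (rule G.comm_group_Q)

lemma groth_class_eq: "groth_class C D \<Omega> = G.cs (frag_of (biset_class C D \<Omega>))"
  by (simp add: groth_class_def union_subgroup_def)

lemma groth_class_closed: "biset C D \<Omega> \<Longrightarrow> groth_class C D \<Omega> \<in> carrier (groth_group C D)"
  unfolding groth_class_eq groth_group_eq G.carrier_Q_iff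
  by (rule exI[of _ "frag_of (biset_class C D \<Omega>)"]) (simp add: biset_class_in)

lemma groth_carrier_iff:
  "a \<in> carrier (groth_group C D) \<longleftrightarrow> (\<exists>p. Poly_Mapping.keys p \<subseteq> biset_classes C D \<and> a = G.cs p)"
  unfolding groth_group_eq by (rule G.carrier_Q_iff)

lemma groth_class_cong: "biset C D \<Omega> \<Longrightarrow> biset_iso C D \<Omega> \<Omega>' \<Longrightarrow> groth_class C D \<Omega> = groth_class C D \<Omega>'"
  unfolding groth_class_def by (simp add: biset_class_cong)

text \<open>The relators mention only \<open>nat\<close>-valued bisets, so both arguments are
  replaced by copies before a relator is used.\<close>

lemma groth_class_union:
  assumes "biset C D \<Omega>" "biset C D \<Psi>"
  shows "groth_class C D (biset_union \<Omega> \<Psi>) = groth_class C D \<Omega> \<otimes>\<^bsub>groth_group C D\<^esub> groth_class C D \<Psi>"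
proof -
  obtain \<Omega>' where \<Omega>': "biset C D (\<Omega>' :: ('o, 'a, 'p, 'b, nat) biset)" "biset_iso C D \<Omega> \<Omega>'"
    using biset_nat_copy[OF assms(1)] .
  obtain \<Psi>' where \<Psi>': "biset C D (\<Psi>' :: ('o, 'a, 'p, 'b, nat) biset)" "biset_iso C D \<Psi> \<Psi>'"
    using biset_nat_copy[OF assms(2)] .
  have "frag_of (biset_class C D (biset_union \<Omega>' \<Psi>')) - frag_of (biset_class C D \<Omega>')
      - frag_of (biset_class C D \<Psi>') \<in> G.N"
    using \<Omega>' \<Psi>' by (intro G.Rel_in_N) (auto simp: union_relators_def is_biset_iff)
  moreover have "Poly_Mapping.keys (frag_of (biset_class C D \<Omega>') + frag_of (biset_class C D \<Psi>')) \<subseteq> biset_classes C D"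
    using \<Omega>' \<Psi>' keys_add[of "frag_of (biset_class C D \<Omega>')" "frag_of (biset_class C D \<Psi>')"]
    by (auto dest: biset_class_in)
  ultimately have "groth_class C D (biset_union \<Omega>' \<Psi>') = groth_class C D \<Omega>' \<otimes>\<^bsub>groth_group C D\<^esub> groth_class C D \<Psi>'"
    using \<Omega>' \<Psi>' unfolding groth_class_eq groth_group_eq
    by (subst G.mult_cs) (auto simp: G.cs_eq_iff biset_class_in biset_biset_union algebra_simps)
  then show ?thesis
    using groth_class_cong[OF assms(1) \<Omega>'(2)] groth_class_cong[OF assms(2) \<Psi>'(2)]
      groth_class_cong[OF biset_biset_union[OF assms] biset_iso_union[OF assms \<Omega>'(2) \<Psi>'(2)]] by simp
qed

text \<open>The union of two \<open>nat\<close>-valued bisets takes values in a sum type, to which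
  \<phi> does not apply. Additivity is therefore expressed through any \<open>nat\<close>-valued
  \<Gamma> isomorphic to the union.\<close>

lemma groth_lift:
  fixes \<phi> :: "('o, 'a, 'p, 'b, nat) biset \<Rightarrow> 'h"
  assumes H: "comm_group H" and closed: "\<And>\<Omega>. biset C D \<Omega> \<Longrightarrow> \<phi> \<Omega> \<in> carrier H"
    and iso: "\<And>\<Omega> \<Omega>'. biset C D \<Omega> \<Longrightarrow> biset C D \<Omega>' \<Longrightarrow> biset_iso C D \<Omega> \<Omega>' \<Longrightarrow> \<phi> \<Omega> = \<phi> \<Omega>'"
    and union: "\<And>\<Omega> \<Psi> \<Gamma>. biset C D \<Omega> \<Longrightarrow> biset C D \<Psi> \<Longrightarrow> biset C D \<Gamma>
      \<Longrightarrow> biset_iso C D (biset_union \<Omega> \<Psi>) \<Gamma> \<Longrightarrow> \<phi> \<Gamma> = \<phi> \<Omega> \<otimes>\<^bsub>H\<^esub> \<phi> \<Psi>"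
  obtains \<psi> where "\<psi> \<in> hom (groth_group C D) H" "\<And>\<Omega>. biset C D \<Omega> \<Longrightarrow> \<psi> (groth_class C D \<Omega>) = \<phi> \<Omega>"
proof -
  \<comment> \<open>A class is evaluated at a chosen \<open>nat\<close>-valued biset of that class.
    Since a biset belongs to its own class, equality of classes returns an isomorphism, and
    \<open>iso\<close> makes the choice immaterial.\<close>
  define h where "h K = \<phi> (SOME \<Omega>. biset C D \<Omega> \<and> biset_class C D \<Omega> = K)" for K
  have h: "h (biset_class C D \<Omega>) = \<phi> \<Omega>" if \<Omega>: "biset C D \<Omega>" for \<Omega>
  proof -
    let ?P = "\<lambda>\<Omega>' :: ('o, 'a, 'p, 'b, nat) biset. biset C D \<Omega>' \<and> biset_class C D \<Omega>' = biset_class C D \<Omega>"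
    define \<Omega>' where "\<Omega>' = (SOME \<Omega>'. ?P \<Omega>')"
    have "?P \<Omega>'"
      unfolding \<Omega>'_def using \<Omega> by (intro someI[of ?P \<Omega>]) simp
    moreover have "\<Omega> \<in> biset_class C D \<Omega>"
      using \<Omega> by (simp add: biset_class_def is_biset_iff naturally_iso_refl)
    ultimately have "biset C D \<Omega>'" "biset_iso C D \<Omega>' \<Omega>"
      by (auto simp: biset_class_def)
    then have "\<phi> \<Omega>' = \<phi> \<Omega>" using \<Omega> by (intro iso)
    then show ?thesis by (simp add: h_def \<Omega>'_def)
  qed
  obtain f where f: "f \<in> hom G.Q H" "\<And>s. s \<in> biset_classes C D \<Longrightarrow> f (G.cs (frag_of s)) = h s"
  proof (rule G.lift[OF H])
    show "h ` biset_classes C D \<subseteq> carrier H"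
      by (auto simp: biset_classes_def is_biset_iff h closed)
    fix k c assume k: "group_hom G.F H k" "\<And>s. s \<in> biset_classes C D \<Longrightarrow> k (frag_of s) = h s"
      and "c \<in> union_relators C D"
    then obtain \<Omega> \<Psi> :: "('o, 'a, 'p, 'b, nat) biset" where 1: "biset C D \<Omega>" "biset C D \<Psi>"
      and c: "c = frag_of (biset_class C D (biset_union \<Omega> \<Psi>)) - frag_of (biset_class C D \<Omega>)
        - frag_of (biset_class C D \<Psi>)"
      by (auto simp: union_relators_def is_biset_iff)
    obtain \<Gamma> where \<Gamma>: "biset C D (\<Gamma> :: ('o, 'a, 'p, 'b, nat) biset)" "biset_iso C D (biset_union \<Omega> \<Psi>) \<Gamma>"
      using biset_nat_copy[OF biset_biset_union[OF 1]] .
    show "k c = \<one>\<^bsub>H\<^esub>"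
      unfolding c biset_class_cong[OF biset_biset_union[OF 1] \<Gamma>(2)]
      using 1 \<Gamma>(1) union[OF 1 \<Gamma>]
      by (intro group_hom_free_relator[OF k(1) _ _ H]) (simp_all add: k(2) h biset_class_in)
  qed (rule that, simp_all)
  show thesis
  proof (rule that)
    show "f \<in> hom (groth_group C D) H"
      using f(1) by (simp add: groth_group_eq)
    show "f (groth_class C D \<Omega>) = \<phi> \<Omega>" if "biset C D \<Omega>" for \<Omega>
      unfolding groth_class_eq using that by (simp add: f(2) biset_class_in h)
  qed
qed

end

section \<open>Linear and bilinear maps on modules of morphisms\<close>

lemma linear_mapD:
  assumes "linear_map R M N f"
  shows "x \<in> carrier M \<Longrightarrow> f x \<in> carrier N"
    and "x \<in> carrier M \<Longrightarrow> y \<in> carrier M \<Longrightarrow> f (x \<oplus>\<^bsub>M\<^esub> y) = f x \<oplus>\<^bsub>N\<^esub> f y"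
    and "r \<in> carrier R \<Longrightarrow> x \<in> carrier M \<Longrightarrow> f (r \<odot>\<^bsub>M\<^esub> x) = r \<odot>\<^bsub>N\<^esub> f x"
  using assms by (auto simp: linear_map_def)

lemma linear_map_id: "linear_map R M M (\<lambda>x. x)"
  by (simp add: linear_map_def)

lemma linear_map_compose:
  "linear_map R M N f \<Longrightarrow> linear_map R N P g \<Longrightarrow> linear_map R M P (\<lambda>x. g (f x))"
  by (auto simp: linear_map_def Pi_iff)

lemma linear_map_add:
  assumes "module R N" "linear_map R M N f" "linear_map R M N g"
  shows "linear_map R M N (\<lambda>x. f x \<oplus>\<^bsub>N\<^esub> g x)"
proof -
  interpret N: module R N by fact
  show ?thesis
    using assms(2,3) by (auto simp: linear_map_def N.smult_r_distr Pi_iff N.add.m_ac)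
qed

lemma linear_map_smult:
  assumes "module R N" "linear_map R M N f" "r \<in> carrier R"
  shows "linear_map R M N (\<lambda>x. r \<odot>\<^bsub>N\<^esub> f x)"
proof -
  interpret N: module R N by fact
  show ?thesis
    using assms(2,3)
    by (auto simp: linear_map_def N.smult_r_distr Pi_iff N.smult_assoc1[symmetric] N.R.m_comm)
qed

locale scalars = R?: cring R for R :: "('r, 'm) ring_scheme" (structure)
begin

lemma scalar_ext_groth:
  assumes "category C" "category D"
  shows "scalar_ext R (groth_group D C)"
proof -
  interpret category_pair D C using assms by (simp add: category_pair_def)
  show ?thesis
    by (intro scalar_ext.intro is_cring comm_group_groth)
qed

lemma module_B_Hom: "category C \<Longrightarrow> category D \<Longrightarrow> module R (B_Hom R C D)"
  unfolding B_Hom_def by (intro scalar_ext.module_M scalar_ext_groth)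

lemma B_class_closed:
  assumes "biset D C \<Omega>"
  shows "B_class R C D \<Omega> \<in> carrier (B_Hom R C D)"
proof -
  interpret biset D C \<Omega> by fact
  interpret category_pair D C ..
  show ?thesis
    unfolding B_class_def B_Hom_def
    by (intro scalar_ext.st_closed[OF scalar_ext_groth] D.category_axioms C.category_axioms
        groth_class_closed assms one_closed)
qed

lemma B_class_cong:
  assumes "biset D C \<Omega>" "biset_iso D C \<Omega> \<Omega>'"
  shows "B_class R C D \<Omega> = B_class R C D \<Omega>'"
  unfolding B_class_def groth_class_def by (simp add: biset_class_cong[OF assms])

lemma B_class_union:
  assumes "biset D C \<Omega>" "biset D C \<Psi>"
  shows "B_class R C D (biset_union \<Omega> \<Psi>) = B_class R C D \<Omega> \<oplus>\<^bsub>B_Hom R C D\<^esub> B_class R C D \<Psi>"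
proof -
  interpret biset D C \<Omega> by fact
  interpret category_pair D C ..
  show ?thesis
    unfolding B_class_def B_Hom_def groth_class_union[OF assms]
    by (intro scalar_ext.st_mult[OF scalar_ext_groth] D.category_axioms C.category_axioms
        groth_class_closed assms one_closed)
qed

text \<open>Classes of \<open>nat\<close>-valued bisets generate the module under addition and
  scalars. Zero and differences, which the presentation of the Grothendieck group requires, are
  expressed by the scalars \<open>\<zero>\<close> and \<open>\<ominus> \<one>\<close>.\<close>

lemma B_Hom_induct [consumes 3, case_names cls add smult]:
  assumes "category C" "category D" and x: "x \<in> carrier (B_Hom R C D)"
    and cls: "\<And>\<Omega> :: ('p, 'b, 'o, 'a, nat) biset. biset D C \<Omega> \<Longrightarrow> P (B_class R C D \<Omega>)"
    and add: "\<And>x y. x \<in> carrier (B_Hom R C D) \<Longrightarrow> y \<in> carrier (B_Hom R C D) \<Longrightarrow> P x \<Longrightarrow> P y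
      \<Longrightarrow> P (x \<oplus>\<^bsub>B_Hom R C D\<^esub> y)"
    and smult: "\<And>r x. r \<in> carrier R \<Longrightarrow> x \<in> carrier (B_Hom R C D) \<Longrightarrow> P x \<Longrightarrow> P (r \<odot>\<^bsub>B_Hom R C D\<^esub> x)"
  shows "P x"
proof -
  interpret category_pair D C using assms by (simp add: category_pair_def)
  interpret S: scalar_ext R "groth_group D C" by (rule scalar_ext_groth[OF assms(1,2)])
  interpret M: module R S.M by (rule S.module_M)
  have unit: "P (S.st \<one> a)" if "a \<in> carrier (groth_group D C)" for a
  proof -
    from that have "\<exists>p. Poly_Mapping.keys p \<subseteq> biset_classes D C \<and> a = G.cs p"
      by (rule groth_carrier_iff[THEN iffD1])
    then obtain p where p: "Poly_Mapping.keys p \<subseteq> biset_classes D C" "a = G.cs p"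
      by (elim exE conjE)
    have closed: "G.cs q \<in> carrier (groth_group D C)" if "Poly_Mapping.keys q \<subseteq> biset_classes D C" for q
      unfolding groth_carrier_iff by (rule exI[of _ q]) (simp add: that)
    have "P (S.st \<one> (G.cs p))"
      using p(1)
    proof (induction p rule: free_Abelian_induct)
      case zero
      \<comment> \<open>The image of the neutral element is idempotent under addition, hence zero.
        To reach it from a class it is written as the zero scalar times the class of the empty
        biset.\<close>
      have "S.st \<one> (G.cs 0) \<oplus>\<^bsub>S.M\<^esub> S.st \<one> (G.cs 0) = S.st \<one> (G.cs 0)"
        using S.st_mult[of \<one> "G.cs 0" "G.cs 0"] G.mult_cs[of 0 0] closed[of 0] by (simp add: groth_group_eq)
      then have "S.st \<one> (G.cs 0) = \<zero>\<^bsub>S.M\<^esub>"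
        using M.add.r_cancel_one[of "S.st \<one> (G.cs 0)" "S.st \<one> (G.cs 0)"]
          S.st_closed[OF one_closed closed[of 0]] by simp
      moreover define \<Omega> :: "('p, 'b, 'o, 'a, nat) biset" where "\<Omega> = \<lparr>fobj = (\<lambda>_. {}), fmor = (\<lambda>_ u. u)\<rparr>"
      have "biset D C \<Omega>" by unfold_locales (auto simp: \<Omega>_def)
      ultimately show ?case
        using smult[OF zero_closed B_class_closed[of D C \<Omega>] cls[of \<Omega>]]
          M.smult_l_null[of "B_class R C D \<Omega>"] B_class_closed[of D C \<Omega>]
        unfolding B_Hom_def by simp
    next
      case (diff x y)
      have keys: "Poly_Mapping.keys (x - y) \<subseteq> biset_classes D C"
        using diff(1,2) keys_diff[of x y] by blast
      note closed' = closed[OF keys] closed[OF diff(1)] closed[OF diff(2)]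
      note st_closed = closed'[THEN S.st_closed[OF one_closed]]
      have "S.st \<one> (G.cs x) = S.st \<one> (G.cs (x - y)) \<oplus>\<^bsub>S.M\<^esub> S.st \<one> (G.cs y)"
        using S.st_mult[OF one_closed closed'(1,3)] G.mult_cs[OF keys diff(2)]
        by (simp add: groth_group_eq)
      then have "S.st \<one> (G.cs (x - y)) = S.st \<one> (G.cs x) \<oplus>\<^bsub>S.M\<^esub> \<ominus>\<^bsub>S.M\<^esub> S.st \<one> (G.cs y)"
        using M.add.inv_solve_right[OF st_closed] by blast
      also have "\<ominus>\<^bsub>S.M\<^esub> S.st \<one> (G.cs y) = (\<ominus> \<one>) \<odot>\<^bsub>S.M\<^esub> S.st \<one> (G.cs y)"
        using M.smult_l_minus[OF one_closed st_closed(3)] M.smult_one[OF st_closed(3)] by simp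
      finally have eq: "S.st \<one> (G.cs (x - y))
        = S.st \<one> (G.cs x) \<oplus>\<^bsub>S.M\<^esub> (\<ominus> \<one>) \<odot>\<^bsub>S.M\<^esub> S.st \<one> (G.cs y)" .
      have "\<ominus> \<one> \<in> carrier R" by simp
      then show ?case
        unfolding eq using diff(3,4) st_closed(2,3)
        by (intro add[unfolded B_Hom_def] smult[unfolded B_Hom_def] M.smult_closed)
    next
      case (gen K)
      then obtain \<Omega> :: "('p, 'b, 'o, 'a, nat) biset" where "biset D C \<Omega>" "K = biset_class D C \<Omega>"
        by (auto simp: biset_classes_def is_biset_iff)
      then show ?case
        using cls[of \<Omega>] by (simp add: B_class_def groth_class_eq)
    qed
    with p show ?thesis by simp
  qed
  from x have "x \<in> carrier S.M" by (simp add: B_Hom_def)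
  then show ?thesis
  proof (induction x rule: S.M_induct)
    case (tensor r a)
    then show ?case
      using smult[unfolded B_Hom_def, of r "S.st \<one> a"] unit[of a] S.st_closed[of \<one> a]
        S.smult_st[of r \<one> a] by simp
  next
    case (add x y)
    then show ?case using assms(5)[unfolded B_Hom_def] by blast
  qed
qed

lemma B_Hom_eqI:
  assumes "category C" "category D" "linear_map R (B_Hom R C D) N f" "linear_map R (B_Hom R C D) N g"
    and "\<And>\<Omega> :: ('p, 'b, 'o, 'a, nat) biset. biset D C \<Omega> \<Longrightarrow> f (B_class R C D \<Omega>) = g (B_class R C D \<Omega>)"
    and "x \<in> carrier (B_Hom R C D)"
  shows "f x = g x"
  using assms(1,2,6)
  by (induction x rule: B_Hom_induct)
    (simp_all add: assms(5) linear_mapD[OF assms(3)] linear_mapD[OF assms(4)])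

text \<open>Two universal properties in succession: isomorphism invariance and additivity on unions
  give a homomorphism on the Grothendieck group, which then extends linearly over
  \<open>R\<close>.\<close>

lemma B_Hom_extend:
  fixes \<phi> :: "('p, 'b, 'o, 'a, nat) biset \<Rightarrow> 'n"
  assumes "category C" "category D" and N: "module R N"
    and closed: "\<And>\<Omega>. biset D C \<Omega> \<Longrightarrow> \<phi> \<Omega> \<in> carrier N"
    and iso: "\<And>\<Omega> \<Omega>'. biset D C \<Omega> \<Longrightarrow> biset D C \<Omega>' \<Longrightarrow> biset_iso D C \<Omega> \<Omega>' \<Longrightarrow> \<phi> \<Omega> = \<phi> \<Omega>'"
    and union: "\<And>\<Omega> \<Psi> \<Gamma>. biset D C \<Omega> \<Longrightarrow> biset D C \<Psi> \<Longrightarrow> biset D C \<Gamma>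
      \<Longrightarrow> biset_iso D C (biset_union \<Omega> \<Psi>) \<Gamma> \<Longrightarrow> \<phi> \<Gamma> = \<phi> \<Omega> \<oplus>\<^bsub>N\<^esub> \<phi> \<Psi>"
  shows "\<exists>f. linear_map R (B_Hom R C D) N f \<and> (\<forall>\<Omega>. biset D C \<Omega> \<longrightarrow> f (B_class R C D \<Omega>) = \<phi> \<Omega>)"
proof -
  interpret category_pair D C using assms by (simp add: category_pair_def)
  interpret S: scalar_ext R "groth_group D C" by (rule scalar_ext_groth[OF assms(1,2)])
  interpret N: module R N by fact
  obtain \<psi> where \<psi>: "\<psi> \<in> hom (groth_group D C) (add_monoid N)"
    "\<And>\<Omega>. biset D C \<Omega> \<Longrightarrow> \<psi> (groth_class D C \<Omega>) = \<phi> \<Omega>"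
    by (rule groth_lift[of "add_monoid N" \<phi>]) (use closed iso union N.a_comm_group in auto)
  obtain f where f: "linear_map R S.M N f"
    "\<And>r a. r \<in> carrier R \<Longrightarrow> a \<in> carrier (groth_group D C) \<Longrightarrow> f (S.st r a) = r \<odot>\<^bsub>N\<^esub> \<psi> a"
    by (rule S.M_lift[OF N \<psi>(1)]) (rule that, simp_all)
  show ?thesis
  proof (intro exI conjI allI impI)
    show "linear_map R (B_Hom R C D) N f"
      using f(1) by (simp only: B_Hom_def)
    fix \<Omega> :: "('p, 'b, 'o, 'a, nat) biset" assume \<Omega>: "biset D C \<Omega>"
    show "f (B_class R C D \<Omega>) = \<phi> \<Omega>"
      unfolding B_class_def
      by (simp only: f(2) one_closed groth_class_closed[OF \<Omega>] \<psi>(2)[OF \<Omega>] closed[OF \<Omega>] N.smult_one)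
  qed
qed

text \<open>The extension is made one variable at a time. The union hypotheses are equations between
  classes because \<open>T \<Gamma> \<Psi>\<close> is compared with a union through an intermediate
  biset, by two isomorphisms.\<close>

lemma bilinear_extend:
  fixes T :: "('p1, 'b1, 'o1, 'a1, nat) biset \<Rightarrow> ('p2, 'b2, 'o2, 'a2, nat) biset \<Rightarrow> ('p, 'b, 'o, 'a, 'x) biset"
  assumes cats: "category C1" "category D1" "category C2" "category D2" "category C" "category D"
    and closed: "\<And>\<Omega> \<Psi>. biset D1 C1 \<Omega> \<Longrightarrow> biset D2 C2 \<Psi> \<Longrightarrow> biset D C (T \<Omega> \<Psi>)"
    and iso: "\<And>\<Omega> \<Psi> \<Omega>' \<Psi>'. biset D1 C1 \<Omega> \<Longrightarrow> biset D2 C2 \<Psi> \<Longrightarrow> biset D1 C1 \<Omega>' \<Longrightarrow> biset D2 C2 \<Psi>'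
      \<Longrightarrow> biset_iso D1 C1 \<Omega> \<Omega>' \<Longrightarrow> biset_iso D2 C2 \<Psi> \<Psi>' \<Longrightarrow> biset_iso D C (T \<Omega> \<Psi>) (T \<Omega>' \<Psi>')"
    and union_left: "\<And>\<Omega> \<Omega>' \<Gamma> \<Psi>. biset D1 C1 \<Omega> \<Longrightarrow> biset D1 C1 \<Omega>' \<Longrightarrow> biset D1 C1 \<Gamma> \<Longrightarrow> biset D2 C2 \<Psi>
      \<Longrightarrow> biset_iso D1 C1 (biset_union \<Omega> \<Omega>') \<Gamma>
      \<Longrightarrow> B_class R C D (T \<Gamma> \<Psi>) = B_class R C D (biset_union (T \<Omega> \<Psi>) (T \<Omega>' \<Psi>))"
    and union_right: "\<And>\<Omega> \<Psi> \<Psi>' \<Gamma>. biset D1 C1 \<Omega> \<Longrightarrow> biset D2 C2 \<Psi> \<Longrightarrow> biset D2 C2 \<Psi>' \<Longrightarrow> biset D2 C2 \<Gamma>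
      \<Longrightarrow> biset_iso D2 C2 (biset_union \<Psi> \<Psi>') \<Gamma>
      \<Longrightarrow> B_class R C D (T \<Omega> \<Gamma>) = B_class R C D (biset_union (T \<Omega> \<Psi>) (T \<Omega> \<Psi>'))"
  shows "\<exists>b. bilinear_map R (B_Hom R C1 D1) (B_Hom R C2 D2) (B_Hom R C D) b \<and>
     (\<forall>\<Omega> \<Psi>. biset D1 C1 \<Omega> \<longrightarrow> biset D2 C2 \<Psi> \<longrightarrow>
        b (B_class R C1 D1 \<Omega>) (B_class R C2 D2 \<Psi>) = B_class R C D (T \<Omega> \<Psi>))"
proof -
  let ?M1 = "B_Hom R C1 D1" and ?M2 = "B_Hom R C2 D2" and ?N = "B_Hom R C D"
  note N = module_B_Hom[OF cats(5,6)]
  interpret M2: module R ?M2 by (rule module_B_Hom[OF cats(3,4)])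
  have cong: "B_class R C D (T \<Omega> \<Psi>) = B_class R C D (T \<Omega>' \<Psi>')"
    if "biset D1 C1 \<Omega>" "biset D2 C2 \<Psi>" "biset D1 C1 \<Omega>'" "biset D2 C2 \<Psi>'"
      "biset_iso D1 C1 \<Omega> \<Omega>'" "biset_iso D2 C2 \<Psi> \<Psi>'" for \<Omega> \<Psi> \<Omega>' \<Psi>'
    using that by (intro B_class_cong closed iso)
  have "\<exists>f. linear_map R ?M2 ?N f \<and> (\<forall>\<Psi>. biset D2 C2 \<Psi> \<longrightarrow> f (B_class R C2 D2 \<Psi>) = B_class R C D (T \<Omega> \<Psi>))"
    if \<Omega>: "biset D1 C1 \<Omega>" for \<Omega>
    using \<Omega> by (intro B_Hom_extend cats N cong naturally_iso_refl)
      (simp_all add: union_right B_class_union closed B_class_closed)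
  then obtain F where F: "\<And>\<Omega>. biset D1 C1 \<Omega> \<Longrightarrow> linear_map R ?M2 ?N (F \<Omega>)"
    "\<And>\<Omega> \<Psi>. biset D1 C1 \<Omega> \<Longrightarrow> biset D2 C2 \<Psi> \<Longrightarrow> F \<Omega> (B_class R C2 D2 \<Psi>) = B_class R C D (T \<Omega> \<Psi>)"
    by metis
  \<comment> \<open>With \<open>y\<close> fixed, \<open>F \<Omega> y\<close> has to be invariant and
    additive in \<Omega>. Both are equations between linear maps in \<open>y\<close>, so they are
    checked when \<open>y\<close> is a class, where they reduce to the hypotheses on
    \<open>T\<close>.\<close>
  have "\<exists>g. linear_map R ?M1 ?N g \<and> (\<forall>\<Omega>. biset D1 C1 \<Omega> \<longrightarrow> g (B_class R C1 D1 \<Omega>) = F \<Omega> y)"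
    if y: "y \<in> carrier ?M2" for y
  proof (rule B_Hom_extend[OF cats(1,2) N])
    show "F \<Omega> y \<in> carrier ?N" if "biset D1 C1 \<Omega>" for \<Omega>
      using linear_mapD(1)[OF F(1)[OF that] y] .
  next
    fix \<Omega> \<Omega>' :: "('p1, 'b1, 'o1, 'a1, nat) biset"
    assume *: "biset D1 C1 \<Omega>" "biset D1 C1 \<Omega>'" "biset_iso D1 C1 \<Omega> \<Omega>'"
    show "F \<Omega> y = F \<Omega>' y"
      by (rule B_Hom_eqI[OF cats(3,4) F(1) F(1) _ y])
        (use * in \<open>simp_all add: F(2) cong[OF _ _ _ _ _ naturally_iso_refl]\<close>)
  next
    fix \<Omega> \<Omega>' \<Gamma> :: "('p1, 'b1, 'o1, 'a1, nat) biset"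
    assume *: "biset D1 C1 \<Omega>" "biset D1 C1 \<Omega>'" "biset D1 C1 \<Gamma>" "biset_iso D1 C1 (biset_union \<Omega> \<Omega>') \<Gamma>"
    show "F \<Gamma> y = F \<Omega> y \<oplus>\<^bsub>?N\<^esub> F \<Omega>' y"
      by (rule B_Hom_eqI[OF cats(3,4) F(1) linear_map_add[OF N F(1) F(1)] _ y])
        (use * in \<open>simp_all add: F(2) union_left[OF *(1,2,3) _ *(4)] B_class_union closed\<close>)
  qed
  then obtain G where G: "\<And>y. y \<in> carrier ?M2 \<Longrightarrow> linear_map R ?M1 ?N (G y)"
    "\<And>y \<Omega>. y \<in> carrier ?M2 \<Longrightarrow> biset D1 C1 \<Omega> \<Longrightarrow> G y (B_class R C1 D1 \<Omega>) = F \<Omega> y"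
    by metis
  \<comment> \<open>The functions \<open>G y\<close> were chosen separately for each
    \<open>y\<close>. Linearity in \<open>y\<close> is recovered by comparing linear maps in
    \<open>x\<close>: on classes \<open>G y\<close> is \<open>F \<Omega> y\<close>, which is linear
    in \<open>y\<close>.\<close>
  have "linear_map R ?M2 ?N (\<lambda>y. G y x)" if x: "x \<in> carrier ?M1" for x
    unfolding linear_map_def
  proof (intro conjI ballI funcsetI)
    fix y assume y: "y \<in> carrier ?M2"
    show "G y x \<in> carrier ?N"
      using linear_mapD(1)[OF G(1)[OF y] x] .
    show "G (y \<oplus>\<^bsub>?M2\<^esub> y') x = G y x \<oplus>\<^bsub>?N\<^esub> G y' x" if y': "y' \<in> carrier ?M2" for y'
      by (rule B_Hom_eqI[OF cats(1,2) G(1) linear_map_add[OF N G(1) G(1)] _ x])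
        (use y y' in \<open>simp_all add: G(2) linear_mapD[OF F(1)]\<close>)
    show "G (r \<odot>\<^bsub>?M2\<^esub> y) x = r \<odot>\<^bsub>?N\<^esub> G y x" if r: "r \<in> carrier R" for r
      by (rule B_Hom_eqI[OF cats(1,2) G(1) linear_map_smult[OF N G(1)] _ x])
        (use y r in \<open>simp_all add: G(2) linear_mapD[OF F(1)]\<close>)
  qed
  then have "bilinear_map R ?M1 ?M2 ?N (\<lambda>x y. G y x)"
    using G(1) by (simp add: bilinear_map_def)
  then show ?thesis
    by (intro exI[of _ "\<lambda>x y. G y x"]) (simp add: G(2) F(2) B_class_closed)
qed

text \<open>Stated with a linear map already substituted in one argument, so that linearity of a
  nested expression in any one of its variables follows by repeated application of rules.\<close>

lemma bilinear_map_rules: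
  assumes b: "bilinear_map R (B_Hom R C1 D1) (B_Hom R C2 D2) (B_Hom R C D) b"
  shows "linear_map R X (B_Hom R C1 D1) f \<Longrightarrow> y \<in> carrier (B_Hom R C2 D2) \<Longrightarrow> linear_map R X (B_Hom R C D) (\<lambda>x. b (f x) y)"
    and "x \<in> carrier (B_Hom R C1 D1) \<Longrightarrow> linear_map R X (B_Hom R C2 D2) g \<Longrightarrow> linear_map R X (B_Hom R C D) (\<lambda>y. b x (g y))"
    and "x \<in> carrier (B_Hom R C1 D1) \<Longrightarrow> y \<in> carrier (B_Hom R C2 D2) \<Longrightarrow> b x y \<in> carrier (B_Hom R C D)"
proof -
  have 1: "linear_map R (B_Hom R C1 D1) (B_Hom R C D) (\<lambda>x. b x y)" if "y \<in> carrier (B_Hom R C2 D2)" for y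
    using b that by (simp add: bilinear_map_def)
  have 2: "linear_map R (B_Hom R C2 D2) (B_Hom R C D) (b x)" if "x \<in> carrier (B_Hom R C1 D1)" for x
    using b that by (simp add: bilinear_map_def)
  show "linear_map R X (B_Hom R C D) (\<lambda>x. b (f x) y)"
    if "linear_map R X (B_Hom R C1 D1) f" "y \<in> carrier (B_Hom R C2 D2)"
    by (rule linear_map_compose[OF that(1) 1[OF that(2)]])
  show "linear_map R X (B_Hom R C D) (\<lambda>y. b x (g y))"
    if "x \<in> carrier (B_Hom R C1 D1)" "linear_map R X (B_Hom R C2 D2) g"
    by (rule linear_map_compose[OF that(2) 2[OF that(1)]])
  show "b x y \<in> carrier (B_Hom R C D)"
    if "x \<in> carrier (B_Hom R C1 D1)" "y \<in> carrier (B_Hom R C2 D2)"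
    by (rule linear_mapD(1)[OF 2[OF that(1)] that(2)])
qed

end

section \<open>The structure maps on classes of bisets\<close>

lemmas fin_cats = finite_category_prod_cat finite_category_op_cat

text \<open>A linear extension obtained by choice, in the style of \<open>B_tau\<close>; existence
  for both is an instance of \<open>reindex_extend\<close>.\<close>

definition B_curry ::
  "('r, 'm) ring_scheme \<Rightarrow> ('o, 'a) cat \<Rightarrow> ('p, 'b) cat \<Rightarrow> ('q, 'c) cat
    \<Rightarrow> ('r, 'o \<times> 'p, 'a \<times> 'b, 'q, 'c) B_elt \<Rightarrow> ('r, 'p, 'b, 'q \<times> 'o, 'c \<times> 'a) B_elt" where
  "B_curry R C D E = (SOME t.
     linear_map R (B_Hom R (prod_cat C D) E) (B_Hom R D (prod_cat E (op_cat C))) t \<and>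
     (\<forall>\<Omega> :: ('q, 'c, 'o \<times> 'p, 'a \<times> 'b, nat) biset. is_biset E (prod_cat C D) \<Omega> \<longrightarrow>
        t (B_class R (prod_cat C D) E \<Omega>)
          = B_class R D (prod_cat E (op_cat C)) (reindex assocr assocr \<Omega>)))"

lemma biset_biset_op:
  assumes "biset C D \<Omega>"
  shows "biset (op_cat D) (op_cat C) (biset_op \<Omega>)"
proof -
  interpret biset C D \<Omega> by fact
  show ?thesis
    unfolding biset_op_eq_reindex
    by (intro biset_reindex[OF assms] category_op_cat is_functor_swap C.category_axioms D.category_axioms)
qed

context scalars
begin

text \<open>Precomposition preserves isomorphisms and commutes with unions on the nose, so it
  extends linearly. It provides the duality map, currying, and the inverse of currying.\<close>

lemma reindex_extend:
  assumes cats: "category C" "category D" "category C'" "category D'"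
    and J: "is_functor (prod_cat D' (op_cat C')) (prod_cat D (op_cat C)) j J"
  shows "\<exists>t. linear_map R (B_Hom R C D) (B_Hom R C' D') t \<and>
    (\<forall>\<Omega> :: ('p, 'b, 'o, 'a, nat) biset. is_biset D C \<Omega> \<longrightarrow>
       t (B_class R C D \<Omega>) = B_class R C' D' (reindex j J \<Omega>))"
proof -
  have cat: "category (prod_cat D' (op_cat C'))"
    by (intro category_prod_cat category_op_cat cats)
  have "\<exists>t. linear_map R (B_Hom R C D) (B_Hom R C' D') t \<and>
    (\<forall>\<Omega> :: ('p, 'b, 'o, 'a, nat) biset. biset D C \<Omega> \<longrightarrow>
       t (B_class R C D \<Omega>) = B_class R C' D' (reindex j J \<Omega>))"
  proof (rule B_Hom_extend[OF cats(1,2) module_B_Hom[OF cats(3,4)]])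
    fix \<Omega> \<Omega>' :: "('p, 'b, 'o, 'a, nat) biset"
    assume *: "biset D C \<Omega>"
    then show "B_class R C' D' (reindex j J \<Omega>) \<in> carrier (B_Hom R C' D')"
      by (intro B_class_closed biset_reindex[OF _ cats(4,3) J])
    assume "biset_iso D C \<Omega> \<Omega>'"
    with * show "B_class R C' D' (reindex j J \<Omega>) = B_class R C' D' (reindex j J \<Omega>')"
      by (intro B_class_cong biset_reindex[OF _ cats(4,3) J] naturally_iso_reindex[OF _ cat J])
  next
    fix \<Omega> \<Psi> \<Gamma> :: "('p, 'b, 'o, 'a, nat) biset"
    assume *: "biset D C \<Omega>" "biset D C \<Psi>" "biset_iso D C (biset_union \<Omega> \<Psi>) \<Gamma>"
    note bi = biset_reindex[OF _ cats(4,3) J]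
    have "B_class R C' D' (reindex j J \<Gamma>) = B_class R C' D' (reindex j J (biset_union \<Omega> \<Psi>))"
      by (intro B_class_cong[symmetric] bi biset_biset_union naturally_iso_reindex[OF _ cat J] *)
    then show "B_class R C' D' (reindex j J \<Gamma>)
      = B_class R C' D' (reindex j J \<Omega>) \<oplus>\<^bsub>B_Hom R C' D'\<^esub> B_class R C' D' (reindex j J \<Psi>)"
      using B_class_union[OF bi[OF *(1)] bi[OF *(2)]] by (simp add: reindex_biset_union)
  qed
  then show ?thesis
    by (simp add: biset_iff_is_biset[OF cats(2,1)])
qed

text \<open>The specification of such a map speaks of \<open>nat\<close>-valued bisets, whereas it
  will be applied to products and composites; a \<open>nat\<close>-valued copy bridges the
  gap.\<close>

lemma reindex_class:
  fixes \<Omega> :: "('p, 'b, 'o, 'a, 'x) biset"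
  assumes "category C'" "category D'" "is_functor (prod_cat D' (op_cat C')) (prod_cat D (op_cat C)) j J"
    and t: "\<And>\<Omega> :: ('p, 'b, 'o, 'a, nat) biset. is_biset D C \<Omega>
      \<Longrightarrow> t (B_class R C D \<Omega>) = B_class R C' D' (reindex j J \<Omega>)"
    and \<Omega>: "biset D C \<Omega>"
  shows "t (B_class R C D \<Omega>) = B_class R C' D' (reindex j J \<Omega>)"
proof -
  obtain \<Omega>' where \<Omega>': "biset D C (\<Omega>' :: ('p, 'b, 'o, 'a, nat) biset)" "biset_iso D C \<Omega> \<Omega>'"
    using biset_nat_copy[OF \<Omega>] .
  have "B_class R C' D' (reindex j J \<Omega>) = B_class R C' D' (reindex j J \<Omega>')"
    by (intro B_class_cong biset_reindex[OF \<Omega>] naturally_iso_reindex[OF \<Omega>'(2)] category_prod_cat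
        category_op_cat assms)
  then show ?thesis
    using t[OF biset.is_biset[OF \<Omega>'(1)]] B_class_cong[OF \<Omega> \<Omega>'(2)] by simp
qed

lemma
  assumes cats: "category C" "category D"
  shows B_tau_linear: "linear_map R (B_Hom R C D) (B_Hom R (op_cat D) (op_cat C)) (B_tau R C D)"
    and B_tau_class: "biset D C \<Omega> \<Longrightarrow>
      B_tau R C D (B_class R C D \<Omega>) = B_class R (op_cat D) (op_cat C) (biset_op \<Omega>)"
proof -
  note * = someI_ex[OF reindex_extend[OF cats category_op_cat[OF cats(2)] category_op_cat[OF cats(1)]
        is_functor_swap], folded biset_op_eq_reindex, folded B_tau_def]
  show "linear_map R (B_Hom R C D) (B_Hom R (op_cat D) (op_cat C)) (B_tau R C D)"
    using * by blast
  show "B_tau R C D (B_class R C D \<Omega>) = B_class R (op_cat D) (op_cat C) (biset_op \<Omega>)" if "biset D C \<Omega>"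
    unfolding biset_op_eq_reindex
    by (rule reindex_class[where t = "B_tau R C D", OF category_op_cat[OF cats(2)] category_op_cat[OF cats(1)]
          is_functor_swap *[THEN conjunct2, rule_format, unfolded biset_op_eq_reindex] that])
qed

lemma
  assumes cats: "category C" "category D" "category E"
  shows B_curry_linear: "linear_map R (B_Hom R (prod_cat C D) E) (B_Hom R D (prod_cat E (op_cat C))) (B_curry R C D E)"
    and B_curry_class: "biset E (prod_cat C D) \<Omega> \<Longrightarrow>
      B_curry R C D E (B_class R (prod_cat C D) E \<Omega>)
        = B_class R D (prod_cat E (op_cat C)) (reindex assocr assocr \<Omega>)"
proof -
  note J = cat_iso.K[OF cat_iso_assoc[OF cats]]
  note * = someI_ex[OF reindex_extend[OF category_prod_cat[OF cats(1,2)] cats(3,2)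
        category_prod_cat[OF cats(3) category_op_cat[OF cats(1)]] J], folded B_curry_def]
  show "linear_map R (B_Hom R (prod_cat C D) E) (B_Hom R D (prod_cat E (op_cat C))) (B_curry R C D E)"
    using * by blast
  show "B_curry R C D E (B_class R (prod_cat C D) E \<Omega>)
      = B_class R D (prod_cat E (op_cat C)) (reindex assocr assocr \<Omega>)" if "biset E (prod_cat C D) \<Omega>"
    by (rule reindex_class[where t = "B_curry R C D E", OF cats(2) category_prod_cat[OF cats(3)
          category_op_cat[OF cats(1)]] J *[THEN conjunct2, rule_format] that])
qed

lemma B_curry_iso:
  assumes cats: "category C" "category D" "category E"
  shows "linear_iso R (B_Hom R (prod_cat C D) E) (B_Hom R D (prod_cat E (op_cat C))) (B_curry R C D E)"
proof -
  note cats' = cats category_prod_cat category_op_cat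
  note J = cat_iso.J[OF cat_iso_assoc[OF cats]]
  note K = cat_iso.K[OF cat_iso_assoc[OF cats]]
  obtain t where t: "linear_map R (B_Hom R D (prod_cat E (op_cat C))) (B_Hom R (prod_cat C D) E) t"
    and t_nat: "\<And>\<Omega> :: ('e \<times> 'a, 'f \<times> 'b, 'c, 'd, nat) biset. is_biset (prod_cat E (op_cat C)) D \<Omega> \<Longrightarrow>
      t (B_class R D (prod_cat E (op_cat C)) \<Omega>) = B_class R (prod_cat C D) E (reindex assocl assocl \<Omega>)"
    using reindex_extend[OF cats(2) category_prod_cat[OF cats(3) category_op_cat[OF cats(1)]]
        category_prod_cat[OF cats(1,2)] cats(3) J] by blast
  have t_class: "t (B_class R D (prod_cat E (op_cat C)) \<Omega>) = B_class R (prod_cat C D) E (reindex assocl assocl \<Omega>)"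
    if "biset (prod_cat E (op_cat C)) D \<Omega>" for \<Omega> :: "('e \<times> 'a, 'f \<times> 'b, 'c, 'd, nat) biset"
    using t_nat[OF biset.is_biset[OF that]] .
  \<comment> \<open>Equalities and not only isomorphisms: the two reassociations are mutually
    inverse on all triples, inside or outside the categories.\<close>
  have inv: "reindex assocl assocl (reindex assocr assocr \<Omega>) = \<Omega>"
    "reindex assocr assocr (reindex assocl assocl \<Psi>) = \<Psi>"
    for \<Omega> :: "('e, 'f, 'a \<times> 'c, 'b \<times> 'd, nat) biset" and \<Psi> :: "('e \<times> 'a, 'f \<times> 'b, 'c, 'd, nat) biset"
    by (cases \<Omega>, cases \<Psi>, auto simp: reindex_def fun_eq_iff)+
  have bisets: "biset (prod_cat E (op_cat C)) D (reindex assocr assocr \<Omega>)" if "biset E (prod_cat C D) \<Omega>"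
    for \<Omega> :: "('e, 'f, 'a \<times> 'c, 'b \<times> 'd, nat) biset"
    by (intro biset_reindex[OF that] K cats')
  have bisets': "biset E (prod_cat C D) (reindex assocl assocl \<Psi>)" if "biset (prod_cat E (op_cat C)) D \<Psi>"
    for \<Psi> :: "('e \<times> 'a, 'f \<times> 'b, 'c, 'd, nat) biset"
    by (intro biset_reindex[OF that] J cats')
  have "t (B_curry R C D E x) = x" if "x \<in> carrier (B_Hom R (prod_cat C D) E)" for x
    by (rule B_Hom_eqI[OF _ _ linear_map_compose[OF B_curry_linear t] linear_map_id _ that])
      (simp_all add: cats' B_curry_class t_class bisets inv)
  moreover have "B_curry R C D E (t y) = y" if "y \<in> carrier (B_Hom R D (prod_cat E (op_cat C)))" for y
    by (rule B_Hom_eqI[OF _ _ linear_map_compose[OF t B_curry_linear] linear_map_id _ that])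
      (simp_all add: cats' B_curry_class t_class bisets' inv)
  ultimately have "bij_betw (B_curry R C D E) (carrier (B_Hom R (prod_cat C D) E))
      (carrier (B_Hom R D (prod_cat E (op_cat C))))"
    using linear_mapD(1)[OF B_curry_linear[OF cats]] linear_mapD(1)[OF t]
    by (intro bij_betwI[of _ _ _ t]) auto
  then show ?thesis
    using B_curry_linear[OF cats] by (simp add: linear_iso_def)
qed

text \<open>Existence of a bilinear extension makes the choice in \<open>B_comp\<close> meet its
  specification. The value on classes is then freed from \<open>nat\<close>-valued arguments by
  copies, which is what allows composites to be composed again.\<close>

lemma
  assumes fin: "finite_category C" "finite_category D" "finite_category E"
  shows B_comp_bilinear: "bilinear_map R (B_Hom R D E) (B_Hom R C D) (B_Hom R C E) (B_comp R C D E)"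
    and B_comp_class: "biset E D \<Psi> \<Longrightarrow> biset D C \<Omega> \<Longrightarrow>
      B_comp R C D E (B_class R D E \<Psi>) (B_class R C D \<Omega>) = B_class R C E (biset_comp E D C \<Psi> \<Omega>)"
proof -
  note cats = fin[THEN finite_categoryD(1)]
  let ?P = "\<lambda>b. bilinear_map R (B_Hom R D E) (B_Hom R C D) (B_Hom R C E) b \<and>
     (\<forall>(\<Psi> :: ('e, 'f, 'c, 'd, nat) biset) (\<Omega> :: ('c, 'd, 'a, 'b, nat) biset).
        biset E D \<Psi> \<longrightarrow> biset D C \<Omega> \<longrightarrow>
        b (B_class R D E \<Psi>) (B_class R C D \<Omega>) = B_class R C E (biset_comp E D C \<Psi> \<Omega>))"
  have "\<exists>b. ?P b"
  proof (rule bilinear_extend[OF cats(2,3,1,2,1,3)])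
    fix \<Omega> \<Omega>' \<Gamma> :: "('e, 'f, 'c, 'd, nat) biset" and \<Psi> :: "('c, 'd, 'a, 'b, nat) biset"
    assume *: "biset E D \<Omega>" "biset E D \<Omega>'" "biset E D \<Gamma>" "biset D C \<Psi>" "biset_iso E D (biset_union \<Omega> \<Omega>') \<Gamma>"
    have "B_class R C E (biset_comp E D C (biset_union \<Omega> \<Omega>') \<Psi>) = B_class R C E (biset_comp E D C \<Gamma> \<Psi>)"
      using * fin by (intro B_class_cong biset_iso_comp naturally_iso_refl biset_biset_comp biset_biset_union)
    moreover have "B_class R C E (biset_comp E D C (biset_union \<Omega> \<Omega>') \<Psi>)
      = B_class R C E (biset_union (biset_comp E D C \<Omega> \<Psi>) (biset_comp E D C \<Omega>' \<Psi>))"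
      using * fin by (intro B_class_cong biset_comp_union_left biset_biset_comp biset_biset_union)
    ultimately show "B_class R C E (biset_comp E D C \<Gamma> \<Psi>)
      = B_class R C E (biset_union (biset_comp E D C \<Omega> \<Psi>) (biset_comp E D C \<Omega>' \<Psi>))" by simp
  next
    fix \<Omega> :: "('e, 'f, 'c, 'd, nat) biset" and \<Psi> \<Psi>' \<Gamma> :: "('c, 'd, 'a, 'b, nat) biset"
    assume *: "biset E D \<Omega>" "biset D C \<Psi>" "biset D C \<Psi>'" "biset D C \<Gamma>" "biset_iso D C (biset_union \<Psi> \<Psi>') \<Gamma>"
    have "B_class R C E (biset_comp E D C \<Omega> (biset_union \<Psi> \<Psi>')) = B_class R C E (biset_comp E D C \<Omega> \<Gamma>)"
      using * fin by (intro B_class_cong biset_iso_comp naturally_iso_refl biset_biset_comp biset_biset_union)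
    moreover have "B_class R C E (biset_comp E D C \<Omega> (biset_union \<Psi> \<Psi>'))
      = B_class R C E (biset_union (biset_comp E D C \<Omega> \<Psi>) (biset_comp E D C \<Omega> \<Psi>'))"
      using * fin by (intro B_class_cong biset_comp_union_right biset_biset_comp biset_biset_union)
    ultimately show "B_class R C E (biset_comp E D C \<Omega> \<Gamma>)
      = B_class R C E (biset_union (biset_comp E D C \<Omega> \<Psi>) (biset_comp E D C \<Omega> \<Psi>'))" by simp
  qed (use fin in \<open>auto intro: biset_biset_comp biset_iso_comp\<close>)
  then have *: "?P (B_comp R C D E)"
    unfolding B_comp_def biset_iff_is_biset[OF cats(3,2)] biset_iff_is_biset[OF cats(2,1)] by (rule someI_ex)
  then show "bilinear_map R (B_Hom R D E) (B_Hom R C D) (B_Hom R C E) (B_comp R C D E)"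
    by simp
  assume \<Psi>: "biset E D \<Psi>" and \<Omega>: "biset D C \<Omega>"
  obtain \<Psi>' where \<Psi>': "biset E D (\<Psi>' :: ('e, 'f, 'c, 'd, nat) biset)" "biset_iso E D \<Psi> \<Psi>'"
    using biset_nat_copy[OF \<Psi>] .
  obtain \<Omega>' where \<Omega>': "biset D C (\<Omega>' :: ('c, 'd, 'a, 'b, nat) biset)" "biset_iso D C \<Omega> \<Omega>'"
    using biset_nat_copy[OF \<Omega>] .
  have "B_class R C E (biset_comp E D C \<Psi> \<Omega>) = B_class R C E (biset_comp E D C \<Psi>' \<Omega>')"
    by (intro B_class_cong biset_biset_comp biset_iso_comp fin \<Psi> \<Psi>' \<Omega> \<Omega>')
  then show "B_comp R C D E (B_class R D E \<Psi>) (B_class R C D \<Omega>) = B_class R C E (biset_comp E D C \<Psi> \<Omega>)"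
    using * \<Psi>'(1) \<Omega>'(1) B_class_cong[OF \<Psi> \<Psi>'(2)] B_class_cong[OF \<Omega> \<Omega>'(2)] by simp
qed

text \<open>The same argument as for composition, with distributivity of products over unions as the
  input for additivity.\<close>

lemma
  assumes cats: "category C" "category D" "category C'" "category D'"
  shows B_tensor_bilinear:
    "bilinear_map R (B_Hom R C D) (B_Hom R C' D') (B_Hom R (prod_cat C C') (prod_cat D D')) (B_tensor R C D C' D')"
    and B_tensor_class: "biset D C \<Omega> \<Longrightarrow> biset D' C' \<Psi> \<Longrightarrow>
      B_tensor R C D C' D' (B_class R C D \<Omega>) (B_class R C' D' \<Psi>)
        = B_class R (prod_cat C C') (prod_cat D D') (biset_prod \<Omega> \<Psi>)"
proof -
  let ?P = "\<lambda>b. bilinear_map R (B_Hom R C D) (B_Hom R C' D') (B_Hom R (prod_cat C C') (prod_cat D D')) b \<and>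
     (\<forall>(\<Omega> :: ('c, 'd, 'a, 'b, nat) biset) (\<Psi> :: ('g, 'h, 'e, 'f, nat) biset).
        biset D C \<Omega> \<longrightarrow> biset D' C' \<Psi> \<longrightarrow>
        b (B_class R C D \<Omega>) (B_class R C' D' \<Psi>) = B_class R (prod_cat C C') (prod_cat D D') (biset_prod \<Omega> \<Psi>))"
  let ?cl = "B_class R (prod_cat C C') (prod_cat D D')"
  have "\<exists>b. ?P b"
  proof (rule bilinear_extend[OF cats category_prod_cat[OF cats(1,3)] category_prod_cat[OF cats(2,4)]])
    fix \<Omega> \<Omega>' \<Gamma> :: "('c, 'd, 'a, 'b, nat) biset" and \<Psi> :: "('g, 'h, 'e, 'f, nat) biset"
    assume *: "biset D C \<Omega>" "biset D C \<Omega>'" "biset D C \<Gamma>" "biset D' C' \<Psi>" "biset_iso D C (biset_union \<Omega> \<Omega>') \<Gamma>"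
    have "?cl (biset_prod (biset_union \<Omega> \<Omega>') \<Psi>) = ?cl (biset_prod \<Gamma> \<Psi>)"
      using * by (intro B_class_cong biset_iso_prod naturally_iso_refl biset_biset_prod biset_biset_union)
    moreover have "?cl (biset_prod (biset_union \<Omega> \<Omega>') \<Psi>) = ?cl (biset_union (biset_prod \<Omega> \<Psi>) (biset_prod \<Omega>' \<Psi>))"
      using * by (intro B_class_cong biset_prod_union_left biset_biset_prod biset_biset_union)
    ultimately show "?cl (biset_prod \<Gamma> \<Psi>) = ?cl (biset_union (biset_prod \<Omega> \<Psi>) (biset_prod \<Omega>' \<Psi>))" by simp
  next
    fix \<Omega> :: "('c, 'd, 'a, 'b, nat) biset" and \<Psi> \<Psi>' \<Gamma> :: "('g, 'h, 'e, 'f, nat) biset"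
    assume *: "biset D C \<Omega>" "biset D' C' \<Psi>" "biset D' C' \<Psi>'" "biset D' C' \<Gamma>" "biset_iso D' C' (biset_union \<Psi> \<Psi>') \<Gamma>"
    have "?cl (biset_prod \<Omega> (biset_union \<Psi> \<Psi>')) = ?cl (biset_prod \<Omega> \<Gamma>)"
      using * by (intro B_class_cong biset_iso_prod naturally_iso_refl biset_biset_prod biset_biset_union)
    moreover have "?cl (biset_prod \<Omega> (biset_union \<Psi> \<Psi>')) = ?cl (biset_union (biset_prod \<Omega> \<Psi>) (biset_prod \<Omega> \<Psi>'))"
      using * by (intro B_class_cong biset_prod_union_right biset_biset_prod biset_biset_union)
    ultimately show "?cl (biset_prod \<Omega> \<Gamma>) = ?cl (biset_union (biset_prod \<Omega> \<Psi>) (biset_prod \<Omega> \<Psi>'))" by simp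
  qed (auto intro: biset_biset_prod biset_iso_prod)
  then have *: "?P (B_tensor R C D C' D')"
    unfolding B_tensor_def biset_iff_is_biset[OF cats(2,1)] biset_iff_is_biset[OF cats(4,3)] by (rule someI_ex)
  then show "bilinear_map R (B_Hom R C D) (B_Hom R C' D') (B_Hom R (prod_cat C C') (prod_cat D D')) (B_tensor R C D C' D')"
    by simp
  assume \<Omega>: "biset D C \<Omega>" and \<Psi>: "biset D' C' \<Psi>"
  obtain \<Omega>' where \<Omega>': "biset D C (\<Omega>' :: ('c, 'd, 'a, 'b, nat) biset)" "biset_iso D C \<Omega> \<Omega>'"
    using biset_nat_copy[OF \<Omega>] .
  obtain \<Psi>' where \<Psi>': "biset D' C' (\<Psi>' :: ('g, 'h, 'e, 'f, nat) biset)" "biset_iso D' C' \<Psi> \<Psi>'"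
    using biset_nat_copy[OF \<Psi>] .
  have "?cl (biset_prod \<Omega> \<Psi>) = ?cl (biset_prod \<Omega>' \<Psi>')"
    by (intro B_class_cong biset_biset_prod biset_iso_prod \<Psi> \<Psi>' \<Omega> \<Omega>')
  then show "B_tensor R C D C' D' (B_class R C D \<Omega>) (B_class R C' D' \<Psi>) = ?cl (biset_prod \<Omega> \<Psi>)"
    using * \<Psi>'(1) \<Omega>'(1) B_class_cong[OF \<Psi> \<Psi>'(2)] B_class_cong[OF \<Omega> \<Omega>'(2)] by simp
qed

lemma lin_tau:
  "finite_category C \<Longrightarrow> finite_category D \<Longrightarrow> linear_map R X (B_Hom R C D) f
    \<Longrightarrow> linear_map R X (B_Hom R (op_cat D) (op_cat C)) (\<lambda>x. B_tau R C D (f x))"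
  by (rule linear_map_compose[OF _ B_tau_linear[OF finite_categoryD(1) finite_categoryD(1)]])

lemma lin_curry:
  "finite_category C \<Longrightarrow> finite_category D \<Longrightarrow> finite_category E \<Longrightarrow> linear_map R X (B_Hom R (prod_cat C D) E) f
    \<Longrightarrow> linear_map R X (B_Hom R D (prod_cat E (op_cat C))) (\<lambda>x. B_curry R C D E (f x))"
  by (rule linear_map_compose[OF _ B_curry_linear[OF finite_categoryD(1) finite_categoryD(1) finite_categoryD(1)]])

lemmas lin_comp = bilinear_map_rules(1,2)[OF B_comp_bilinear]
lemmas comp_closed = bilinear_map_rules(3)[OF B_comp_bilinear]
lemmas lin_tensor = bilinear_map_rules(1,2)[OF B_tensor_bilinear[OF finite_categoryD(1) finite_categoryD(1)
      finite_categoryD(1) finite_categoryD(1)]]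
lemmas tensor_closed = bilinear_map_rules(3)[OF B_tensor_bilinear[OF finite_categoryD(1) finite_categoryD(1)
      finite_categoryD(1) finite_categoryD(1)]]
lemmas tau_closed = linear_mapD(1)[OF B_tau_linear[OF finite_categoryD(1) finite_categoryD(1)]]
lemmas curry_closed = linear_mapD(1)[OF B_curry_linear[OF finite_categoryD(1) finite_categoryD(1)
      finite_categoryD(1)]]
text \<open>Two collections drive the remaining equations: \<open>lin\<close> proves linearity of
  both sides in each variable, and \<open>class_simps\<close> evaluates both sides on classes,
  leaving a single isomorphism of bisets.\<close>

lemmas lin = linear_map_id lin_comp lin_tensor lin_tau lin_curry comp_closed tensor_closed tau_closed
  curry_closed B_class_closed fin_cats
lemmas class_simps = B_comp_class B_tensor_class B_tau_class B_curry_class finite_categoryD(1)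
  category_prod_cat category_op_cat fin_cats biset_biset_comp biset_biset_prod biset_biset_op

lemma B_Hom_eqI2:
  fixes f g :: "('r, 'o1, 'a1, 'p1, 'b1) B_elt \<Rightarrow> ('r, 'o2, 'a2, 'p2, 'b2) B_elt \<Rightarrow> 'n"
  assumes "category C1" "category D1" "category C2" "category D2"
    and "\<And>y. y \<in> carrier (B_Hom R C2 D2) \<Longrightarrow> linear_map R (B_Hom R C1 D1) N (\<lambda>x. f x y)"
    and "\<And>x. x \<in> carrier (B_Hom R C1 D1) \<Longrightarrow> linear_map R (B_Hom R C2 D2) N (f x)"
    and "\<And>y. y \<in> carrier (B_Hom R C2 D2) \<Longrightarrow> linear_map R (B_Hom R C1 D1) N (\<lambda>x. g x y)"
    and "\<And>x. x \<in> carrier (B_Hom R C1 D1) \<Longrightarrow> linear_map R (B_Hom R C2 D2) N (g x)"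
    and cls: "\<And>(\<Omega> :: ('p1, 'b1, 'o1, 'a1, nat) biset) (\<Psi> :: ('p2, 'b2, 'o2, 'a2, nat) biset).
      biset D1 C1 \<Omega> \<Longrightarrow> biset D2 C2 \<Psi> \<Longrightarrow> f (B_class R C1 D1 \<Omega>) (B_class R C2 D2 \<Psi>)
        = g (B_class R C1 D1 \<Omega>) (B_class R C2 D2 \<Psi>)"
    and x: "x \<in> carrier (B_Hom R C1 D1)" and y: "y \<in> carrier (B_Hom R C2 D2)"
  shows "f x y = g x y"
proof (rule B_Hom_eqI[OF assms(1,2) assms(5,7)[OF y] _ x])
  fix \<Omega> :: "('p1, 'b1, 'o1, 'a1, nat) biset" assume \<Omega>: "biset D1 C1 \<Omega>"
  show "f (B_class R C1 D1 \<Omega>) y = g (B_class R C1 D1 \<Omega>) y"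
    by (rule B_Hom_eqI[OF assms(3,4) assms(6,8)[OF B_class_closed[OF \<Omega>]] cls[OF \<Omega>] y])
qed

section \<open>Functoriality of duality and tensor product, naturality of currying\<close>

lemma B_tau_comp:
  assumes fin: "finite_category C" "finite_category D" "finite_category E"
    and g: "g \<in> carrier (B_Hom R D E)" and f: "f \<in> carrier (B_Hom R C D)"
  shows "B_tau R C E (B_comp R C D E g f)
    = B_comp R (op_cat E) (op_cat D) (op_cat C) (B_tau R C D f) (B_tau R D E g)"
proof (rule B_Hom_eqI2[where f = "\<lambda>g f. B_tau R C E (B_comp R C D E g f)" and g = "\<lambda>g f.
      B_comp R (op_cat E) (op_cat D) (op_cat C) (B_tau R C D f) (B_tau R D E g)", OF _ _ _ _ _ _ _ _ _ g f])
  fix G :: "('e, 'f, 'c, 'd, nat) biset" and F :: "('c, 'd, 'a, 'b, nat) biset"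
  assume *: "biset E D G" "biset D C F"
  have "B_class R (op_cat E) (op_cat C) (biset_comp (op_cat C) (op_cat D) (op_cat E) (biset_op F) (biset_op G))
    = B_class R (op_cat E) (op_cat C) (biset_op (biset_comp E D C G F))"
    using * fin by (intro B_class_cong biset_comp_op biset_biset_comp biset_biset_op fin_cats)
  then show "B_tau R C E (B_comp R C D E (B_class R D E G) (B_class R C D F))
    = B_comp R (op_cat E) (op_cat D) (op_cat C) (B_tau R C D (B_class R C D F)) (B_tau R D E (B_class R D E G))"
    using * fin by (simp add: class_simps)
qed ((assumption | rule lin finite_categoryD(1) fin)+)

lemma B_tensor_comp:
  assumes fin: "finite_category C" "finite_category D" "finite_category E"
      "finite_category C'" "finite_category D'" "finite_category E'"
    and g: "g \<in> carrier (B_Hom R D E)" and f: "f \<in> carrier (B_Hom R C D)"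
    and g': "g' \<in> carrier (B_Hom R D' E')" and f': "f' \<in> carrier (B_Hom R C' D')"
  shows "B_tensor R C E C' E' (B_comp R C D E g f) (B_comp R C' D' E' g' f')
    = B_comp R (prod_cat C C') (prod_cat D D') (prod_cat E E')
        (B_tensor R D E D' E' g g') (B_tensor R C D C' D' f f')"
proof -
  let ?l = "\<lambda>g f g' f'. B_tensor R C E C' E' (B_comp R C D E g f) (B_comp R C' D' E' g' f')"
  let ?r = "\<lambda>g f g' f'. B_comp R (prod_cat C C') (prod_cat D D') (prod_cat E E')
        (B_tensor R D E D' E' g g') (B_tensor R C D C' D' f f')"
  \<comment> \<open>Four variables are reduced to classes in two rounds: here \<open>g\<close> and
    \<open>f\<close> are already classes while \<open>g'\<close> and \<open>f'\<close> are general,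
    and the last step releases \<open>g\<close> and \<open>f\<close>.\<close>
  have "?l (B_class R D E G) (B_class R C D F) g' f' = ?r (B_class R D E G) (B_class R C D F) g' f'"
    if *: "biset E D G" "biset D C F" for G :: "('e, 'f, 'c, 'd, nat) biset" and F :: "('c, 'd, 'a, 'b, nat) biset"
  proof (rule B_Hom_eqI2[where f = "?l (B_class R D E G) (B_class R C D F)"
        and g = "?r (B_class R D E G) (B_class R C D F)", OF _ _ _ _ _ _ _ _ _ g' f'])
    fix G' :: "('k, 'l, 'i, 'j, nat) biset" and F' :: "('i, 'j, 'g, 'h, nat) biset"
    assume **: "biset E' D' G'" "biset D' C' F'"
    have "B_class R (prod_cat C C') (prod_cat E E')
        (biset_comp (prod_cat E E') (prod_cat D D') (prod_cat C C') (biset_prod G G') (biset_prod F F'))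
      = B_class R (prod_cat C C') (prod_cat E E') (biset_prod (biset_comp E D C G F) (biset_comp E' D' C' G' F'))"
      using * ** fin by (intro B_class_cong biset_comp_prod biset_biset_comp biset_biset_prod fin_cats)
    with * ** fin show "?l (B_class R D E G) (B_class R C D F) (B_class R D' E' G') (B_class R C' D' F')
      = ?r (B_class R D E G) (B_class R C D F) (B_class R D' E' G') (B_class R C' D' F')"
      by (simp add: class_simps)
  qed ((assumption | rule lin finite_categoryD(1) fin *)+)
  note cls = this
  show ?thesis
    by (rule B_Hom_eqI2[where f = "\<lambda>g f. ?l g f g' f'" and g = "\<lambda>g f. ?r g f g' f'", OF _ _ _ _ _ _ _ _ _ g f])
      ((rule cls; assumption) | assumption | rule lin finite_categoryD(1) fin g' f')+
qed

lemma B_curry_natural: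
  assumes fin: "finite_category C" "finite_category C'" "finite_category D" "finite_category D'"
      "finite_category E" "finite_category E'"
    and f: "f \<in> carrier (B_Hom R C' C)" and h: "h \<in> carrier (B_Hom R D' D)"
    and g: "g \<in> carrier (B_Hom R E E')" and w: "w \<in> carrier (B_Hom R (prod_cat C D) E)"
  shows "B_curry R C' D' E' (B_comp R (prod_cat C' D') (prod_cat C D) E'
      (B_comp R (prod_cat C D) E E' g w) (B_tensor R C' C D' D f h))
    = B_comp R D' D (prod_cat E' (op_cat C'))
        (B_comp R D (prod_cat E (op_cat C)) (prod_cat E' (op_cat C'))
          (B_tensor R E E' (op_cat C) (op_cat C') g (B_tau R C' C f)) (B_curry R C D E w)) h"
proof -
  let ?l = "\<lambda>f h g w. B_curry R C' D' E' (B_comp R (prod_cat C' D') (prod_cat C D) E'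
      (B_comp R (prod_cat C D) E E' g w) (B_tensor R C' C D' D f h))"
  let ?r = "\<lambda>f h g w. B_comp R D' D (prod_cat E' (op_cat C'))
        (B_comp R D (prod_cat E (op_cat C)) (prod_cat E' (op_cat C'))
          (B_tensor R E E' (op_cat C) (op_cat C') g (B_tau R C' C f)) (B_curry R C D E w)) h"
  \<comment> \<open>As for the interchange law, the variables are treated in pairs,
    \<open>(g, w)\<close> inside and \<open>(f, h)\<close> outside; on four classes the equation is
    \<open>biset_comp_curry\<close>.\<close>
  have "?l (B_class R C' C F) (B_class R D' D H) g w = ?r (B_class R C' C F) (B_class R D' D H) g w"
    if *: "biset C C' F" "biset D D' H" for F :: "('a, 'b, 'c, 'd, nat) biset" and H :: "('e, 'f, 'g, 'h, nat) biset"
  proof (rule B_Hom_eqI2[where f = "?l (B_class R C' C F) (B_class R D' D H)"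
        and g = "?r (B_class R C' C F) (B_class R D' D H)", OF _ _ _ _ _ _ _ _ _ g w])
    fix G :: "('k, 'l, 'i, 'j, nat) biset" and W :: "('i, 'j, 'a \<times> 'e, 'b \<times> 'f, nat) biset"
    assume **: "biset E' E G" "biset E (prod_cat C D) W"
    have W: "biset (prod_cat E (op_cat C)) D (reindex assocr assocr W)"
      by (intro biset_reindex[OF **(2)] category_prod_cat category_op_cat cat_iso.K[OF cat_iso_assoc]
          fin[THEN finite_categoryD(1)])
    have "B_class R D' (prod_cat E' (op_cat C'))
        (biset_comp (prod_cat E' (op_cat C')) D D'
          (biset_comp (prod_cat E' (op_cat C')) (prod_cat E (op_cat C)) D
            (biset_prod G (biset_op F)) (reindex assocr assocr W)) H)
      = B_class R D' (prod_cat E' (op_cat C'))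
        (reindex assocr assocr (biset_comp E' (prod_cat C D) (prod_cat C' D')
          (biset_comp E' E (prod_cat C D) G W) (biset_prod F H)))"
      using * ** W fin
      by (intro B_class_cong biset_comp_curry biset_biset_comp biset_biset_prod biset_biset_op fin_cats)
    with * ** W fin show "?l (B_class R C' C F) (B_class R D' D H) (B_class R E E' G) (B_class R (prod_cat C D) E W)
      = ?r (B_class R C' C F) (B_class R D' D H) (B_class R E E' G) (B_class R (prod_cat C D) E W)"
      by (simp add: class_simps)
  qed ((assumption | rule lin finite_categoryD(1) fin *)+)
  note cls = this
  show ?thesis
    by (rule B_Hom_eqI2[where f = "\<lambda>f h. ?l f h g w" and g = "\<lambda>f h. ?r f h g w", OF _ _ _ _ _ _ _ _ _ f h])
      ((rule cls; assumption) | assumption | rule lin finite_categoryD(1) fin g w)+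
qed

lemma B_tau_id: "finite_category C \<Longrightarrow> B_tau R C C (B_id R C) = B_id R (op_cat C)"
  unfolding B_id_def
  by (simp add: B_tau_class finite_categoryD biset_biset_id
      B_class_cong[OF biset_biset_op[OF biset_biset_id] biset_op_id])

lemma B_tensor_id:
  "finite_category C \<Longrightarrow> finite_category D \<Longrightarrow>
    B_tensor R C C D D (B_id R C) (B_id R D) = B_id R (prod_cat C D)"
  unfolding B_id_def
  by (simp add: B_tensor_class finite_categoryD biset_biset_id
      B_class_cong[OF biset_biset_prod[OF biset_biset_id biset_biset_id] biset_prod_id])

section \<open>The associativity isomorphism between iterated internal Homs\<close>

definition B_assoc ::
  "('o, 'a) cat \<Rightarrow> ('p, 'b) cat \<Rightarrow> ('q, 'c) cat
    \<Rightarrow> ('r, 'q \<times> 'o \<times> 'p, 'c \<times> 'a \<times> 'b, ('q \<times> 'o) \<times> 'p, ('c \<times> 'a) \<times> 'b) B_elt" where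
  "B_assoc C D E = B_class R (prod_cat E (op_cat (prod_cat C D))) (prod_cat (prod_cat E (op_cat C)) (op_cat D))
     (cat_iso.rep (prod_cat (prod_cat E (op_cat C)) (op_cat D)) assocl assocl)"

lemma B_assoc_iso:
  assumes fin: "finite_category C" "finite_category D" "finite_category E"
  shows "B_iso R (prod_cat E (op_cat (prod_cat C D))) (prod_cat (prod_cat E (op_cat C)) (op_cat D)) (B_assoc C D E)"
proof -
  let ?A = "prod_cat (prod_cat E (op_cat C)) (op_cat D)" and ?B = "prod_cat E (op_cat (prod_cat C D))"
  interpret I: cat_iso ?A ?B assocl assocl assocr assocr
    by (intro cat_iso_assoc fin[THEN finite_categoryD(1)])
  interpret S: cat_iso ?B ?A assocr assocr assocl assocl by (rule I.swap)
  have fin': "finite_category ?A" "finite_category ?B"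
    by (intro fin_cats fin)+
  note bisets = I.biset_rep[OF fin'(1)] S.biset_rep[OF fin'(2)]
  have "B_comp R ?B ?A ?B (B_class R ?A ?B S.rep) (B_assoc C D E) = B_id R ?B"
    unfolding B_assoc_def B_id_def
    using B_class_cong[OF biset_biset_comp[OF bisets(2,1) fin'(1)] S.rep_inverse[OF fin'(2,1)]]
    by (simp add: B_comp_class fin' bisets)
  moreover have "B_comp R ?A ?B ?A (B_assoc C D E) (B_class R ?A ?B S.rep) = B_id R ?A"
    unfolding B_assoc_def B_id_def
    using B_class_cong[OF biset_biset_comp[OF bisets fin'(2)] I.rep_inverse[OF fin']]
    by (simp add: B_comp_class fin' bisets)
  ultimately show ?thesis
    unfolding B_iso_def using B_class_closed[OF bisets(1)] B_class_closed[OF bisets(2)]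
    by (auto simp: B_assoc_def)
qed

text \<open>Both composites contain a representable factor, on the left in one and on the right in
  the other. \<open>comp_rep\<close> and \<open>rep_comp\<close> remove it, leaving two reindexed
  products with values in triples that differ only in their bracketing.\<close>

lemma B_assoc_natural:
  assumes fin: "finite_category C" "finite_category C'" "finite_category D" "finite_category D'"
      "finite_category E" "finite_category E'"
    and f: "f \<in> carrier (B_Hom R C' C)" and h: "h \<in> carrier (B_Hom R D' D)"
    and g: "g \<in> carrier (B_Hom R E E')"
  shows "B_comp R (prod_cat E (op_cat (prod_cat C D))) (prod_cat E' (op_cat (prod_cat C' D')))
      (prod_cat (prod_cat E' (op_cat C')) (op_cat D')) (B_assoc C' D' E')
      (B_tensor R E E' (op_cat (prod_cat C D)) (op_cat (prod_cat C' D')) g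
        (B_tau R (prod_cat C' D') (prod_cat C D) (B_tensor R C' C D' D f h)))
    = B_comp R (prod_cat E (op_cat (prod_cat C D))) (prod_cat (prod_cat E (op_cat C)) (op_cat D))
      (prod_cat (prod_cat E' (op_cat C')) (op_cat D'))
      (B_tensor R (prod_cat E (op_cat C)) (prod_cat E' (op_cat C')) (op_cat D) (op_cat D')
        (B_tensor R E E' (op_cat C) (op_cat C') g (B_tau R C' C f)) (B_tau R D' D h))
      (B_assoc C D E)"
proof -
  let ?A = "prod_cat (prod_cat E (op_cat C)) (op_cat D)" and ?B = "prod_cat E (op_cat (prod_cat C D))"
  let ?A' = "prod_cat (prod_cat E' (op_cat C')) (op_cat D')" and ?B' = "prod_cat E' (op_cat (prod_cat C' D'))"
  let ?l = "\<lambda>f h g. B_comp R ?B ?B' ?A' (B_assoc C' D' E')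
      (B_tensor R E E' (op_cat (prod_cat C D)) (op_cat (prod_cat C' D')) g
        (B_tau R (prod_cat C' D') (prod_cat C D) (B_tensor R C' C D' D f h)))"
  let ?r = "\<lambda>f h g. B_comp R ?B ?A ?A'
      (B_tensor R (prod_cat E (op_cat C)) (prod_cat E' (op_cat C')) (op_cat D) (op_cat D')
        (B_tensor R E E' (op_cat C) (op_cat C') g (B_tau R C' C f)) (B_tau R D' D h))
      (B_assoc C D E)"
  interpret I: cat_iso ?A ?B assocl assocl assocr assocr
    by (intro cat_iso_assoc fin[THEN finite_categoryD(1)])
  interpret I': cat_iso ?A' ?B' assocl assocl assocr assocr
    by (intro cat_iso_assoc fin[THEN finite_categoryD(1)])
  have fin': "finite_category ?A" "finite_category ?B" "finite_category ?A'" "finite_category ?B'"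
    by (intro fin_cats fin)+
  have reps: "biset ?A ?B I.rep" "biset ?A' ?B' I'.rep"
    by (intro I.biset_rep I'.biset_rep fin')+
  have assoc_closed: "B_assoc C D E \<in> carrier (B_Hom R ?B ?A)" "B_assoc C' D' E' \<in> carrier (B_Hom R ?B' ?A')"
    unfolding B_assoc_def by (intro B_class_closed reps)+
  have "?l (B_class R C' C F) (B_class R D' D H) g = ?r (B_class R C' C F) (B_class R D' D H) g"
    if *: "biset C C' F" "biset D D' H" for F :: "('a, 'b, 'c, 'd, nat) biset" and H :: "('e, 'f, 'g, 'h, nat) biset"
  proof (rule B_Hom_eqI[where f = "?l (B_class R C' C F) (B_class R D' D H)"
        and g = "?r (B_class R C' C F) (B_class R D' D H)", OF _ _ _ _ _ g])
    fix G :: "('k, 'l, 'i, 'j, nat) biset"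
    assume **: "biset E' E G"
    let ?X = "biset_prod G (biset_op (biset_prod F H))" and ?Y = "biset_prod (biset_prod G (biset_op F)) (biset_op H)"
    have X: "biset ?B' ?B ?X" and Y: "biset ?A' ?A ?Y"
      by (intro biset_biset_prod biset_biset_op * **)+
    \<comment> \<open>Here \<open>?X\<close> is reindexed in its left variable and \<open>?Y\<close>
      in its right one, so that both become bisets over the same pair of categories; reassociating
      the elements compares them.\<close>
    have "biset_iso ?A' ?B (reindex (map_prod assocr id) (map_prod assocr id) ?X)
        (reindex (map_prod id assocl) (map_prod id assocl) ?Y)"
      by (rule biset_isoI[of _ _ _ "\<lambda>_ _. assocl" _ "\<lambda>_ _. assocr"]) auto
    then have "B_class R ?B ?A' (biset_comp ?A' ?B' ?B I'.rep ?X)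
        = B_class R ?B ?A' (reindex (map_prod id assocl) (map_prod id assocl) ?Y)"
      by (intro B_class_cong biset_biset_comp[OF reps(2) X fin'(4)] naturally_iso_trans[OF _ I'.comp_rep[OF fin'(3,4) X]]
          category_prod_cat category_op_cat I'.A.category_axioms I.B.category_axioms)
    also have "\<dots> = B_class R ?B ?A' (biset_comp ?A' ?A ?B ?Y I.rep)"
      by (intro B_class_cong[symmetric] biset_biset_comp[OF Y reps(1) fin'(1)] I.rep_comp[OF fin'(1,2) Y])
    finally show "?l (B_class R C' C F) (B_class R D' D H) (B_class R E E' G)
      = ?r (B_class R C' C F) (B_class R D' D H) (B_class R E E' G)"
      using * ** fin X Y reps by (simp add: class_simps B_assoc_def)
  qed ((assumption | rule lin finite_categoryD(1) fin * assoc_closed)+)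
  note cls = this
  show ?thesis
    by (rule B_Hom_eqI2[where f = "\<lambda>f h. ?l f h g" and g = "\<lambda>f h. ?r f h g", OF _ _ _ _ _ _ _ _ _ f h])
      ((rule cls; assumption) | assumption | rule lin finite_categoryD(1) fin g assoc_closed)+
qed

end

theorem proposition9p4:
  fixes R :: "('r, 'm) ring_scheme"
  assumes "cring R"
  shows
    "(\<comment> \<open>\<open>\<H>\<close> is a functor, contravariant in the first and covariant in the second variable\<close>
      (\<forall>(C :: ('o1, 'a1) cat) (E :: ('o3, 'a3) cat).
         finite_category C \<longrightarrow> finite_category E \<longrightarrow>
         finite_category (intern_hom C E) \<and>
         intern_hom_mor R C C E E (B_id R C) (B_id R E) = B_id R (intern_hom C E)) \<and>
      (\<forall>(C :: ('o1, 'a1) cat) (C' :: ('o1, 'a1) cat) (E :: ('o3, 'a3) cat) (E' :: ('o3, 'a3) cat).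
         finite_category C \<longrightarrow> finite_category C' \<longrightarrow> finite_category E \<longrightarrow> finite_category E' \<longrightarrow>
         (\<forall>f \<in> carrier (B_Hom R C' C). \<forall>g \<in> carrier (B_Hom R E E').
            intern_hom_mor R C' C E E' f g
              \<in> carrier (B_Hom R (intern_hom C E) (intern_hom C' E')))) \<and>
      (\<forall>(C :: ('o1, 'a1) cat) (C' :: ('o1, 'a1) cat) (C'' :: ('o1, 'a1) cat)
        (E :: ('o3, 'a3) cat) (E' :: ('o3, 'a3) cat) (E'' :: ('o3, 'a3) cat).
         finite_category C \<longrightarrow> finite_category C' \<longrightarrow> finite_category C'' \<longrightarrow>
         finite_category E \<longrightarrow> finite_category E' \<longrightarrow> finite_category E'' \<longrightarrow>
         (\<forall>f \<in> carrier (B_Hom R C' C). \<forall>f' \<in> carrier (B_Hom R C'' C').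
          \<forall>g \<in> carrier (B_Hom R E E'). \<forall>g' \<in> carrier (B_Hom R E' E'').
            intern_hom_mor R C'' C E E'' (B_comp R C'' C' C f f') (B_comp R E E' E'' g' g)
              = B_comp R (intern_hom C E) (intern_hom C' E') (intern_hom C'' E'')
                  (intern_hom_mor R C'' C' E' E'' f' g') (intern_hom_mor R C' C E E' f g)))) \<and>
     (\<comment> \<open>\<open>R\<close>-linear isomorphisms \<open>Hom(C \<times> D, E) \<cong> Hom(D, \<H>(C, E))\<close>, natural in \<open>C\<close>, \<open>D\<close>, \<open>E\<close>\<close>
      \<exists>\<Phi>.
      (\<forall>(C :: ('o1, 'a1) cat) (D :: ('o2, 'a2) cat) (E :: ('o3, 'a3) cat).
         finite_category C \<longrightarrow> finite_category D \<longrightarrow> finite_category E \<longrightarrow>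
         linear_iso R (B_Hom R (prod_cat C D) E) (B_Hom R D (intern_hom C E)) (\<Phi> C D E)) \<and>
      (\<forall>(C :: ('o1, 'a1) cat) (C' :: ('o1, 'a1) cat) (D :: ('o2, 'a2) cat) (D' :: ('o2, 'a2) cat)
        (E :: ('o3, 'a3) cat) (E' :: ('o3, 'a3) cat).
         finite_category C \<longrightarrow> finite_category C' \<longrightarrow> finite_category D \<longrightarrow> finite_category D' \<longrightarrow>
         finite_category E \<longrightarrow> finite_category E' \<longrightarrow>
         (\<forall>f \<in> carrier (B_Hom R C' C). \<forall>h \<in> carrier (B_Hom R D' D).
          \<forall>g \<in> carrier (B_Hom R E E'). \<forall>w \<in> carrier (B_Hom R (prod_cat C D) E).
            \<Phi> C' D' E' (B_comp R (prod_cat C' D') (prod_cat C D) E'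
                (B_comp R (prod_cat C D) E E' g w) (B_tensor R C' C D' D f h))
              = B_comp R D' D (intern_hom C' E')
                  (B_comp R D (intern_hom C E) (intern_hom C' E')
                    (intern_hom_mor R C' C E E' f g) (\<Phi> C D E w)) h))) \<and>
     (\<comment> \<open>isomorphisms \<open>\<H>(C \<times> D, E) \<cong> \<H>(D, \<H>(C, E))\<close> in the biset category, natural in \<open>C\<close>, \<open>D\<close>, \<open>E\<close>\<close>
      \<exists>\<Theta>.
      (\<forall>(C :: ('o1, 'a1) cat) (D :: ('o2, 'a2) cat) (E :: ('o3, 'a3) cat).
         finite_category C \<longrightarrow> finite_category D \<longrightarrow> finite_category E \<longrightarrow>
         B_iso R (intern_hom (prod_cat C D) E) (intern_hom D (intern_hom C E)) (\<Theta> C D E)) \<and>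
      (\<forall>(C :: ('o1, 'a1) cat) (C' :: ('o1, 'a1) cat) (D :: ('o2, 'a2) cat) (D' :: ('o2, 'a2) cat)
        (E :: ('o3, 'a3) cat) (E' :: ('o3, 'a3) cat).
         finite_category C \<longrightarrow> finite_category C' \<longrightarrow> finite_category D \<longrightarrow> finite_category D' \<longrightarrow>
         finite_category E \<longrightarrow> finite_category E' \<longrightarrow>
         (\<forall>f \<in> carrier (B_Hom R C' C). \<forall>h \<in> carrier (B_Hom R D' D).
          \<forall>g \<in> carrier (B_Hom R E E').
            B_comp R (intern_hom (prod_cat C D) E) (intern_hom (prod_cat C' D') E')
                (intern_hom D' (intern_hom C' E')) (\<Theta> C' D' E')
                (intern_hom_mor R (prod_cat C' D') (prod_cat C D) E E' (B_tensor R C' C D' D f h) g)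
              = B_comp R (intern_hom (prod_cat C D) E) (intern_hom D (intern_hom C E))
                  (intern_hom D' (intern_hom C' E'))
                  (intern_hom_mor R D' D (intern_hom C E) (intern_hom C' E') h
                    (intern_hom_mor R C' C E E' f g))
                  (\<Theta> C D E))))"
proof -
  interpret scalars R using assms by (simp add: scalars_def)
  show ?thesis
    unfolding intern_hom_mor_def intern_hom_def
  proof (intro conjI allI impI ballI exI[of _ "B_curry R"] exI[of _ B_assoc])
    fix C :: "('o1, 'a1) cat" and E :: "('o3, 'a3) cat"
    assume "finite_category C" "finite_category E"
    then show "finite_category (prod_cat E (op_cat C))"
      "B_tensor R E E (op_cat C) (op_cat C) (B_id R E) (B_tau R C C (B_id R C)) = B_id R (prod_cat E (op_cat C))"
      by (simp_all add: fin_cats B_tau_id B_tensor_id)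
  next
    fix C C' :: "('o1, 'a1) cat" and E E' :: "('o3, 'a3) cat" and f g
    assume "finite_category C" "finite_category C'" "finite_category E" "finite_category E'"
      "f \<in> carrier (B_Hom R C' C)" "g \<in> carrier (B_Hom R E E')"
    then show "B_tensor R E E' (op_cat C) (op_cat C') g (B_tau R C' C f)
      \<in> carrier (B_Hom R (prod_cat E (op_cat C)) (prod_cat E' (op_cat C')))"
      by - (assumption | rule lin)+
  next
    fix C C' C'' :: "('o1, 'a1) cat" and E E' E'' :: "('o3, 'a3) cat" and f f' g g'
    assume *: "finite_category C" "finite_category C'" "finite_category C''"
      "finite_category E" "finite_category E'" "finite_category E''"
      "f \<in> carrier (B_Hom R C' C)" "f' \<in> carrier (B_Hom R C'' C')"
      "g \<in> carrier (B_Hom R E E')" "g' \<in> carrier (B_Hom R E' E'')"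
    then have "B_tau R C' C f \<in> carrier (B_Hom R (op_cat C) (op_cat C'))"
      "B_tau R C'' C' f' \<in> carrier (B_Hom R (op_cat C') (op_cat C''))"
      by - (assumption | rule lin finite_categoryD(1))+
    with * show "B_tensor R E E'' (op_cat C) (op_cat C'') (B_comp R E E' E'' g' g) (B_tau R C'' C (B_comp R C'' C' C f f'))
      = B_comp R (prod_cat E (op_cat C)) (prod_cat E' (op_cat C')) (prod_cat E'' (op_cat C''))
          (B_tensor R E' E'' (op_cat C') (op_cat C'') g' (B_tau R C'' C' f'))
          (B_tensor R E E' (op_cat C) (op_cat C') g (B_tau R C' C f))"
      \<comment> \<open>Duality reverses the composite of \<open>f\<close> and \<open>f'\<close>,
        which matches the order of the covariant composite in the other factor; the interchange law
        then separates the two tensors.\<close>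
      by (simp add: B_tau_comp B_tensor_comp fin_cats)
  qed (assumption | rule B_curry_iso B_curry_natural B_assoc_iso B_assoc_natural finite_categoryD(1))+
qed

end
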